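(* Let $0<\theta<\pi$ be given. For $s\in\mathbb{C}$ with $|s-1|\ge 2\pi$ and $\theta<\arg(s-1)<2\pi-\theta$ we have $$\mathcal{R}(s)=\chi(s)\Bigl(\zeta(1-s)-\sum_{n=1}^{m}\frac{1}{n^{1-s}}+\frac{(-1)^m}{2i}\,\eta^{s-1}e^{-\pi i\eta^2}\,\overline{G}(p)\bigl(1+O_\theta(|\eta|^{-1})\bigr)\Bigr),$$ where the implied constant depends only on $\theta$, and $\eta,m,p,\overline{G},\chi$ are as in the context.
   Context: Riemann's auxiliary function is the entire function $$\mathcal{R}(s)=\int_{0\swarrow1}\frac{x^{-s}e^{\pi i x^2}}{e^{\pi i x}-e^{-\pi i x}}\,dx,$$ where the path is a straight line of direction $e^{-3\pi i/4}$ (running from the upper right to the lower left) crossing the real axis at a point strictly between $0$ and $1$, and $x^{-s}=\exp(-s\log x)$ with the principal logarithm. $\zeta$ is the Riemann zeta function and $\chi(s)=\pi^{s-\frac12}\Gamma(\frac{1-s}{2})/\Gamma(\frac{s}{2})$, so that $\zeta(s)=\chi(s)\zeta(1-s)$. Here $\arg(s-1)$ is taken in $(0,2\pi)$. Put $\eta=\sqrt{(s-1)/(2\pi i)}$ with $-\frac{\pi}{4}<\arg\eta<\frac{3\pi}{4}$, $\eta_1=\operatorname{Re}\eta$, $\eta_2=\operatorname{Im}\eta$, $m=\lfloor\eta_1+\eta_2\rfloor\ (\ge0)$, $p=-2(m+\tfrac12-\eta)$; $\eta^{s-1}=\exp((s-1)\log\eta)$ with $\log\eta=\log|\eta|+i\arg\eta$.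 $G$ is the entire function $$G(q)=\frac{e^{\frac{\pi i}{2}q^2}-\sqrt2\,e^{\frac{\pi i}{8}}\cos\frac{\pi q}{2}}{\cos\pi q}$$ (with removable singularities removed), and $\overline{G}(p):=\overline{G(\overline{p})}$. *)

theory Defs
  imports "HOL-Complex_Analysis.Complex_Analysis"
begin

text \<open>
  The line of direction \<open>e\<^bsup>-3\<pi>i/4\<^esup>\<close> through \<open>c\<close> is parametrised by \<open>x = c + t e\<^bsup>-3\<pi>i/4\<^esup>\<close> with
  \<open>t\<close> running from \<open>-\<infinity>\<close> to \<open>\<infinity>\<close>. Only \<open>0 < c < 1\<close> is meant: the line then avoids the cut of
  the principal logarithm and the zeros of the denominator, the integral converges absolutely
  (\<open>\<bar>e\<^bsup>\<pi>ix\<^sup>2\<^esup>\<bar>\<close> decays like \<open>e\<^bsup>-\<pi>t\<^sup>2\<^esup>\<close>), and by Cauchy's theorem its value does not depend on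
  \<open>c\<close>; statements about the auxiliary function are made for every such \<open>c\<close>.
\<close>
definition riemann_aux :: "real \<Rightarrow> complex \<Rightarrow> complex" where
  "riemann_aux c s =
     (\<integral>t. (let x = of_real c + of_real t * cis (- (3 * pi / 4)) in
            exp (- s * Ln x) * exp (of_real pi * \<i> * x\<^sup>2) /
            (exp (of_real pi * \<i> * x) - exp (- (of_real pi * \<i> * x))) * cis (- (3 * pi / 4)))
        \<partial>lborel)"

text \<open>
  Analytic continuation of the Dirichlet series; it is unique on \<open>UNIV - {1}\<close>, which is
  connected. The value at the pole is left unspecified.
\<close>
definition riemann_zeta :: "complex \<Rightarrow> complex" where
  "riemann_zeta =
     (SOME f. f holomorphic_on (UNIV - {1}) \<and>
        (\<forall>s. Re s > 1 \<longrightarrow> (\<lambda>n. 1 / of_nat (Suc n) powr s) sums f s))"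

text \<open>
  \<open>rGamma\<close> is the entire function \<open>1/\<Gamma>\<close>, so the zeros at \<open>s = 0, -2, -4, \<dots>\<close> come out right;
  at the poles \<open>s = 1, 3, 5, \<dots>\<close> the value is junk.
\<close>
definition zeta_chi :: "complex \<Rightarrow> complex" where
  "zeta_chi s = of_real pi powr (s - 1/2) * Gamma ((1 - s) / 2) * rGamma (s / 2)"

text \<open>
  The range of arguments lies inside that of the principal argument, hence \<open>Arg\<close> here and
  the principal power \<open>\<eta> powr (s - 1) = exp ((s - 1) * Ln \<eta>)\<close> below agree with the branch
  \<open>log \<eta> = log \<bar>\<eta>\<bar> + i arg \<eta>\<close>.
\<close>
definition eta :: "complex \<Rightarrow> complex" where
  "eta s = (THE \<eta>. \<eta>\<^sup>2 = (s - 1) / (2 * of_real pi * \<i>) \<and> - (pi / 4) < Arg \<eta> \<and> Arg \<eta> < 3 * pi / 4)"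

lemma eta_ex1:
  assumes "0 < Arg2pi (s - 1)"
  shows "\<exists>!\<eta>. \<eta>\<^sup>2 = (s - 1) / (2 * of_real pi * \<i>) \<and> - (pi / 4) < Arg \<eta> \<and> Arg \<eta> < 3 * pi / 4"
proof -
  define a where "a = Arg2pi (s - 1)"
  have a: "0 < a" "a < 2 * pi"
    using assms Arg2pi_lt_2pi[of "s - 1"] by (auto simp: a_def)
  have nz: "s - 1 \<noteq> 0" using assms by (auto simp: Arg2pi_0)
  define r where "r = sqrt (norm (s - 1) / (2 * pi))"
  have r: "r > 0" "r\<^sup>2 = norm (s - 1) / (2 * pi)"
    using nz by (auto simp: r_def)
  define e where "e = of_real r * cis (a / 2 - pi / 4)"
  have s1: "s - 1 = of_real (norm (s - 1)) * cis a"
    using Arg2pi_eq[of "s - 1"] by (simp add: a_def cis_conv_exp)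
  have "cis (a / 2 - pi / 4) ^ 2 = cis (a - pi / 2)"
    by (simp add: Complex.DeMoivre algebra_simps)
  also have "\<dots> = cis a / \<i>"
    by (simp flip: cis_divide)
  finally have "e\<^sup>2 = of_real (r\<^sup>2) * (cis a / \<i>)"
    by (simp add: e_def power_mult_distrib)
  also have "\<dots> = of_real (norm (s - 1)) * cis a / (2 * of_real pi * \<i>)"
    by (simp add: r(2) field_simps)
  finally have sq: "e\<^sup>2 = (s - 1) / (2 * of_real pi * \<i>)"
    using s1 by simp
  have arge: "Arg e = a / 2 - pi / 4"
    unfolding e_def using a r by (intro cis_Arg_unique) (auto simp: sgn_mult sgn_of_real)
  show ?thesis
  proof (rule ex1I[of _ e])
    show "e\<^sup>2 = (s - 1) / (2 * of_real pi * \<i>) \<and> - (pi / 4) < Arg e \<and> Arg e < 3 * pi / 4"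
      using sq arge a by auto
  next
    fix y
    assume y: "y\<^sup>2 = (s - 1) / (2 * of_real pi * \<i>) \<and> - (pi / 4) < Arg y \<and> Arg y < 3 * pi / 4"
    then have "y = e \<or> y = - e" using sq by (metis power2_eq_iff)
    moreover have "y \<noteq> - e"
    proof
      assume "y = - e"
      moreover have "e \<noteq> 0" using r by (simp add: e_def)
      ultimately have "Arg y = (if Arg e \<le> 0 then Arg e + pi else Arg e - pi)"
        by (simp add: Arg_minus)
      then show False using y arge a by (auto split: if_splits)
    qed
    ultimately show "y = e" by blast
  qed
qed

text \<open>
  Under the bounds on \<open>Arg \<eta>\<close> the floor is nonnegative, so that \<open>nat\<close> does not truncate.
\<close>
definition eta_floor :: "complex \<Rightarrow> nat" where
  "eta_floor s = nat \<lfloor>Re (eta s) + Im (eta s)\<rfloor>"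

definition eta_p :: "complex \<Rightarrow> complex" where
  "eta_p s = - 2 * (of_nat (eta_floor s) + 1/2 - eta s)"

definition riemann_G :: "complex \<Rightarrow> complex" where
  "riemann_G = remove_sings (\<lambda>q.
     (exp (of_real pi * \<i> / 2 * q\<^sup>2)
        - of_real (sqrt 2) * exp (of_real pi * \<i> / 8) * cos (of_real pi * q / 2))
     / cos (of_real pi * q))"

definition riemann_G_bar :: "complex \<Rightarrow> complex" where
  "riemann_G_bar p = cnj (riemann_G (cnj p))"

end

theory Submission
  imports Defs "HOL-Probability.Distributions"
begin

text \<open>
  Conjugating, \<open>riemann_aux\<close> becomes an integral of \<open>x\<^sup>-\<^sup>s e\<^bsup>-\<pi>ix\<^sup>2\<^esup> / (e\<^bsup>\<pi>ix\<^esup> - e\<^bsup>-\<pi>ix\<^esup>)\<close> along the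
  direction \<open>e\<^bsup>-\<pi>i/4\<^esup>\<close>, called \<open>riemann_aux_bar\<close> below. Letting its line tend to \<open>0\<close> and inserting
  the closed form of Mordell's integral gives \<open>R(s) = \<chi>(s) (\<zeta>(1 - s) - R_bar(1 - s))\<close>, which also
  provides the continuation of \<open>\<zeta>\<close>. Moving the line of \<open>R_bar(1 - s)\<close> across \<open>1, \<dots>, m\<close> splits off the
  finite sum and leaves an integral whose numerator has its saddle point at \<open>\<eta>\<close>. On the line through
  \<open>\<eta>\<close> the modulus of the numerator is explicit and dominated by a Gaussian, uniformly in the sector,
  so replacing the phase by its quadratic part costs a relative error \<open>O(1/\<bar>\<eta>\<bar>)\<close> and leaves
  another Mordell integral, \<open>i/2\<close> times the conjugate of \<open>G\<close> at \<open>p\<close>. The error is relative to the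
  main term because \<open>\<bar>Re p + Im p\<bar> \<le> 1\<close> and \<open>G_bar\<close> has no zero in that strip: the zeros
  \<open>p = \<plusminus>1/2\<close> of its numerator there are cancelled by the denominator.
\<close>

section \<open>Integrals along lines\<close>

text \<open>After conjugation the exponent (s - 1) log x - pi i x^2 is stationary at x = eta, and
  the fixed direction \<open>se\<close> is its direction of steepest descent there, since
  \<open>se\<close>^2 = -i makes -2 pi i (x - eta)^2 real and negative. A straight line thus serves
  both as path of integration and as descent path. Two obstacles shape the estimate. The line
  through eta may pass close to an integer, a pole of the kernel, so the line through m + 1/2 is
  used, at horizontal distance at most 1/2 from eta; the price is a factor exp (O(|u| + 1)) that the
  Gaussian absorbs. And the main term can be as small as exp (-pi |Im eta|), because of the sine in
  the denominator, so an absolute error O(1/|eta|) would not do: the same factor is carried through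
  the error and matched by a lower bound for the main term. The angle theta enters only through sin
  (theta/2), which bounds the relative distance of eta from the line Re + Im = 0.\<close>

lemma has_bochner_integral_inverse_square_tail:
  fixes r :: real
  assumes "r > 0"
  shows "has_bochner_integral lborel (\<lambda>t. indicator {t. r \<le> \<bar>t\<bar>} t *\<^sub>R (1 / t\<^sup>2)) (2 / r)"
proof -
  have "has_bochner_integral lborel (\<lambda>t. indicator {r..} t *\<^sub>R (1 / t\<^sup>2)) (1 / r)"
  proof (rule has_bochner_integral_nn_integral)
    have "(\<integral>\<^sup>+t. ennreal (1 / t\<^sup>2) * indicator {r..} t \<partial>lborel) = ennreal (0 - (- (1 / r)))"
    proof (rule nn_integral_FTC_atLeast)
      fix t :: real assume "r \<le> t"
      then show "((\<lambda>t. - (1 / t)) has_real_derivative 1 / t\<^sup>2) (at t)"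
        using assms by (auto intro!: derivative_eq_intros simp: power2_eq_square)
    next
      show "((\<lambda>t::real. - (1 / t)) \<longlongrightarrow> 0) at_top"
        using tendsto_minus[OF tendsto_inverse_0_at_top[OF filterlim_ident[of "at_top::real filter"]]]
        by (simp add: inverse_eq_divide)
    qed auto
    moreover have "ennreal (1 / t\<^sup>2) * indicator {r..} t = ennreal (indicator {r..} t *\<^sub>R (1 / t\<^sup>2))" for t
      by (auto split: split_indicator)
    ultimately show "(\<integral>\<^sup>+t. ennreal (indicator {r..} t *\<^sub>R (1 / t\<^sup>2)) \<partial>lborel) = ennreal (1 / r)"
      by simp
  qed (use assms in auto)
  also have "(\<lambda>t. indicator {r..} t *\<^sub>R (1 / t\<^sup>2)) =
      (\<lambda>t. indicator {0..} t *\<^sub>R (indicator {t. r \<le> \<bar>t\<bar>} t *\<^sub>R (1 / t\<^sup>2)))"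
    using assms by (auto simp: fun_eq_iff split: split_indicator)
  finally have "has_bochner_integral lborel (\<lambda>t. indicator {t. r \<le> \<bar>t\<bar>} t *\<^sub>R (1 / t\<^sup>2)) (2 *\<^sub>R (1 / r))"
    by (rule has_bochner_integral_even_function) (auto simp: indicator_def)
  then show ?thesis by simp
qed

text \<open>A bound A / t^2 outside a compact interval is the common form of decay below: it covers
  Gaussians as well as differences of simple poles, and its tail is explicit.\<close>

lemma inverse_square_decay_integrable:
  fixes h :: "real \<Rightarrow> complex"
  assumes cont: "continuous_on UNIV h" and "T > 0" and bd: "\<And>t. T \<le> \<bar>t\<bar> \<Longrightarrow> norm (h t) \<le> A / t\<^sup>2"
  shows "integrable lborel h"
proof -
  have meas: "h \<in> borel_measurable borel" by (rule borel_measurable_continuous_onI[OF cont])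
  have 1: "integrable lborel (\<lambda>t. indicator {-T..T} t *\<^sub>R h t)"
    by (rule borel_integrable_compact) (auto intro: continuous_on_subset[OF cont])
  have 2: "integrable lborel (\<lambda>t. indicator {t. T \<le> \<bar>t\<bar>} t *\<^sub>R h t)"
  proof (rule Bochner_Integration.integrable_bound)
    show "integrable lborel (\<lambda>t. A * (indicator {t. T \<le> \<bar>t\<bar>} t *\<^sub>R (1 / t\<^sup>2)))"
      using has_bochner_integral_inverse_square_tail[OF \<open>T > 0\<close>]
      by (intro integrable_mult_right) (auto simp: has_bochner_integral_iff)
    show "AE t in lborel. norm (indicator {t. T \<le> \<bar>t\<bar>} t *\<^sub>R h t)
        \<le> norm (A * (indicator {t. T \<le> \<bar>t\<bar>} t *\<^sub>R (1 / t\<^sup>2)))"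
    proof (rule AE_I2)
      fix t :: real
      show "norm (indicator {t. T \<le> \<bar>t\<bar>} t *\<^sub>R h t)
        \<le> norm (A * (indicator {t. T \<le> \<bar>t\<bar>} t *\<^sub>R (1 / t\<^sup>2)))"
        using bd[of t] abs_ge_self[of "A / t\<^sup>2"] by (auto split: split_indicator intro: order_trans)
    qed
  qed (use meas in measurable)
  have "integrable lborel (\<lambda>t. indicator {-T..T} t *\<^sub>R h t + indicator {t. T \<le> \<bar>t\<bar>} t *\<^sub>R h t)"
    using 1 2 by (rule Bochner_Integration.integrable_add)
  \<comment> \<open>The two indicator sets overlap at T and -T, hence equality only almost
    everywhere.\<close>
  moreover have "AE t in lborel. indicator {-T..T} t *\<^sub>R h t + indicator {t. T \<le> \<bar>t\<bar>} t *\<^sub>R h t = h t"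
  proof -
    have "AE t in lborel. t \<noteq> T" "AE t in lborel. t \<noteq> -T" by (rule AE_lborel_singleton)+
    then show ?thesis by eventually_elim (auto split: split_indicator)
  qed
  ultimately show ?thesis
    by (subst (asm) integrable_cong_AE) (use meas in auto)
qed

text \<open>The bound depends on \<open>h\<close> only through \<open>A\<close> and
  \<open>T\<close>, which makes truncated integrals converge uniformly when \<open>h\<close> carries
  a parameter.\<close>

lemma inverse_square_decay_truncation:
  fixes h :: "real \<Rightarrow> complex"
  assumes cont: "continuous_on UNIV h" and "T > 0" and bd: "\<And>t. T \<le> \<bar>t\<bar> \<Longrightarrow> norm (h t) \<le> A / t\<^sup>2"
    and "T \<le> r"
  shows "norm (integral {-r..r} h - (\<integral>t. h t \<partial>lborel)) \<le> 2 * A / r"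
proof -
  have int: "integrable lborel h" by (rule inverse_square_decay_integrable[OF assms(1-3)])
  have r: "r > 0" using assms by simp
  have intr: "integrable lborel (\<lambda>t. indicator {-r..r} t *\<^sub>R h t)"
    by (rule borel_integrable_compact) (auto intro: continuous_on_subset[OF cont])
  have "integral {-r..r} h = (\<integral>t. indicator {-r..r} t *\<^sub>R h t \<partial>lborel)"
    using set_borel_integral_eq_integral(2)[of "{-r..r}" h] intr
    by (simp add: set_integrable_def set_lebesgue_integral_def)
  then have "(\<integral>t. h t \<partial>lborel) - integral {-r..r} h = (\<integral>t. h t - indicator {-r..r} t *\<^sub>R h t \<partial>lborel)"
    using int intr by (simp add: Bochner_Integration.integral_diff)
  also have "norm (\<integral>t. h t - indicator {-r..r} t *\<^sub>R h t \<partial>lborel) \<le> (\<integral>t. A * (indicator {t. r \<le> \<bar>t\<bar>} t *\<^sub>R (1 / t\<^sup>2)) \<partial>lborel)"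
  proof (rule Bochner_Integration.integral_norm_bound_integral)
    show "integrable lborel (\<lambda>t. A * (indicator {t. r \<le> \<bar>t\<bar>} t *\<^sub>R (1 / t\<^sup>2)))"
      using has_bochner_integral_inverse_square_tail[OF r]
      by (intro integrable_mult_right) (auto simp: has_bochner_integral_iff)
  next
    fix t :: real
    have "norm (h t) \<le> A / t\<^sup>2" if "r \<le> \<bar>t\<bar>" using bd[of t] that assms by auto
    moreover have "0 \<le> A / t\<^sup>2" if "r \<le> \<bar>t\<bar>" using norm_ge_zero calculation[OF that] by (rule order_trans)
    ultimately show "norm (h t - indicator {-r..r} t *\<^sub>R h t) \<le> A * (indicator {t. r \<le> \<bar>t\<bar>} t *\<^sub>R (1 / t\<^sup>2))"
      by (auto split: split_indicator)
  qed (use int intr in auto)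
  also have "\<dots> = A * (2 / r)"
    by (subst integral_mult_right_zero)
       (use has_bochner_integral_inverse_square_tail[OF r] in \<open>simp add: has_bochner_integral_iff\<close>)
  finally show ?thesis by (simp add: norm_minus_commute mult.commute)
qed

lemma inverse_square_decay_tendsto:
  fixes h :: "real \<Rightarrow> complex"
  assumes cont: "continuous_on UNIV h" and "T > 0" and bd: "\<And>t. T \<le> \<bar>t\<bar> \<Longrightarrow> norm (h t) \<le> A / t\<^sup>2"
  shows "((\<lambda>r. integral {-r..r} h) \<longlongrightarrow> (\<integral>t. h t \<partial>lborel)) at_top"
proof -
  have "((\<lambda>r. 2 * A / r) \<longlongrightarrow> 0) at_top"
    by (rule real_tendsto_divide_at_top[OF tendsto_const filterlim_ident])
  then have "((\<lambda>r. integral {-r..r} h - (\<integral>t. h t \<partial>lborel)) \<longlongrightarrow> 0) at_top"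
  proof (rule Lim_null_comparison[rotated])
    show "\<forall>\<^sub>F r in at_top. norm (integral {-r..r} h - (\<integral>t. h t \<partial>lborel)) \<le> 2 * A / r"
      using eventually_ge_at_top[of T]
    proof eventually_elim
      case (elim r)
      show ?case
        by (rule inverse_square_decay_truncation[where T = T]) (use assms elim in auto)
    qed
  qed
  then show ?thesis by (rule Lim_null[THEN iffD2])
qed

section \<open>Shifting parallel lines and crossing poles\<close>

definition line_integral :: "complex \<Rightarrow> real \<Rightarrow> (complex \<Rightarrow> complex) \<Rightarrow> complex" where
  "line_integral d c f = (\<integral>t. f (of_real c + of_real t * d) * d \<partial>lborel)"

text \<open>A primitive \<open>F\<close> on the convex set \<open>U\<close> replaces the contour in
  Cauchy's theorem: truncated integrals are differences of values of \<open>F\<close>, and each of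
  the two horizontal connecting sides at parameters r and -r contributes at most A / r^2 times c2 -
  c1.\<close>

lemma line_integral_shift:
  fixes f :: "complex \<Rightarrow> complex"
  assumes hol: "f holomorphic_on U" and U: "open U" "convex U" and "c1 \<le> c2"
    and lines: "\<And>c t. c \<in> {c1..c2} \<Longrightarrow> of_real c + of_real t * d \<in> U"
    and "T > 0" and decay: "\<And>c t. c \<in> {c1..c2} \<Longrightarrow> T \<le> \<bar>t\<bar> \<Longrightarrow> norm (f (of_real c + of_real t * d)) \<le> A / t\<^sup>2"
  shows "line_integral d c1 f = line_integral d c2 f"
proof -
  obtain F where F: "\<And>z. z \<in> U \<Longrightarrow> (F has_field_derivative f z) (at z within U)"
    using holomorphic_convex_primitive'[OF U(2) U(1) hol] by blast
  have cf: "continuous_on U f" using hol by (rule holomorphic_on_imp_continuous_on)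
  have along: "integral {-r..r} (\<lambda>t. f (of_real c + of_real t * d) * d)
      = F (of_real c + of_real r * d) - F (of_real c + of_real (-r) * d)" if "c \<in> {c1..c2}" "r \<ge> 0" for c r
  proof (rule integral_unique, rule fundamental_theorem_of_calculus)
    fix t assume "t \<in> {-r..r}"
    have "(F has_field_derivative f (of_real c + of_real t * d)) (at (of_real c + of_real t * d))"
      using F[OF lines[OF that(1)]] U lines[OF that(1)] by (metis at_within_open)
    then have "((\<lambda>t. F (of_real c + of_real t * d)) has_vector_derivative d * f (of_real c + of_real t * d)) (at t)"
      by (intro field_vector_diff_chain_at[unfolded o_def]) (auto intro!: derivative_eq_intros)
    then show "((\<lambda>t. F (of_real c + of_real t * d)) has_vector_derivative
        f (of_real c + of_real t * d) * d) (at t within {-r..r})"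
      by (simp add: mult.commute has_vector_derivative_at_within)
  qed (use that in auto)
  have cont: "continuous_on UNIV (\<lambda>t. f (of_real c + of_real t * d) * d)" if "c \<in> {c1..c2}" for c
    by (intro continuous_intros continuous_on_compose2[OF cf]) (use lines[OF that] in auto)
  have lim: "((\<lambda>r. F (of_real c + of_real r * d) - F (of_real c + of_real (-r) * d))
      \<longlongrightarrow> line_integral d c f) at_top" if "c \<in> {c1..c2}" for c
  proof -
    have bd: "norm (f (of_real c + of_real t * d) * d) \<le> (A * norm d) / t\<^sup>2" if "T \<le> \<bar>t\<bar>" for t
      using mult_right_mono[OF decay[OF \<open>c \<in> {c1..c2}\<close> that], of "norm d"] by (simp add: norm_mult)
    have "\<forall>\<^sub>F r in at_top. integral {-r..r} (\<lambda>t. f (of_real c + of_real t * d) * d)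
      = F (of_real c + of_real r * d) - F (of_real c + of_real (-r) * d)"
      using eventually_ge_at_top[of 0] by eventually_elim (rule along[OF that])
    with inverse_square_decay_tendsto[OF cont[OF that] \<open>T > 0\<close> bd]
    show ?thesis unfolding line_integral_def by (rule Lim_transform_eventually)
  qed
  have across: "norm (F (of_real c2 + of_real t * d) - F (of_real c1 + of_real t * d)) \<le> A / t\<^sup>2 * (c2 - c1)"
    if "T \<le> \<bar>t\<bar>" for t
  proof -
    have "norm (F (of_real c2 + of_real t * d) - F (of_real c1 + of_real t * d))
        \<le> (A / t\<^sup>2) * norm ((of_real c2 + of_real t * d) - (of_real c1 + of_real t * d))"
    proof (rule field_differentiable_bound)
      show "convex ((\<lambda>c. of_real c + of_real t * d) ` {c1..c2})"
      proof -
        have "(\<lambda>c. of_real c + of_real t * d) ` {c1..c2} = (+) (of_real t * d) ` of_real ` {c1..c2}"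
          by (auto simp: image_image add.commute)
        then show ?thesis
          by (auto intro!: convex_translation convex_linear_image bounded_linear.linear[OF bounded_linear_of_real])
      qed
      fix z assume z: "z \<in> (\<lambda>c. of_real c + of_real t * d) ` {c1..c2}"
      then have zU: "z \<in> U" using lines by auto
      show "(F has_field_derivative f z) (at z within (\<lambda>c. of_real c + of_real t * d) ` {c1..c2})"
        using F[OF zU] lines by (auto intro: DERIV_subset)
      show "norm (f z) \<le> A / t\<^sup>2" using z decay that by auto
    qed (use \<open>c1 \<le> c2\<close> in auto)
    also have "norm ((of_real c2 + of_real t * d) - (of_real c1 + of_real t * d)) = c2 - c1"
      using \<open>c1 \<le> c2\<close> norm_of_real[of "c2 - c1", where ?'a = complex] by (simp add: of_real_diff)
    finally show ?thesis .
  qed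
  have "((\<lambda>r. (F (of_real c2 + of_real r * d) - F (of_real c2 + of_real (-r) * d))
          - (F (of_real c1 + of_real r * d) - F (of_real c1 + of_real (-r) * d))) \<longlongrightarrow> 0) at_top"
  proof (rule Lim_null_comparison)
    show "\<forall>\<^sub>F r in at_top. norm ((F (of_real c2 + of_real r * d) - F (of_real c2 + of_real (-r) * d))
          - (F (of_real c1 + of_real r * d) - F (of_real c1 + of_real (-r) * d))) \<le> 2 * (A * (c2 - c1)) * inverse (r\<^sup>2)"
      using eventually_ge_at_top[of T]
    proof eventually_elim
      case (elim r)
      have "norm ((F (of_real c2 + of_real r * d) - F (of_real c2 + of_real (-r) * d))
          - (F (of_real c1 + of_real r * d) - F (of_real c1 + of_real (-r) * d)))
          = norm ((F (of_real c2 + of_real r * d) - F (of_real c1 + of_real r * d))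
          - (F (of_real c2 + of_real (-r) * d) - F (of_real c1 + of_real (-r) * d)))"
        by (simp add: algebra_simps)
      also have "\<dots> \<le> A / r\<^sup>2 * (c2 - c1) + A / (-r)\<^sup>2 * (c2 - c1)"
        using elim \<open>T > 0\<close> by (intro order_trans[OF norm_triangle_ineq4] add_mono across) auto
      finally show ?case by (simp add: field_simps)
    qed
    have "((\<lambda>r::real. inverse (r\<^sup>2)) \<longlongrightarrow> 0) at_top"
      by (intro tendsto_inverse_0_at_top filterlim_pow_at_top filterlim_ident) auto
    then show "((\<lambda>r::real. 2 * (A * (c2 - c1)) * inverse (r\<^sup>2)) \<longlongrightarrow> 0) at_top"
      using tendsto_mult_right_zero by blast
  qed
  moreover have "((\<lambda>r. (F (of_real c2 + of_real r * d) - F (of_real c2 + of_real (-r) * d))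
          - (F (of_real c1 + of_real r * d) - F (of_real c1 + of_real (-r) * d)))
       \<longlongrightarrow> line_integral d c2 f - line_integral d c1 f) at_top"
    using \<open>c1 \<le> c2\<close> by (intro tendsto_diff lim) auto
  ultimately have "line_integral d c2 f - line_integral d c1 f = 0"
    using tendsto_unique trivial_limit_at_top_linorder by blast
  then show ?thesis by simp
qed

text \<open>Truncated integrals are holomorphic by differentiation under the integral sign, and the
  tail bound makes their convergence locally uniform.\<close>

lemma holomorphic_on_integral_parameter:
  fixes f :: "complex \<Rightarrow> real \<Rightarrow> complex"
  assumes S: "open S" and deriv: "\<And>z t. z \<in> S \<Longrightarrow> ((\<lambda>z. f z t) has_field_derivative f' z t) (at z)"
    and cont: "\<And>z. z \<in> S \<Longrightarrow> continuous_on UNIV (f z)"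
    and cont': "continuous_on (S \<times> UNIV) (\<lambda>(z, t). f' z t)"
    and decay: "\<And>z. z \<in> S \<Longrightarrow> \<exists>e>0. \<exists>A. \<exists>T>0. \<forall>w\<in>ball z e. \<forall>t. T \<le> \<bar>t\<bar> \<longrightarrow> norm (f w t) \<le> A / t\<^sup>2"
  shows "(\<lambda>z. \<integral>t. f z t \<partial>lborel) holomorphic_on S"
proof -
  have "(\<lambda>z. \<integral>t. f z t \<partial>lborel) holomorphic_on ball z0 e" if z0: "ball z0 e \<subseteq> S"
    and e: "\<exists>A. \<exists>T>0. \<forall>w\<in>ball z0 e. \<forall>t. T \<le> \<bar>t\<bar> \<longrightarrow> norm (f w t) \<le> A / t\<^sup>2" for z0 e
  proof (rule holomorphic_uniform_sequence)
    show "open (ball z0 e)" by simp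
    let ?F = "\<lambda>n z. integral (cbox (- real n) (real n)) (f z)"
    show "?F n holomorphic_on ball z0 e" for n
    proof (rule leibniz_rule_holomorphic)
      fix z t assume z: "z \<in> ball z0 e"
      show "((\<lambda>x. f x t) has_field_derivative f' z t) (at z within ball z0 e)"
        using z z0 by (intro DERIV_subset[OF deriv]) auto
      show "f z integrable_on cbox (- real n) (real n)"
        by (intro integrable_continuous continuous_on_subset[OF cont]) (use z z0 in auto)
    next
      show "continuous_on (ball z0 e \<times> cbox (- real n) (real n)) (\<lambda>(x, t). f' x t)"
        by (rule continuous_on_subset[OF cont']) (use z0 in auto)
    qed auto
    obtain A T where T: "T > 0" and AT: "\<And>w t. w \<in> ball z0 e \<Longrightarrow> T \<le> \<bar>t\<bar> \<Longrightarrow> norm (f w t) \<le> A / t\<^sup>2"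
      using e by metis
    have ul: "uniform_limit (ball z0 e) ?F (\<lambda>z. \<integral>t. f z t \<partial>lborel) sequentially"
    proof (rule uniform_limitI)
      fix \<epsilon> :: real assume "\<epsilon> > 0"
      have "(\<lambda>n. 2 * A / real n) \<longlonglongrightarrow> 0" by (rule lim_const_over_n)
      from order_tendstoD(2)[OF this \<open>\<epsilon> > 0\<close>]
      have "\<forall>\<^sub>F n in sequentially. 2 * A / real n < \<epsilon>" .
      moreover have "\<forall>\<^sub>F n in sequentially. T \<le> real n"
        using filterlim_real_sequentially by (auto simp: filterlim_at_top)
      ultimately show "\<forall>\<^sub>F n in sequentially. \<forall>x\<in>ball z0 e. dist (?F n x) (\<integral>t. f x t \<partial>lborel) < \<epsilon>"
      proof eventually_elim
        case (elim n)
        show ?case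
        proof
          fix x assume x: "x \<in> ball z0 e"
          have "norm (?F n x - (\<integral>t. f x t \<partial>lborel)) \<le> 2 * A / real n"
            unfolding cbox_interval
            by (rule inverse_square_decay_truncation[OF cont T AT[OF x]]) (use x z0 elim in auto)
          then show "dist (?F n x) (\<integral>t. f x t \<partial>lborel) < \<epsilon>" using elim by (simp add: dist_norm)
        qed
      qed
    qed
    fix x assume "x \<in> ball z0 e"
    then obtain d where "d > 0" "cball x d \<subseteq> ball z0 e" using open_contains_cball open_ball by blast
    then show "\<exists>d>0. cball x d \<subseteq> ball z0 e \<and> uniform_limit (cball x d) ?F (\<lambda>z. \<integral>t. f z t \<partial>lborel) sequentially"
      using uniform_limit_on_subset[OF ul] by blast
  qed note ball = this
  show ?thesis
    unfolding holomorphic_on_def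
  proof
    fix z assume z: "z \<in> S"
    obtain e1 where e1: "e1 > 0" "ball z e1 \<subseteq> S" using S z open_contains_ball by blast
    obtain e2 A T where e2: "e2 > 0" "T > 0" "\<And>w t. w\<in>ball z e2 \<Longrightarrow> T \<le> \<bar>t\<bar> \<Longrightarrow> norm (f w t) \<le> A / t\<^sup>2"
      using decay[OF z] by blast
    have "(\<lambda>z. \<integral>t. f z t \<partial>lborel) holomorphic_on ball z (min e1 e2)"
      by (rule ball) (use e1 e2 in fastforce)+
    then have "(\<lambda>z. \<integral>t. f z t \<partial>lborel) field_differentiable at z"
      using e1 e2 by (intro holomorphic_on_imp_differentiable_at[of _ "ball z (min e1 e2)"]) auto
    then show "(\<lambda>z. \<integral>t. f z t \<partial>lborel) field_differentiable at z within S"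
      by (rule field_differentiable_at_within)
  qed
qed

text \<open>Two extra units of linear growth pay for t^2 <= exp (2 |t|); completing the square then
  bounds the exponent.\<close>

lemma exp_quadratic_le_inverse_square:
  fixes K L \<kappa> t :: real
  assumes "\<kappa> > 0" "t \<noteq> 0"
  shows "exp (L + K * \<bar>t\<bar> - \<kappa> * t\<^sup>2) \<le> exp (L + (K + 2)\<^sup>2 / (4 * \<kappa>)) / t\<^sup>2"
proof -
  have "0 \<le> (2 * \<kappa> * \<bar>t\<bar> - (K + 2))\<^sup>2 / (4 * \<kappa>)" using assms by simp
  also have "\<dots> = \<kappa> * t\<^sup>2 - (K + 2) * \<bar>t\<bar> + (K + 2)\<^sup>2 / (4 * \<kappa>)"
    using assms by (simp add: power2_eq_square field_simps)
  finally have *: "2 * \<bar>t\<bar> + (L + K * \<bar>t\<bar> - \<kappa> * t\<^sup>2) \<le> L + (K + 2)\<^sup>2 / (4 * \<kappa>)"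
    by (simp add: algebra_simps)
  have "\<bar>t\<bar> \<le> exp \<bar>t\<bar>" using exp_ge_add_one_self[of "\<bar>t\<bar>"] by linarith
  then have "\<bar>t\<bar>\<^sup>2 \<le> (exp \<bar>t\<bar>)\<^sup>2" by (rule power_mono) simp
  then have "t\<^sup>2 \<le> exp (2 * \<bar>t\<bar>)" by (simp add: exp_double)
  then have "t\<^sup>2 * exp (L + K * \<bar>t\<bar> - \<kappa> * t\<^sup>2) \<le> exp (2 * \<bar>t\<bar>) * exp (L + K * \<bar>t\<bar> - \<kappa> * t\<^sup>2)"
    by (rule mult_right_mono) simp
  also have "\<dots> \<le> exp (L + (K + 2)\<^sup>2 / (4 * \<kappa>))" using * by (simp flip: exp_add)
  finally show ?thesis using assms by (simp add: field_simps)
qed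

text \<open>The moduli of r + z and -r + z become equal in the limit; what survives is the argument,
  near 0 for r + z and near pi or -pi for -r + z according to the side of the cut on which z
  lies.\<close>

lemma Ln_symmetric_difference_tendsto:
  assumes "Im z \<noteq> 0"
  shows "((\<lambda>r. Ln (of_real r + z) - Ln (of_real (-r) + z)) \<longlongrightarrow>
            (if Im z > 0 then - (\<i> * pi) else \<i> * pi)) at_top"
proof -
  let ?s = "if Im z > 0 then - (\<i> * of_real pi) else \<i> * of_real pi"
  have zr: "((\<lambda>r. z / of_real r) \<longlongrightarrow> 0) at_top"
  proof -
    have "((\<lambda>r::real. of_real (inverse r) :: complex) \<longlongrightarrow> of_real 0) at_top"
      by (intro tendsto_of_real tendsto_inverse_0_at_top filterlim_ident)
    then show ?thesis using tendsto_mult_right_zero[of "\<lambda>r::real. of_real (inverse r)" at_top z]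
      by (simp add: divide_inverse)
  qed
  have "((\<lambda>r. Ln (1 + z / of_real r) - Ln (1 - z / of_real r) + ?s) \<longlongrightarrow> Ln (1 + 0) - Ln (1 - 0) + ?s) at_top"
    by (intro tendsto_intros zr) auto
  then have lim: "((\<lambda>r. Ln (1 + z / of_real r) - Ln (1 - z / of_real r) + ?s) \<longlongrightarrow> ?s) at_top" by simp
  show ?thesis
  proof (rule Lim_transform_eventually[OF lim])
    show "\<forall>\<^sub>F r in at_top. Ln (1 + z / of_real r) - Ln (1 - z / of_real r) + ?s
        = Ln (of_real r + z) - Ln (of_real (-r) + z)"
      using eventually_gt_at_top[of 0]
    proof eventually_elim
      case (elim r)
      have nz: "1 + z / of_real r \<noteq> 0" "1 - z / of_real r \<noteq> 0" "-1 + z / of_real r \<noteq> 0"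
        using assms elim by (auto simp: complex_eq_iff)
      have "of_real r + z = of_real r * (1 + z / of_real r)" using elim by (simp add: field_simps)
      then have 1: "Ln (of_real r + z) = of_real (ln r) + Ln (1 + z / of_real r)"
        using Ln_times_of_real[OF elim nz(1)] elim by (simp add: Ln_of_real)
      have "of_real (-r) + z = of_real r * (-1 + z / of_real r)" using elim by (simp add: field_simps)
      then have "Ln (of_real (-r) + z) = of_real (ln r) + Ln (- (1 - z / of_real r))"
        using Ln_times_of_real[OF elim nz(3)] elim by (simp add: Ln_of_real)
      also have "Ln (- (1 - z / of_real r)) = Ln (1 - z / of_real r) - ?s"
        using Ln_minus[OF nz(2)] assms elim by (auto simp: field_simps split: if_splits)
      finally show ?case using 1 by simp
    qed
  qed
qed

lemma inverse_difference_bound: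
  fixes d :: complex and c n n' t :: real
  assumes "Im d \<noteq> 0" "t \<noteq> 0"
  shows "norm (1 / (of_real c + of_real t * d - of_real n) - 1 / (of_real c + of_real t * d - of_real n'))
      \<le> (\<bar>n - n'\<bar> / (Im d)\<^sup>2) / t\<^sup>2"
proof -
  let ?z = "of_real c + of_real t * d :: complex"
  have *: "norm (?z - of_real a) \<ge> \<bar>t\<bar> * \<bar>Im d\<bar>" for a
    using abs_Im_le_cmod[of "?z - of_real a"] by (simp add: abs_mult)
  have nz: "?z - of_real a \<noteq> 0" for a using assms by (auto simp: complex_eq_iff)
  have "1 / (?z - of_real n) - 1 / (?z - of_real n') = of_real (n - n') / ((?z - of_real n) * (?z - of_real n'))"
    using nz[of n] nz[of n'] by (simp add: divide_simps)
  also have "norm \<dots> = \<bar>n - n'\<bar> / (norm (?z - of_real n) * norm (?z - of_real n'))"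
    by (simp add: norm_divide norm_mult del: of_real_diff)
  also have "\<dots> \<le> \<bar>n - n'\<bar> / ((\<bar>t\<bar> * \<bar>Im d\<bar>) * (\<bar>t\<bar> * \<bar>Im d\<bar>))"
    using assms nz[of n] nz[of n'] by (intro divide_left_mono mult_mono *) (auto intro!: mult_pos_pos)
  also have "\<dots> = (\<bar>n - n'\<bar> / (Im d)\<^sup>2) / t\<^sup>2"
    by (simp add: power2_eq_square mult_ac flip: abs_mult)
  finally show ?thesis .
qed

text \<open>The function 1 / (z - n) alone is not absolutely integrable on a line. Pairing it with 1
  / (z - n') restores decay 1 / t^2, and n', left of the line, only normalises the value: each
  logarithm contributes pi i or -pi i according to the side of its pole.\<close>

lemma line_integral_inverse_difference:
  fixes d :: complex and c n n' :: real
  assumes d: "Im d < 0" and "c \<noteq> n" "n' < c"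
  shows "line_integral d c (\<lambda>z. 1 / (z - of_real n) - 1 / (z - of_real n')) = (if c < n then 2 * pi * \<i> else 0)"
proof -
  let ?h = "\<lambda>t. (1 / (of_real c + of_real t * d - of_real n) - 1 / (of_real c + of_real t * d - of_real n')) * d"
  define z where "z = (\<lambda>a::real. of_real (c - a) / d)"
  have d0: "d \<noteq> 0" using d by auto
  have nz: "of_real c + of_real t * d - of_real a \<noteq> 0" if "a \<noteq> c" for a t
  proof
    assume "of_real c + of_real t * d - of_real a = 0"
    then have "t * Im d = 0" "c + t * Re d - a = 0" by (simp_all add: complex_eq_iff)
    then show False using d that by auto
  qed
  have Imz: "Im (z a) = (c - a) * (- Im d / (norm d)\<^sup>2)" for a
    by (simp add: z_def Im_divide flip: cmod_power2)
  have dd: "- Im d / (norm d)\<^sup>2 > 0" using d d0 by (intro divide_pos_pos) auto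
  have sgn: "Im (z a) > 0 \<longleftrightarrow> a < c" "Im (z a) = 0 \<longleftrightarrow> a = c" for a
    unfolding Imz zero_less_mult_iff mult_eq_0_iff using dd by auto
  have h_eq: "?h t = 1 / (of_real t + z n) - 1 / (of_real t + z n')" for t
    using d0 nz[of n t] nz[of n' t] assms by (simp add: z_def field_simps)
  have nzt: "of_real t + z a \<noteq> 0" "of_real t + z a \<notin> \<real>\<^sub>\<le>\<^sub>0" if "a \<noteq> c" for t a
    using sgn(2)[of a] that by (auto simp: complex_eq_iff complex_nonpos_Reals_iff)
  have along: "integral {-r..r} ?h = (Ln (of_real r + z n) - Ln (of_real (-r) + z n))
       - (Ln (of_real r + z n') - Ln (of_real (-r) + z n'))" if "r \<ge> 0" for r
  proof -
    have "(?h has_integral ((Ln (of_real r + z n) - Ln (of_real r + z n'))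
       - (Ln (of_real (-r) + z n) - Ln (of_real (-r) + z n')))) {-r..r}"
    proof (rule fundamental_theorem_of_calculus)
      fix t assume "t \<in> {-r..r}"
      have "((\<lambda>t. Ln (of_real t + z a)) has_vector_derivative 1 * (1 / (of_real t + z a))) (at t)" if "a \<noteq> c" for a
        using nzt[OF that]
        by (intro field_vector_diff_chain_at[unfolded o_def]) (auto intro!: derivative_eq_intros simp: divide_inverse)
      from has_vector_derivative_diff[OF this[of n] this[of n']]
      have "((\<lambda>t. Ln (of_real t + z n) - Ln (of_real t + z n')) has_vector_derivative ?h t) (at t)"
        unfolding h_eq using assms by simp
      then show "((\<lambda>t. Ln (of_real t + z n) - Ln (of_real t + z n')) has_vector_derivative ?h t) (at t within {-r..r})"
        by (rule has_vector_derivative_at_within)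
    qed (use that in auto)
    then show ?thesis by (simp only: integral_unique) (simp only: algebra_simps)
  qed
  have cont: "continuous_on UNIV ?h"
    by (intro continuous_intros) (use nz assms in auto)
  have bd: "norm (?h t) \<le> (\<bar>n - n'\<bar> / (Im d)\<^sup>2 * norm d) / t\<^sup>2" if "1 \<le> \<bar>t\<bar>" for t
    using mult_right_mono[OF inverse_difference_bound[of d t c n n'], of "norm d"] d that by (auto simp: norm_mult)
  have "((\<lambda>r. integral {-r..r} ?h) \<longlongrightarrow> (\<integral>t. ?h t \<partial>lborel)) at_top"
    by (rule inverse_square_decay_tendsto[where T = 1, OF cont _ bd]) auto
  moreover have "((\<lambda>r. integral {-r..r} ?h) \<longlongrightarrow>
     (if Im (z n) > 0 then - (\<i> * pi) else \<i> * pi) - (if Im (z n') > 0 then - (\<i> * pi) else \<i> * pi)) at_top"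
  proof (rule Lim_transform_eventually)
    show "((\<lambda>r. (Ln (of_real r + z n) - Ln (of_real (-r) + z n))
       - (Ln (of_real r + z n') - Ln (of_real (-r) + z n'))) \<longlongrightarrow>
      (if Im (z n) > 0 then - (\<i> * pi) else \<i> * pi) - (if Im (z n') > 0 then - (\<i> * pi) else \<i> * pi)) at_top"
      by (intro tendsto_diff Ln_symmetric_difference_tendsto) (use sgn assms in auto)
    show "\<forall>\<^sub>F r in at_top. (Ln (of_real r + z n) - Ln (of_real (-r) + z n))
       - (Ln (of_real r + z n') - Ln (of_real (-r) + z n')) = integral {-r..r} ?h"
      using eventually_ge_at_top[of 0] by eventually_elim (rule along[symmetric])
  qed
  ultimately have "(\<integral>t. ?h t \<partial>lborel) =
     (if Im (z n) > 0 then - (\<i> * pi) else \<i> * pi) - (if Im (z n') > 0 then - (\<i> * pi) else \<i> * pi)"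
    using tendsto_unique trivial_limit_at_top_linorder by blast
  then show ?thesis using assms unfolding line_integral_def sgn by auto
qed

text \<open>Subtracting r times the pair of poles at n and n' leaves a function with a removable
  singularity at n, to which \<open>line_integral_shift\<close> applies; the jump comes entirely
  from the explicit integrals of the pair.\<close>

lemma line_integral_residue:
  fixes f :: "complex \<Rightarrow> complex" and n c1 c2 :: real
  assumes hol: "f holomorphic_on U - {of_real n}" and U: "open U" "convex U" and c: "c1 < n" "n < c2"
    and lines: "\<And>c t. c \<in> {c1..c2} \<Longrightarrow> of_real c + of_real t * d \<in> U" and d: "Im d < 0"
    and res: "((\<lambda>z. (z - of_real n) * f z) \<longlongrightarrow> r) (at (of_real n))"
    and "T > 0" and decay: "\<And>c t. c \<in> {c1..c2} \<Longrightarrow> T \<le> \<bar>t\<bar> \<Longrightarrow> norm (f (of_real c + of_real t * d)) \<le> A / t\<^sup>2"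
  shows "line_integral d c1 f - line_integral d c2 f = 2 * pi * \<i> * r"
proof -
  \<comment> \<open>The auxiliary pole lies to the left of every line involved, hence is never
    crossed.\<close>
  define n' where "n' = c1 - 1"
  \<comment> \<open>The half-plane to the right of the parallel through n'. Intersecting with it
    removes n' from \<open>U\<close> and keeps the domain convex.\<close>
  define H where "H = {z. Re z - Im z * (Re d / Im d) > n'}"
  define k where "k = (\<lambda>z::complex. 1 / (z - of_real n) - 1 / (z - of_real n'))"
  have H_half: "H = {z. inner (Complex 1 (- (Re d / Im d))) z > n'}"
    by (simp add: H_def inner_complex_def mult.commute)
  have H: "open H" "convex H"
    unfolding H_half by (rule open_halfspace_gt, rule convex_halfspace_gt)
  have lineH: "of_real c + of_real t * d \<in> H" if "c \<in> {c1..c2}" for c t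
    using that d by (simp add: H_def n'_def)
  have n'H: "of_real n' \<notin> H" by (simp add: H_def)
  have nU: "of_real n \<in> U \<inter> H" using lines[of n 0] lineH[of n 0] c by auto
  have holk: "(\<lambda>z. f z - r * k z) holomorphic_on (U \<inter> H) - {of_real n}"
    unfolding k_def
    by (intro holomorphic_intros holomorphic_on_subset[OF hol]) (use n'H in auto)
  have "((\<lambda>z. (z - of_real n) * f z - r * (1 - (z - of_real n) / (z - of_real n'))) \<longlongrightarrow>
          r - r * (1 - (of_real n - of_real n) / (of_real n - of_real n'))) (at (of_real n))"
    by (intro tendsto_intros res) (use c in \<open>simp add: n'_def flip: of_real_diff\<close>)
  moreover have "\<forall>\<^sub>F z in at (of_real n). (z - of_real n) * f z - r * (1 - (z - of_real n) / (z - of_real n'))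
      = (z - of_real n) * (f z - r * k z)"
    unfolding eventually_at_filter
  proof (rule always_eventually, intro allI impI)
    fix z :: complex assume "z \<noteq> of_real n"
    then have "(z - of_real n) * k z = 1 - (z - of_real n) / (z - of_real n')"
      by (simp add: k_def right_diff_distrib)
    then show "(z - of_real n) * f z - r * (1 - (z - of_real n) / (z - of_real n'))
      = (z - of_real n) * (f z - r * k z)"
      by (metis (no_types, lifting) mult.left_commute right_diff_distrib)
  qed
  ultimately have "((\<lambda>z. (z - of_real n) * (f z - r * k z)) \<longlongrightarrow> 0) (at (of_real n))"
    by (simp add: Lim_transform_eventually)
  then obtain g where g: "g holomorphic_on U \<inter> H" "\<And>z. z \<in> U \<inter> H \<Longrightarrow> z \<noteq> of_real n \<Longrightarrow> g z = f z - r * k z"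
    using holomorphic_on_extend_lim[OF holk, of] nU U H by (auto simp: interior_open open_Int)
  have gdecay: "norm (g (of_real c + of_real t * d)) \<le> (A + norm r * (\<bar>n - n'\<bar> / (Im d)\<^sup>2)) / t\<^sup>2"
    if "c \<in> {c1..c2}" "T \<le> \<bar>t\<bar>" for c t
  proof -
    have t: "t \<noteq> 0" using that \<open>T > 0\<close> by auto
    have "of_real c + of_real t * d \<noteq> of_real n" using t d by (auto simp: complex_eq_iff)
    then have "norm (g (of_real c + of_real t * d)) \<le> norm (f (of_real c + of_real t * d)) + norm r * norm (k (of_real c + of_real t * d))"
      using g(2)[of "of_real c + of_real t * d"] lines lineH that norm_triangle_ineq4
      by (metis IntI norm_mult)
    also have "\<dots> \<le> A / t\<^sup>2 + norm r * ((\<bar>n - n'\<bar> / (Im d)\<^sup>2) / t\<^sup>2)"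
      unfolding k_def using that d t
      by (intro add_mono decay mult_left_mono inverse_difference_bound) auto
    finally show ?thesis by (simp add: add_divide_distrib)
  qed
  have shift: "line_integral d c1 g = line_integral d c2 g"
    by (rule line_integral_shift[OF g(1), where T = T and A = "A + norm r * (\<bar>n - n'\<bar> / (Im d)\<^sup>2)"])
       (use U H c lines lineH gdecay \<open>T > 0\<close> in \<open>auto simp: open_Int convex_Int\<close>)
  have split: "line_integral d c f = line_integral d c g + r * line_integral d c k" if c: "c \<in> {c1..c2}" "c \<noteq> n" for c
  proof -
    have nz: "of_real c + of_real t * d \<noteq> of_real n" for t
    proof
      assume "of_real c + of_real t * d = of_real n"
      then have "t * Im d = 0" "c + t * Re d - n = 0" by (simp_all add: complex_eq_iff)
      then show False using d that by auto
    qed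
    have nz': "of_real c + of_real t * d \<noteq> of_real n'" for t
      using lineH[OF c(1), of t] n'H by auto
    have ig: "integrable lborel (\<lambda>t. g (of_real c + of_real t * d) * d)"
    proof (rule inverse_square_decay_integrable)
      show "continuous_on UNIV (\<lambda>t. g (of_real c + of_real t * d) * d)"
        by (intro continuous_intros continuous_on_compose2[OF holomorphic_on_imp_continuous_on[OF g(1)]])
           (use lines[OF c(1)] lineH[OF c(1)] in auto)
      show "norm (g (of_real c + of_real t * d) * d) \<le> ((A + norm r * (\<bar>n - n'\<bar> / (Im d)\<^sup>2)) * norm d) / t\<^sup>2"
        if "T \<le> \<bar>t\<bar>" for t
        using mult_right_mono[OF gdecay[OF c(1) that], of "norm d"] by (simp add: norm_mult)
    qed fact
    have ik: "integrable lborel (\<lambda>t. k (of_real c + of_real t * d) * d)"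
    proof (rule inverse_square_decay_integrable)
      show "continuous_on UNIV (\<lambda>t. k (of_real c + of_real t * d) * d)"
        unfolding k_def by (intro continuous_intros) (use nz nz' in auto)
      show "norm (k (of_real c + of_real t * d) * d) \<le> (\<bar>n - n'\<bar> / (Im d)\<^sup>2 * norm d) / t\<^sup>2" if "1 \<le> \<bar>t\<bar>" for t
        using mult_right_mono[OF inverse_difference_bound[of d t c n n'], of "norm d"] d that
        by (auto simp: norm_mult k_def)
    qed simp
    have "f (of_real c + of_real t * d) * d = g (of_real c + of_real t * d) * d + r * (k (of_real c + of_real t * d) * d)" for t
      using g(2)[of "of_real c + of_real t * d"] nz lines[OF c(1)] lineH[OF c(1)] by (simp add: algebra_simps flip: distrib_left)
    then show ?thesis
      unfolding line_integral_def using ig ik by (simp add: Bochner_Integration.integral_add)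
  qed
  have "line_integral d c1 k = 2 * pi * \<i>" "line_integral d c2 k = 0"
    unfolding k_def using c d by (subst line_integral_inverse_difference; auto simp: n'_def)+
  then show ?thesis using split[of c1] split[of c2] shift c by simp
qed

text \<open>The integral is entire in z and constant for real z, by translation of the variable; the
  identity theorem extends the value at 0 to all z.\<close>

lemma Gaussian_integral:
  fixes \<kappa> :: real and z :: complex
  assumes "\<kappa> > 0"
  shows "(\<integral>t. exp (- (of_real \<kappa> * (of_real t + z)\<^sup>2)) \<partial>lborel) = of_real (sqrt (pi / \<kappa>))"
proof -
  define F where "F = (\<lambda>z::complex. \<integral>t. exp (- (of_real \<kappa> * (of_real t + z)\<^sup>2)) \<partial>lborel)"
  have hol: "F holomorphic_on UNIV"
    unfolding F_def
  proof (rule holomorphic_on_integral_parameter)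
    fix z :: complex
    let ?A = "exp (\<kappa> * (norm z + 1)\<^sup>2 + (2 * \<kappa> * (norm z + 1) + 2)\<^sup>2 / (4 * \<kappa>))"
    have bd: "norm (exp (- (of_real \<kappa> * (of_real t + w)\<^sup>2))) \<le> ?A / t\<^sup>2"
      if w: "w \<in> ball z 1" and t: "1 \<le> \<bar>t\<bar>" for w t
    proof -
      let ?B = "norm z + 1"
      have B: "norm w \<le> ?B"
        using w norm_triangle_ineq2[of w z] by (auto simp: dist_norm norm_minus_commute)
      have "- (2 * t * Re w) \<le> 2 * ?B * \<bar>t\<bar>"
      proof -
        have "- (2 * t * Re w) \<le> 2 * (\<bar>t\<bar> * \<bar>Re w\<bar>)" by (simp flip: abs_mult)
        also have "\<dots> \<le> 2 * (\<bar>t\<bar> * ?B)" using abs_Re_le_cmod[of w] B by (intro mult_left_mono) auto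
        finally show ?thesis by (simp add: mult_ac)
      qed
      then have "- 2 * t * Re w \<le> 2 * ?B * \<bar>t\<bar>" by linarith
      moreover have "(Im w)\<^sup>2 \<le> ?B\<^sup>2"
        using abs_Im_le_cmod[of w] B by (intro power2_le_iff_abs_le[THEN iffD2]) auto
      moreover have "0 \<le> (Re w)\<^sup>2" by simp
      ultimately have "- Re ((of_real t + w)\<^sup>2) \<le> ?B\<^sup>2 + 2 * ?B * \<bar>t\<bar> - t\<^sup>2"
        unfolding Re_power2 plus_complex.sel Re_complex_of_real Im_complex_of_real power2_sum[of t] by (simp only: add_0_left)
      then have "- (\<kappa> * Re ((of_real t + w)\<^sup>2)) \<le> \<kappa> * (?B\<^sup>2 + 2 * ?B * \<bar>t\<bar> - t\<^sup>2)"
        using assms by (metis mult_left_mono less_imp_le mult_minus_right)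
      then have "norm (exp (- (of_real \<kappa> * (of_real t + w)\<^sup>2))) \<le> exp (\<kappa> * ?B\<^sup>2 + (2 * \<kappa> * ?B) * \<bar>t\<bar> - \<kappa> * t\<^sup>2)"
        by (simp add: algebra_simps)
      also have "\<dots> \<le> exp (\<kappa> * ?B\<^sup>2 + (2 * \<kappa> * ?B + 2)\<^sup>2 / (4 * \<kappa>)) / t\<^sup>2"
        using t assms by (intro exp_quadratic_le_inverse_square) auto
      finally show ?thesis .
    qed
    show "\<exists>e>0. \<exists>A. \<exists>T>0. \<forall>w\<in>ball z e. \<forall>t. T \<le> \<bar>t\<bar> \<longrightarrow>
        norm (exp (- (of_real \<kappa> * (of_real t + w)\<^sup>2))) \<le> A / t\<^sup>2"
      by (rule exI[of _ 1], rule conjI, simp, rule exI[of _ ?A], rule exI[of _ 1]) (use bd in auto)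
  next
    fix z :: complex and t :: real
    show "((\<lambda>z. exp (- (of_real \<kappa> * (of_real t + z)\<^sup>2))) has_field_derivative
        exp (- (of_real \<kappa> * (of_real t + z)\<^sup>2)) * (- (of_real \<kappa> * (2 * (of_real t + z))))) (at z)"
      by (auto intro!: derivative_eq_intros)
  qed (auto intro!: continuous_intros simp: split_def)
  have real: "F (of_real x) = F 0" for x :: real
    using lborel_integral_real_affine[of 1 "\<lambda>t. exp (- (of_real \<kappa> * (of_real t)\<^sup>2)) :: complex" x]
    by (simp add: F_def add.commute)
  have F0: "F 0 = of_real (sqrt (pi / \<kappa>))"
  proof -
    have "has_bochner_integral lborel (\<lambda>x. exp (- x\<^sup>2)) (2 *\<^sub>R (sqrt pi / 2))"
      by (rule has_bochner_integral_even_function[OF gaussian_moment_0]) auto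
    then have "(\<integral>x. exp (- x\<^sup>2) \<partial>lborel) = sqrt pi" by (simp add: has_bochner_integral_iff)
    moreover have "(\<integral>x. exp (- x\<^sup>2) \<partial>lborel) = sqrt \<kappa> * (\<integral>t. exp (- (\<kappa> * t\<^sup>2)) \<partial>lborel)"
      using lborel_integral_real_affine[of "sqrt \<kappa>" "\<lambda>x. exp (- x\<^sup>2)" 0] assms by (simp add: power_mult_distrib)
    ultimately have "(\<integral>t. exp (- (\<kappa> * t\<^sup>2)) \<partial>lborel) = sqrt (pi / \<kappa>)"
      using assms by (simp add: real_sqrt_divide field_simps)
    moreover have "F 0 = (\<integral>t. of_real (exp (- (\<kappa> * t\<^sup>2))) \<partial>lborel)"
      by (simp add: F_def flip: of_real_power of_real_mult of_real_minus exp_of_real)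
    ultimately show ?thesis by (simp only: integral_complex_of_real)
  qed
  have "F z - of_real (sqrt (pi / \<kappa>)) = 0"
  proof (rule analytic_continuation[where S = UNIV and U = \<real> and \<xi> = 0 and f = "\<lambda>z. F z - of_real (sqrt (pi / \<kappa>))"])
    show "(\<lambda>z. F z - of_real (sqrt (pi / \<kappa>))) holomorphic_on UNIV"
      by (intro holomorphic_intros hol)
    show "(0::complex) islimpt \<real>"
      unfolding islimpt_approachable
    proof (intro allI impI)
      fix e :: real assume "e > 0"
      then show "\<exists>x'\<in>\<real>. x' \<noteq> (0::complex) \<and> dist x' 0 < e"
        by (intro bexI[of _ "of_real (e/2)"]) auto
    qed
    show "F z - of_real (sqrt (pi / \<kappa>)) = 0" if "z \<in> \<real>" for z
      using that real F0 by (auto elim!: Reals_cases)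
  qed auto
  then show ?thesis by (simp add: F_def)
qed

section \<open>Mordell integrals\<close>

definition sin_den :: "complex \<Rightarrow> complex" where
  "sin_den x = exp (of_real pi * \<i> * x) - exp (- (of_real pi * \<i> * x))"

text \<open>The direction for which \<open>se\<close>^2 = -i, so that exp (-pi i x^2) is a real
  Gaussian on the line through 0.\<close>

definition se :: complex where "se = cis (- (pi / 4))"

lemma se_simps: "Re se = sqrt 2 / 2" "Im se = - (sqrt 2 / 2)" "se\<^sup>2 = - \<i>" "se * se = - \<i>"
    "norm se = 1" "se \<noteq> 0"
  by (simp_all add: se_def cos_45 sin_45 cis_mult power2_eq_square complex_eq_iff)

lemma sin_den_eq: "sin_den x = 2 * \<i> * sin (of_real pi * x)"
  by (simp add: sin_den_def sin_exp_eq mult_ac)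

lemma sin_den_eq_0_iff: "sin_den x = 0 \<longleftrightarrow> x \<in> \<int>"
proof
  assume "sin_den x = 0"
  then obtain n :: int where "of_real pi * x = of_real (of_int n * pi)"
    by (auto simp: sin_den_eq Complex_Transcendental.sin_eq_0)
  then have "x = of_int n" by simp
  then show "x \<in> \<int>" by simp
next
  assume "x \<in> \<int>"
  then obtain n where "x = of_int n" by (auto elim: Ints_cases)
  then show "sin_den x = 0"
    by (auto simp: sin_den_eq Complex_Transcendental.sin_eq_0 mult.commute)
qed

lemma holomorphic_sin_den [holomorphic_intros]:
  "f holomorphic_on A \<Longrightarrow> (\<lambda>x. sin_den (f x)) holomorphic_on A"
  unfolding sin_den_def by (intro holomorphic_intros)

lemma continuous_sin_den [continuous_intros]:
  "continuous_on A f \<Longrightarrow> continuous_on A (\<lambda>x. sin_den (f x))"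
  unfolding sin_den_def by (intro continuous_intros)

lemma norm_sin_den_ge_sinh: "norm (sin_den x) \<ge> 2 * \<bar>sinh (pi * Im x)\<bar>"
proof -
  have "\<bar>exp (- (pi * Im x)) - exp (pi * Im x)\<bar> \<le> norm (sin_den x)"
    using norm_triangle_ineq3[of "exp (of_real pi * \<i> * x)" "exp (- (of_real pi * \<i> * x))"]
    by (simp add: sin_den_def)
  moreover have "\<bar>exp (- (pi * Im x)) - exp (pi * Im x)\<bar> = 2 * \<bar>sinh (pi * Im x)\<bar>"
    by (simp add: sinh_def field_simps abs_minus_commute)
  ultimately show ?thesis by simp
qed

lemma sinh_real_ge_self:
  fixes y :: real
  assumes "y \<ge> 0"
  shows "y \<le> sinh y"
proof -
  have "sinh 0 - 0 \<le> sinh y - y"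
    by (rule DERIV_nonneg_imp_nondecreasing[OF assms])
       (auto intro!: derivative_eq_intros exI simp: cosh_real_ge_1)
  then show ?thesis by simp
qed

lemma norm_sin_den_ge: "norm (sin_den x) \<ge> 2 * pi * \<bar>Im x\<bar>"
proof -
  have "\<bar>sinh (pi * Im x)\<bar> \<ge> \<bar>pi * Im x\<bar>"
    using sinh_real_ge_self[of "pi * Im x"] sinh_real_ge_self[of "- (pi * Im x)"]
    by (cases "pi * Im x \<ge> 0") auto
  then show ?thesis using norm_sin_den_ge_sinh[of x] by (simp add: abs_mult)
qed

lemma sin_den_add_1: "sin_den (x + 1) = - sin_den x"
  by (simp add: sin_den_eq ring_distribs sin_add)

text \<open>Reciprocal of the derivative 2 pi i cos (pi n).\<close>

lemma sin_den_residue: "((\<lambda>z. (z - of_nat n) / sin_den z) \<longlongrightarrow> (-1) ^ n / (2 * of_real pi * \<i>)) (at (of_nat n))"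
proof -
  have "cos (of_real pi * of_nat n :: complex) = of_real (cos (pi * real n))"
    using cos_of_real[of "pi * real n", where 'a = complex] by simp
  also have "\<dots> = (-1) ^ n" by (simp only: cos_npi2) simp
  finally have c: "cos (of_real pi * of_nat n :: complex) = (-1) ^ n" .
  have "sin_den (of_nat n) = 0" by (simp add: sin_den_eq_0_iff)
  have "(sin_den has_field_derivative 2 * \<i> * (cos (of_real pi * of_nat n) * of_real pi)) (at (of_nat n))"
    unfolding sin_den_eq[abs_def] by (auto intro!: derivative_eq_intros)
  then have "((\<lambda>z. (sin_den z - sin_den (of_nat n)) / (z - of_nat n)) \<longlongrightarrow> 2 * \<i> * ((-1) ^ n * of_real pi)) (at (of_nat n))"
    by (simp add: has_field_derivative_iff c)
  then have "((\<lambda>z. inverse ((sin_den z) / (z - of_nat n))) \<longlongrightarrow> inverse (2 * \<i> * ((-1) ^ n * of_real pi))) (at (of_nat n))"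
    by (intro tendsto_inverse) (auto simp: \<open>sin_den (of_nat n) = 0\<close>)
  moreover have "inverse (2 * \<i> * ((-1) ^ n * of_real pi)) = (-1) ^ n / (2 * of_real pi * \<i> :: complex)"
    by (cases "even n") (auto simp: field_simps)
  ultimately show ?thesis by (simp only: inverse_divide)
qed

text \<open>Re z + Im z is constant along \<open>se\<close>, so these are the regions between two
  parallel lines of that direction, indexed by their real intercepts.\<close>

definition strip :: "real \<Rightarrow> real \<Rightarrow> complex set" where
  "strip a b = {z. a < Re z + Im z \<and> Re z + Im z < b}"

lemma open_convex_strip: "open (strip a b)" "convex (strip a b)"
proof -
  have *: "strip a b = {z. inner (Complex 1 1) z > a} \<inter> {z. inner (Complex 1 1) z < b}"
    by (auto simp: strip_def inner_complex_def)
  show "open (strip a b)" "convex (strip a b)"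
    unfolding * by (auto intro!: open_Int convex_Int open_halfspace_gt open_halfspace_lt convex_halfspace_gt convex_halfspace_lt)
qed

lemma line_in_strip [simp]: "of_real c + of_real t * se \<in> strip a b \<longleftrightarrow> a < c \<and> c < b"
  by (simp add: strip_def se_simps)

lemma Im_line_ge:
  assumes "1 \<le> \<bar>t\<bar>"
  shows "\<bar>Im (of_real c + of_real t * se)\<bar> \<ge> 1/2"
proof -
  have "sqrt 2 \<ge> 1" by simp
  then have "1 * 1 \<le> \<bar>t\<bar> * sqrt 2" using assms by (intro mult_mono) auto
  then show ?thesis by (simp add: se_simps abs_mult)
qed

lemma norm_sin_den_line_ge:
  assumes "1 \<le> \<bar>t\<bar>"
  shows "norm (sin_den (of_real c + of_real t * se)) \<ge> 1"
proof -
  have "1 \<le> 2 * pi * (1/2)" using pi_gt3 by simp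
  also have "\<dots> \<le> 2 * pi * \<bar>Im (of_real c + of_real t * se)\<bar>"
    by (intro mult_left_mono Im_line_ge assms) auto
  also have "\<dots> \<le> norm (sin_den (of_real c + of_real t * se))" by (rule norm_sin_den_ge)
  finally show ?thesis .
qed

lemma norm_line_le: "norm (of_real c + of_real t * se) \<le> \<bar>c\<bar> + \<bar>t\<bar>"
  by (rule order_trans[OF norm_triangle_ineq]) (simp add: norm_mult se_simps)

text \<open>Along the line x^2 = c^2 + 2 c t \<open>se\<close> - i t^2. Only the last term is
  quadratic in t; the cross term and the exponential in a grow at most linearly in the
  exponent.\<close>

lemma norm_gauss_line_le:
  assumes "\<kappa> > 0" "\<bar>c\<bar> \<le> B"
  shows "norm (exp (- (of_real (pi * \<kappa>) * \<i> * (of_real c + of_real t * se)\<^sup>2)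
            + 2 * of_real pi * \<i> * a * (of_real c + of_real t * se)))
      \<le> exp (2 * pi * norm a * B + (2 * pi * \<kappa> * B + 2 * pi * norm a) * \<bar>t\<bar> - pi * \<kappa> * t\<^sup>2)"
proof -
  let ?x = "of_real c + of_real t * se"
  have x2: "?x\<^sup>2 = of_real (c\<^sup>2) + of_real (2 * c * t) * se - \<i> * of_real (t\<^sup>2)"
    by (simp add: power2_sum power_mult_distrib se_simps algebra_simps)
  have "Re (- (of_real (pi * \<kappa>) * \<i> * ?x\<^sup>2)) = - (sqrt 2 * pi * \<kappa> * c * t) - pi * \<kappa> * t\<^sup>2"
    unfolding x2 by (simp add: se_simps algebra_simps)
  also have "\<dots> \<le> 2 * pi * \<kappa> * B * \<bar>t\<bar> - pi * \<kappa> * t\<^sup>2"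
  proof -
    have s: "sqrt 2 \<le> 2" using real_sqrt_le_mono[of 2 4] by simp
    have "- (sqrt 2 * pi * \<kappa> * c * t) \<le> \<bar>sqrt 2 * pi * \<kappa> * c * t\<bar>" by linarith
    also have "\<dots> = sqrt 2 * pi * \<kappa> * \<bar>c\<bar> * \<bar>t\<bar>" using assms by (simp add: abs_mult)
    also have "\<dots> \<le> 2 * pi * \<kappa> * B * \<bar>t\<bar>" using assms s by (intro mult_right_mono mult_mono) auto
    finally show ?thesis by simp
  qed
  finally have 1: "Re (- (of_real (pi * \<kappa>) * \<i> * ?x\<^sup>2)) \<le> 2 * pi * \<kappa> * B * \<bar>t\<bar> - pi * \<kappa> * t\<^sup>2" .
  have "Re (2 * of_real pi * \<i> * a * ?x) \<le> norm (2 * of_real pi * \<i> * a * ?x)" by (rule complex_Re_le_cmod)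
  also have "\<dots> = 2 * pi * norm a * norm ?x" by (simp add: norm_mult)
  also have "\<dots> \<le> 2 * pi * norm a * (B + \<bar>t\<bar>)"
    using norm_line_le[of c t] assms by (intro mult_left_mono) auto
  finally have "Re (2 * of_real pi * \<i> * a * ?x) \<le> 2 * pi * norm a * (B + \<bar>t\<bar>)" .
  with 1 show ?thesis by (simp add: algebra_simps del: Re_complex_of_real)
qed

text \<open>Completing the square about b leads to \<open>Gaussian_integral\<close> with the complex
  shift (c - b) / \<open>se\<close>, which is why c drops out.\<close>

lemma line_integral_gauss:
  assumes "\<kappa> > 0"
  shows "line_integral se c (\<lambda>x. exp (- (of_real (pi * \<kappa>) * \<i> * x\<^sup>2) + 2 * of_real pi * \<i> * of_real \<kappa> * b * x))
     = se * exp (of_real (pi * \<kappa>) * \<i> * b\<^sup>2) / of_real (sqrt \<kappa>)"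
proof -
  define z where "z = (of_real c - b) / se"
  have eq: "exp (- (of_real (pi * \<kappa>) * \<i> * (of_real c + of_real t * se)\<^sup>2)
        + 2 * of_real pi * \<i> * of_real \<kappa> * b * (of_real c + of_real t * se)) * se
      = se * exp (of_real (pi * \<kappa>) * \<i> * b\<^sup>2) * exp (- (of_real (pi * \<kappa>) * (of_real t + z)\<^sup>2))" for t
  proof -
    have x: "of_real c + of_real t * se = b + se * (of_real t + z)" by (simp add: z_def se_simps distrib_left)
    have e: "- (of_real (pi * \<kappa>) * \<i> * (b + se * w)\<^sup>2) + 2 * of_real pi * \<i> * of_real \<kappa> * b * (b + se * w)
        = of_real (pi * \<kappa>) * \<i> * b\<^sup>2 + - (of_real (pi * \<kappa>) * w\<^sup>2)" for w
    proof -
      have "(se * w)\<^sup>2 = - \<i> * w\<^sup>2" by (simp add: power_mult_distrib se_simps)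
      then show ?thesis by (simp add: power2_sum algebra_simps power2_eq_square[of b])
    qed
    show ?thesis unfolding x e exp_add by (simp only: mult_ac)
  qed
  have "line_integral se c (\<lambda>x. exp (- (of_real (pi * \<kappa>) * \<i> * x\<^sup>2) + 2 * of_real pi * \<i> * of_real \<kappa> * b * x))
      = se * exp (of_real (pi * \<kappa>) * \<i> * b\<^sup>2) * of_real (sqrt (pi / (pi * \<kappa>)))"
    unfolding line_integral_def eq using Gaussian_integral[of "pi * \<kappa>" z] assms by simp
  moreover have "sqrt (pi / (pi * \<kappa>)) = 1 / sqrt \<kappa>" by (simp add: real_sqrt_divide)
  ultimately show ?thesis by simp
qed

text \<open>Mordell's integral. The case k = 1 yields the functional equation of zeta, the case k =
  2 the function G; both closed forms take c = 1/2.\<close>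

definition mordell :: "nat \<Rightarrow> real \<Rightarrow> complex \<Rightarrow> complex" where
  "mordell k c a = line_integral se c
     (\<lambda>x. exp (- (of_real (pi * k) * \<i> * x\<^sup>2) + 2 * of_real pi * \<i> * a * x) / sin_den x)"

lemma mordell_decay:
  assumes "k > 0" "\<bar>c\<bar> \<le> B" "1 \<le> \<bar>t\<bar>"
  defines "x \<equiv> of_real c + of_real t * se"
  shows "norm (exp (- (of_real (pi * real k) * \<i> * x\<^sup>2) + 2 * of_real pi * \<i> * a * x) / sin_den x)
     \<le> exp (2 * pi * norm a * B + (2 * pi * k * B + 2 * pi * norm a + 2)\<^sup>2 / (4 * (pi * k))) / t\<^sup>2"
proof -
  have "norm (exp (- (of_real (pi * real k) * \<i> * x\<^sup>2) + 2 * of_real pi * \<i> * a * x) / sin_den x)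
      \<le> norm (exp (- (of_real (pi * real k) * \<i> * x\<^sup>2) + 2 * of_real pi * \<i> * a * x)) / 1"
    unfolding norm_divide x_def by (intro divide_left_mono norm_sin_den_line_ge assms) (use norm_sin_den_line_ge[OF assms(3), of c] in auto)
  also have "\<dots> \<le> exp (2 * pi * norm a * B + (2 * pi * k * B + 2 * pi * norm a) * \<bar>t\<bar> - (pi * k) * t\<^sup>2)"
    using norm_gauss_line_le[of k c B t a] assms by (simp add: x_def)
  also have "\<dots> \<le> exp (2 * pi * norm a * B + (2 * pi * k * B + 2 * pi * norm a + 2)\<^sup>2 / (4 * (pi * k))) / t\<^sup>2"
    using assms by (intro exp_quadratic_le_inverse_square) auto
  finally show ?thesis .
qed

lemma not_Ints_line:
  assumes "c \<notin> \<int>"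
  shows "of_real c + of_real t * se \<notin> \<int>"
proof
  assume "of_real c + of_real t * se \<in> \<int>"
  then obtain n where "of_real c + of_real t * se = of_int n" by (elim Ints_cases)
  then have "t * sqrt 2 = 0" "c + t * sqrt 2 / 2 = of_int n" by (auto simp: complex_eq_iff se_simps)
  then have "t = 0" by simp
  with \<open>c + t * sqrt 2 / 2 = of_int n\<close> have "c = of_int n" by simp
  then show False using assms by auto
qed

lemma not_Ints_half: "(1/2 :: real) \<notin> \<int>"
  using fraction_not_in_Ints[of 2 1, where 'a = real] by simp

lemma mordell_integrable:
  assumes "k > 0" "c \<notin> \<int>"
  shows "integrable lborel (\<lambda>t. exp (- (of_real (pi * real k) * \<i> * (of_real c + of_real t * se)\<^sup>2) +
            2 * of_real pi * \<i> * a * (of_real c + of_real t * se)) / sin_den (of_real c + of_real t * se))"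
proof (rule inverse_square_decay_integrable[where T = 1])
  show "continuous_on UNIV (\<lambda>t. exp (- (of_real (pi * real k) * \<i> * (of_real c + of_real t * se)\<^sup>2) +
            2 * of_real pi * \<i> * a * (of_real c + of_real t * se)) / sin_den (of_real c + of_real t * se))"
    by (intro continuous_intros) (auto simp: sin_den_eq_0_iff not_Ints_line[OF assms(2)])
qed (use mordell_decay[OF assms(1), of c "\<bar>c\<bar>" _ a] in auto)

lemma exp_minus_of_nat_pi_i: "exp (- (of_real (pi * real k) * \<i>)) = (-1) ^ k"
proof -
  have "- (of_real (pi * real k) * \<i>) = of_nat k * (- (of_real pi * \<i>))" by simp
  then show ?thesis by (simp only: exp_of_nat_mult) (simp add: exp_minus)
qed

lemma sin_den_nonzero_strip:
  assumes "z \<in> strip 0 2" "z \<noteq> 1"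
  shows "sin_den z \<noteq> 0"
proof
  assume "sin_den z = 0"
  then obtain n where n: "z = of_int n" by (auto simp: sin_den_eq_0_iff elim: Ints_cases)
  then have "0 < n" "n < 2" using assms by (auto simp: strip_def)
  then have "n = 1" by simp
  then show False using n assms by simp
qed

text \<open>
  Crossing the pole at \<open>1\<close> and shifting back by periodicity gives one functional equation in \<open>a\<close>, the
  difference \<open>mordell_difference\<close>, a Gaussian integral, a second one; together they determine the integral.
\<close>

lemma mordell_shift:
  assumes "k > 0"
  shows "mordell k (1/2) a + (-1) ^ k * exp (2 * of_real pi * \<i> * a) * mordell k (1/2) (a - of_nat k)
       = - ((-1) ^ k * exp (2 * of_real pi * \<i> * a))"
proof -
  let ?f = "\<lambda>x. exp (- (of_real (pi * real k) * \<i> * x\<^sup>2) + 2 * of_real pi * \<i> * a * x) / sin_den x"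
  \<comment> \<open>Residue at 1: the Gaussian contributes exp (-pi i k) = (-1)^k and 1 /
    \<open>sin_den\<close> contributes -1 / (2 pi i).\<close>
  let ?r = "- ((-1) ^ k * exp (2 * of_real pi * \<i> * a) / (2 * of_real pi * \<i>))"
  have "line_integral se (1/2) ?f - line_integral se (3/2) ?f = 2 * pi * \<i> * ?r"
  proof (rule line_integral_residue[where U = "strip 0 2" and n = 1 and T = 1])
    show "?f holomorphic_on strip 0 2 - {of_real 1}"
      by (intro holomorphic_intros) (use sin_den_nonzero_strip in auto)
    have "((\<lambda>z. exp (- (of_real (pi * real k) * \<i> * z\<^sup>2) + 2 * of_real pi * \<i> * a * z) * ((z - of_nat 1) / sin_den z)) \<longlongrightarrow>
         exp (- (of_real (pi * real k) * \<i> * (of_nat 1)\<^sup>2) + 2 * of_real pi * \<i> * a * of_nat 1) * ((-1) ^ 1 / (2 * of_real pi * \<i>))) (at (of_nat 1))"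
      by (intro tendsto_intros sin_den_residue)
    moreover have "exp (- (of_real (pi * real k) * \<i> * (of_nat 1)\<^sup>2) + 2 * of_real pi * \<i> * a * of_nat 1) * ((-1) ^ 1 / (2 * of_real pi * \<i>)) = ?r"
      unfolding exp_add using exp_minus_of_nat_pi_i[of k] by simp
    ultimately show "((\<lambda>z. (z - of_real 1) * ?f z) \<longlongrightarrow> ?r) (at (of_real 1))"
      by (simp add: mult.commute)
    show "norm (?f (of_real c + of_real t * se))
       \<le> exp (2 * pi * norm a * 2 + (2 * pi * k * 2 + 2 * pi * norm a + 2)\<^sup>2 / (4 * (pi * k))) / t\<^sup>2"
      if "c \<in> {1/2..3/2}" "1 \<le> \<bar>t\<bar>" for c t
      using that by (intro mordell_decay assms) auto
  qed (auto simp: open_convex_strip se_simps)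
  moreover have "line_integral se (3/2) ?f = - ((-1) ^ k * exp (2 * of_real pi * \<i> * a)) * mordell k (1/2) (a - of_nat k)"
  proof -
    have "?f (of_real (3/2) + of_real t * se) * se = - ((-1) ^ k * exp (2 * of_real pi * \<i> * a)) *
       ((exp (- (of_real (pi * real k) * \<i> * (of_real (1/2) + of_real t * se)\<^sup>2) + 2 * of_real pi * \<i> * (a - of_nat k) * (of_real (1/2) + of_real t * se)) /
         sin_den (of_real (1/2) + of_real t * se)) * se)" for t
    proof -
      let ?x = "of_real (1/2) + of_real t * se"
      have x: "of_real (3/2) + of_real t * se = ?x + 1" by simp
      \<comment> \<open>The cross term -2 pi i k y produced by the translation lowers a by
        k.\<close>
      have "- (of_real (pi * real k) * \<i> * (y + 1)\<^sup>2) + 2 * of_real pi * \<i> * a * (y + 1) =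
         - (of_real (pi * real k) * \<i>) + 2 * of_real pi * \<i> * a
           + (- (of_real (pi * real k) * \<i> * y\<^sup>2) + 2 * of_real pi * \<i> * (a - of_nat k) * y)"
        for y :: complex
        by (simp add: power2_eq_square algebra_simps)
      then have E: "exp (- (of_real (pi * real k) * \<i> * (y + 1)\<^sup>2) + 2 * of_real pi * \<i> * a * (y + 1)) =
         (-1) ^ k * exp (2 * of_real pi * \<i> * a) * exp (- (of_real (pi * real k) * \<i> * y\<^sup>2) + 2 * of_real pi * \<i> * (a - of_nat k) * y)"
        for y :: complex
        by (simp only: exp_add exp_minus_of_nat_pi_i)
      show ?thesis unfolding x sin_den_add_1 E
        by (simp only: minus_divide_right[symmetric] minus_divide_left[symmetric] mult_minus_left times_divide_eq_right times_divide_eq_left mult.assoc)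
    qed
    then show ?thesis unfolding mordell_def line_integral_def by (simp only: integral_mult_right_zero)
  qed
  ultimately show ?thesis by (simp add: mordell_def)
qed

lemma mordell_difference:
  assumes "k > 0"
  shows "mordell k (1/2) a - mordell k (1/2) (a - 1) = se * exp (of_real pi * \<i> * (a - 1/2)\<^sup>2 / of_nat k) / of_real (sqrt k)"
proof -
  let ?x = "\<lambda>t. of_real (1/2) + of_real t * se"
  let ?f = "\<lambda>a x. exp (- (of_real (pi * real k) * \<i> * x\<^sup>2) + 2 * of_real pi * \<i> * a * x) / sin_den x"
  have int: "integrable lborel (\<lambda>t. ?f a (?x t) * se)" for a
    using mordell_integrable[OF assms not_Ints_half, of a] by (rule integrable_mult_left)
  have "mordell k (1/2) a - mordell k (1/2) (a - 1) = (\<integral>t. ?f a (?x t) * se - ?f (a - 1) (?x t) * se \<partial>lborel)"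
    unfolding mordell_def line_integral_def using int by (simp only: Bochner_Integration.integral_diff)
  also have "\<dots> = line_integral se (1/2) (\<lambda>x. exp (- (of_real (pi * real k) * \<i> * x\<^sup>2) + 2 * of_real pi * \<i> * of_real k * ((a - 1/2) / of_nat k) * x))"
  proof -
    \<comment> \<open>With a = (a - 1/2) + 1/2 and a - 1 = (a - 1/2) - 1/2 the two exponentials
      differ by the factor \<open>sin_den\<close>, which cancels the denominator and leaves a pure
      Gaussian.\<close>
    have "?f a (?x t) * se - ?f (a - 1) (?x t) * se =
      exp (- (of_real (pi * real k) * \<i> * (?x t)\<^sup>2) + 2 * of_real pi * \<i> * of_real k * ((a - 1/2) / of_nat k) * ?x t) * se" for t
    proof -
      have nz: "sin_den (?x t) \<noteq> 0" using not_Ints_line[OF not_Ints_half] by (simp add: sin_den_eq_0_iff)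
      have b: "2 * of_real pi * \<i> * of_real k * ((a - 1/2) / of_nat k) * x = 2 * of_real pi * \<i> * (a - 1/2) * x" for x
        using assms by simp
      have "2 * of_real pi * \<i> * a * x = 2 * of_real pi * \<i> * (a - 1/2) * x + of_real pi * \<i> * x"
           "2 * of_real pi * \<i> * (a - 1) * x = 2 * of_real pi * \<i> * (a - 1/2) * x + - (of_real pi * \<i> * x)" for x
        by (simp_all add: algebra_simps)
      then have "exp (- (of_real (pi * real k) * \<i> * x\<^sup>2) + 2 * of_real pi * \<i> * a * x) - exp (- (of_real (pi * real k) * \<i> * x\<^sup>2) + 2 * of_real pi * \<i> * (a - 1) * x)
         = exp (- (of_real (pi * real k) * \<i> * x\<^sup>2) + 2 * of_real pi * \<i> * (a - 1/2) * x) * sin_den x" for x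
        by (simp only: exp_add sin_den_def right_diff_distrib mult.assoc)
      from this[of "?x t"] show ?thesis
        unfolding b by (simp only: left_diff_distrib[symmetric] diff_divide_distrib[symmetric] nonzero_mult_div_cancel_right[OF nz])
    qed
    then show ?thesis unfolding line_integral_def by (simp only:)
  qed
  also have "\<dots> = se * exp (of_real (pi * real k) * \<i> * ((a - 1/2) / of_nat k)\<^sup>2) / of_real (sqrt k)"
    by (rule line_integral_gauss) (use assms in simp)
  also have "of_real (pi * real k) * \<i> * ((a - 1/2) / of_nat k)\<^sup>2 = of_real pi * \<i> * (a - 1/2)\<^sup>2 / of_nat k"
    using assms by (simp add: power_divide power2_eq_square[of "of_nat k"])
  finally show ?thesis .
qed

text \<open>For k = 1 the shift by k coincides with the unit step of
  \<open>mordell_difference\<close>, so the two functional equations form a linear system for the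
  values at a and a - 1.\<close>

lemma mordell_1_closed_form: "mordell 1 (1/2) a * sin_den a = exp (of_real pi * \<i> * a\<^sup>2) - exp (of_real pi * \<i> * a)"
proof -
  let ?E = "exp (of_real pi * \<i> * a)" and ?e = "exp (- (of_real pi * \<i> * a))" and ?Q = "exp (of_real pi * \<i> * a\<^sup>2)"
  \<comment> \<open>Elimination with E = exp (pi i a), e = 1 / E, Q = exp (pi i a^2) and M the
    unknown value at a.\<close>
  have cancel: "M * (E - e) = Q - E" if "E * e = 1" "M - E * E * (M - Q * e) = E * E" for M E e Q :: complex
  proof -
    have "e * M - (E * e) * E * M + (E * e) * (E * e) * Q = e * (M - E * E * (M - Q * e))"
      by (simp add: algebra_simps)
    also have "\<dots> = (E * e) * E" by (simp add: that(2))
    finally show ?thesis by (simp add: that(1) algebra_simps)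
  qed
  have E2: "exp (2 * of_real pi * \<i> * a) = ?E * ?E" by (simp add: mult_ac flip: exp_add)
  have inv: "?E * ?e = 1" by (simp flip: exp_add)
  \<comment> \<open>The constant exp (pi i/4) coming from (a - 1/2)^2 is cancelled by
    \<open>se\<close>.\<close>
  have "se * exp (of_real pi * \<i> * (a - 1/2)\<^sup>2) = ?Q * ?e"
  proof -
    have "se * exp (of_real pi * \<i> * (a - 1/2)\<^sup>2) = exp (- (of_real pi * \<i> / 4) + of_real pi * \<i> * (a - 1/2)\<^sup>2)"
      unfolding exp_add by (simp add: se_def cis_conv_exp mult_ac)
    also have "- (of_real pi * \<i> / 4) + of_real pi * \<i> * (a - 1/2)\<^sup>2 = of_real pi * \<i> * a\<^sup>2 + - (of_real pi * \<i> * a)"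
      by (simp add: power2_eq_square field_simps)
    finally show ?thesis by (simp only: exp_add)
  qed
  with mordell_difference[of 1 a] have "mordell 1 (1/2) (a - 1) = mordell 1 (1/2) a - ?Q * ?e"
    by (simp add: diff_eq_eq eq_diff_eq add.commute)
  with mordell_shift[of 1 a] have "mordell 1 (1/2) a - ?E * ?E * (mordell 1 (1/2) a - ?Q * ?e) = ?E * ?E"
    by (simp add: E2)
  then have "mordell 1 (1/2) a * (?E - ?e) = ?Q - ?E" by (rule cancel[OF inv])
  then show ?thesis by (simp only: sin_den_def)
qed

lemma holomorphic_mordell:
  assumes k: "k > 0" and c: "c \<notin> \<int>"
  shows "mordell k c holomorphic_on UNIV"
proof -
  let ?f = "\<lambda>a x. exp (- (of_real (pi * real k) * \<i> * x\<^sup>2) + 2 * of_real pi * \<i> * a * x) / sin_den x"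
  let ?x = "\<lambda>t. of_real c + of_real t * se"
  have nz: "sin_den (?x t) \<noteq> 0" for t by (simp add: sin_den_eq_0_iff not_Ints_line c)
  have "(\<lambda>a. \<integral>t. ?f a (?x t) * se \<partial>lborel) holomorphic_on UNIV"
  proof (rule holomorphic_on_integral_parameter)
    show "((\<lambda>a. ?f a (?x t) * se) has_field_derivative ?f a (?x t) * (2 * of_real pi * \<i> * ?x t) * se) (at a)" for a t
      using nz by (auto intro!: derivative_eq_intros)
    show "continuous_on UNIV (\<lambda>t. ?f a (?x t) * se)" for a
      using nz by (intro continuous_intros) auto
    show "continuous_on (UNIV \<times> UNIV) (\<lambda>(a, t). ?f a (?x t) * (2 * of_real pi * \<i> * ?x t) * se)"
      using nz unfolding split_def by (intro continuous_intros) auto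
    fix a :: complex
    let ?B = "norm a + 1"
    let ?A = "exp (2 * pi * ?B * \<bar>c\<bar> + (2 * pi * k * \<bar>c\<bar> + 2 * pi * ?B + 2)\<^sup>2 / (4 * (pi * k)))"
    have bd: "norm (?f w (?x t) * se) \<le> ?A / t\<^sup>2" if "w \<in> ball a 1" "1 \<le> \<bar>t\<bar>" for w t
    proof -
      have w: "norm w \<le> ?B"
        using that norm_triangle_ineq2[of w a] by (auto simp: dist_norm norm_minus_commute)
      have "norm (?f w (?x t) * se) = norm (?f w (?x t))" by (simp only: norm_mult[of _ se] se_simps mult_1_right)
      also have "\<dots> \<le> exp (2 * pi * norm w * \<bar>c\<bar> + (2 * pi * k * \<bar>c\<bar> + 2 * pi * norm w + 2)\<^sup>2 / (4 * (pi * k))) / t\<^sup>2"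
        using that by (intro mordell_decay k) auto
      also have "\<dots> \<le> ?A / t\<^sup>2"
        using w k by (intro divide_right_mono exp_le_cancel_iff[THEN iffD2] add_mono mult_mono power_mono) auto
      finally show ?thesis .
    qed
    show "\<exists>e>0. \<exists>A. \<exists>T>0. \<forall>w\<in>ball a e. \<forall>t. T \<le> \<bar>t\<bar> \<longrightarrow> norm (?f w (?x t) * se) \<le> A / t\<^sup>2"
      by (rule exI[of _ 1], rule conjI, simp, rule exI[of _ ?A], rule exI[of _ 1]) (use bd in auto)
  qed auto
  then show ?thesis unfolding mordell_def line_integral_def .
qed

text \<open>The model integral at the saddle: -2 pi i is half the second derivative of the phase at
  its stationary point. It is applied at z = eta - m.\<close>

definition saddle_gauss :: "complex \<Rightarrow> complex" where
  "saddle_gauss z = line_integral se (1/2) (\<lambda>x. exp (- (2 * of_real pi * \<i> * (x - z)\<^sup>2)) / sin_den x)"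

lemma saddle_gauss_eq_mordell: "saddle_gauss z = exp (- (2 * of_real pi * \<i> * z\<^sup>2)) * mordell 2 (1/2) (2 * z)"
proof -
  have "- (2 * of_real pi * \<i> * (x - z)\<^sup>2) = - (2 * of_real pi * \<i> * z\<^sup>2) +
      (- (of_real (pi * real 2) * \<i> * x\<^sup>2) + 2 * of_real pi * \<i> * (2 * z) * x)" for x
    by (simp add: power2_eq_square algebra_simps)
  then have "exp (- (2 * of_real pi * \<i> * (x - z)\<^sup>2)) / sin_den x * se = exp (- (2 * of_real pi * \<i> * z\<^sup>2)) *
      (exp (- (of_real (pi * real 2) * \<i> * x\<^sup>2) + 2 * of_real pi * \<i> * (2 * z) * x) / sin_den x * se)" for x
    by (simp only: exp_add times_divide_eq_right times_divide_eq_left mult.assoc)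
  then show ?thesis
    unfolding saddle_gauss_def mordell_def line_integral_def by (simp only: integral_mult_right_zero)
qed

lemma holomorphic_saddle_gauss: "saddle_gauss holomorphic_on UNIV"
proof -
  have "(\<lambda>z. exp (- (2 * of_real pi * \<i> * z\<^sup>2)) * mordell 2 (1/2) (2 * z)) holomorphic_on UNIV"
    by (intro holomorphic_intros holomorphic_on_compose[OF _ holomorphic_on_subset[OF holomorphic_mordell], unfolded o_def] not_Ints_half) auto
  then show ?thesis by (simp add: saddle_gauss_eq_mordell[abs_def])
qed

text \<open>For k = 2 two unit steps lead from 2z to 2z - 2, hence the two Gaussian values
  \<open>D1\<close> and \<open>D2\<close>; together they give the multiple of \<open>sin_den\<close>
  z.\<close>

lemma saddle_gauss_closed_form:
  "saddle_gauss z * (2 * cos (2 * of_real pi * z)) =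
     exp (- (of_real pi * \<i> / 8)) / of_real (sqrt 2) * sin_den z - exp (- (2 * of_real pi * \<i> * z\<^sup>2) + 2 * of_real pi * \<i> * z)"
proof -
  let ?T = "mordell 2 (1/2)" and ?a = "2 * z"
  define D1 where "D1 = se * exp (of_real pi * \<i> * (2 * z - 1/2)\<^sup>2 / 2) / of_real (sqrt 2)"
  define D2 where "D2 = se * exp (of_real pi * \<i> * (2 * z - 3/2)\<^sup>2 / 2) / of_real (sqrt 2)"
  define E where "E = exp (2 * of_real pi * \<i> * (2 * z))"
  have 1: "?T (2 * z) - ?T (2 * z - 1) = D1"
    using mordell_difference[of 2 "2 * z"] by (simp add: D1_def)
  have 2: "?T (2 * z - 1) - ?T (2 * z - 2) = D2"
    using mordell_difference[of 2 "2 * z - 1"] by (simp add: D2_def)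
  have 3: "?T (2 * z) + E * ?T (2 * z - 2) = - E"
    using mordell_shift[of 2 "2 * z"] by (simp add: E_def)
  have "?T (2 * z - 2) = ?T (2 * z) - D1 - D2" by (simp flip: 1 2)
  with 3 have "?T (2 * z) + E * (?T (2 * z) - D1 - D2) = - E" by (simp only:)
  moreover have "t * (1 + E) = t + E * (t - D1 - D2) + E * (D1 + D2)" for t
    by (simp add: algebra_simps)
  ultimately have T: "?T (2 * z) * (1 + E) = - E + E * (D1 + D2)" by (simp only:)
  define P where "P = exp (- (2 * of_real pi * \<i> * z\<^sup>2))"
  define e where "e = exp (- (2 * of_real pi * \<i> * z))"
  have Ee: "e * E = exp (2 * of_real pi * \<i> * z)"
    unfolding e_def E_def exp_add[symmetric] by (simp add: algebra_simps)
  \<comment> \<open>The factor \<open>e\<close> symmetrises 1 + E = 1 + exp (4 pi i z) into a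
    cosine.\<close>
  have "2 * cos (2 * of_real pi * z) = e * (1 + E)"
    unfolding distrib_left Ee by (simp add: e_def cos_exp_eq mult_ac)
  then have "saddle_gauss z * (2 * cos (2 * of_real pi * z)) = P * e * (?T (2 * z) * (1 + E))"
    by (simp add: saddle_gauss_eq_mordell P_def)
  also have "\<dots> = P * (e * E) * D1 + P * (e * E) * D2 - P * (e * E)"
    unfolding T by (simp add: algebra_simps)
  also have "P * (e * E) * D1 = exp (- (of_real pi * \<i> / 8)) / of_real (sqrt 2) * exp (of_real pi * \<i> * z)"
  proof -
    have "- (2 * of_real pi * \<i> * z\<^sup>2) + 2 * of_real pi * \<i> * z + (- (of_real pi * \<i> / 4) + of_real pi * \<i> * (2 * z - 1/2)\<^sup>2 / 2)
        = - (of_real pi * \<i> / 8) + of_real pi * \<i> * z"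
      by (simp add: power2_eq_square field_simps)
    from this[THEN arg_cong[of _ _ exp]]
    have "P * (e * E) * (exp (- (of_real pi * \<i> / 4)) * exp (of_real pi * \<i> * (2 * z - 1/2)\<^sup>2 / 2))
        = exp (- (of_real pi * \<i> / 8)) * exp (of_real pi * \<i> * z)"
      unfolding Ee P_def exp_add .
    then show ?thesis by (simp add: D1_def se_def cis_conv_exp mult_ac)
  qed
  also have "P * (e * E) * D2 = - (exp (- (of_real pi * \<i> / 8)) / of_real (sqrt 2) * exp (- (of_real pi * \<i> * z)))"
  proof -
    have "- (2 * of_real pi * \<i> * z\<^sup>2) + 2 * of_real pi * \<i> * z + (- (of_real pi * \<i> / 4) + of_real pi * \<i> * (2 * z - 3/2)\<^sup>2 / 2)
        = - (of_real pi * \<i> / 8) + - (of_real pi * \<i> * z) + of_real pi * \<i>"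
      by (simp add: power2_eq_square field_simps)
    from this[THEN arg_cong[of _ _ exp]]
    have "P * (e * E) * (exp (- (of_real pi * \<i> / 4)) * exp (of_real pi * \<i> * (2 * z - 3/2)\<^sup>2 / 2))
        = exp (- (of_real pi * \<i> / 8)) * exp (- (of_real pi * \<i> * z)) * -1"
      unfolding Ee P_def exp_add exp_pi_i .
    then show ?thesis by (simp add: D2_def se_def cis_conv_exp mult_ac)
  qed
  also have "P * (e * E) = exp (- (2 * of_real pi * \<i> * z\<^sup>2) + 2 * of_real pi * \<i> * z)"
    unfolding Ee P_def exp_add ..
  finally show ?thesis by (simp only: sin_den_def right_diff_distrib) simp
qed

text \<open>The substitution x -> 1 - x maps the line through 1/2 to itself with t reversed and
  leaves \<open>sin_den\<close> unchanged.\<close>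

lemma saddle_gauss_reflect: "saddle_gauss (1 - z) = saddle_gauss z"
proof -
  let ?x = "\<lambda>t. of_real (1/2) + of_real t * se"
  let ?f = "\<lambda>z x. exp (- (2 * of_real pi * \<i> * (x - z)\<^sup>2)) / sin_den x * se"
  have eq: "?f (1 - z) (?x (0 + -1 * t)) = ?f z (?x t)" for t
  proof -
    have x: "?x (0 + -1 * t) = 1 - ?x t" by simp
    have 1: "sin_den (1 - y) = sin_den y" for y
      by (simp add: sin_den_eq ring_distribs sin_diff)
    have 2: "(1 - y - (1 - z))\<^sup>2 = (y - z)\<^sup>2" for y by (simp add: power2_eq_square algebra_simps)
    show ?thesis unfolding x 1 2 ..
  qed
  have "(\<integral>t. ?f (1 - z) (?x t) \<partial>lborel) = \<bar>-1\<bar> *\<^sub>R (\<integral>t. ?f (1 - z) (?x (0 + -1 * t)) \<partial>lborel)"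
    by (rule lborel_integral_real_affine) simp
  also have "\<dots> = (\<integral>t. ?f z (?x t) \<partial>lborel)" by (simp only: eq) simp
  finally show ?thesis unfolding saddle_gauss_def line_integral_def by simp
qed

text \<open>At z = 1/4 the closed form reads 0 = 0 and gives no information. A zero there would be
  reflected to 3/4, and then a difference of two Mordell integrals would vanish although it is a
  nonzero Gaussian value.\<close>

lemma saddle_gauss_quarter: "saddle_gauss (1/4) \<noteq> 0"
proof
  assume "saddle_gauss (1/4) = 0"
  moreover from this have "saddle_gauss (3/4) = 0" using saddle_gauss_reflect[of "1/4"] by simp
  ultimately have "mordell 2 (1/2) (1/2) = 0" "mordell 2 (1/2) (3/2) = 0" by (auto simp: saddle_gauss_eq_mordell)
  then show False using mordell_difference[of 2 "3/2"] by (simp add: se_simps)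
qed

section \<open>Identification with the function G\<close>

lemma eventually_cos_nonzero: "\<forall>\<^sub>F q in at q0. cos (of_real pi * q) \<noteq> (0 :: complex)"
proof -
  have "\<forall>\<^sub>F q in at q0. cos (of_real pi * q) \<noteq> (0 :: complex) \<and> q \<in> UNIV"
    by (rule non_zero_neighbour_alt[where \<beta> = 0]) (auto intro!: holomorphic_intros)
  then show ?thesis by simp
qed

text \<open>In the variable p the symmetry z -> 1 - z becomes p -> -p, and the right side is i times
  the numerator of G with i replaced by -i.\<close>

lemma saddle_gauss_closed_form_centred:
  "saddle_gauss ((1 + p) / 2) * (2 * cos (of_real pi * p)) =
     \<i> * (exp (- (of_real pi * \<i> / 2 * p\<^sup>2)) - of_real (sqrt 2) * exp (- (of_real pi * \<i> / 8)) * cos (of_real pi * p / 2))"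
proof -
  have "2 * of_real pi * ((1 + p) / 2) = of_real pi + of_real pi * p" by (simp add: field_simps)
  then have c: "cos (2 * of_real pi * ((1 + p) / 2)) = - cos (of_real pi * p)"
    by (simp only: cos_add) (simp add: sin_of_real cos_of_real)
  have s: "sin_den ((1 + p) / 2) = 2 * \<i> * cos (of_real pi * p / 2)"
    by (simp add: sin_den_eq ring_distribs add_divide_distrib sin_add)
  have "- (2 * of_real pi * \<i> * ((1 + p) / 2)\<^sup>2) + 2 * of_real pi * \<i> * ((1 + p) / 2) = \<i> * of_real (pi / 2) + - (of_real pi * \<i> / 2 * p\<^sup>2)"
    by (simp add: power2_eq_square field_simps)
  then have e: "exp (- (2 * of_real pi * \<i> * ((1 + p) / 2)\<^sup>2) + 2 * of_real pi * \<i> * ((1 + p) / 2)) = \<i> * exp (- (of_real pi * \<i> / 2 * p\<^sup>2))"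
    by (simp only: exp_add flip: cis_conv_exp) simp
  have r2: "2 / of_real (sqrt 2) = (of_real (sqrt 2) :: complex)"
    by (simp add: field_simps flip: of_real_mult)
  have "X / of_real (sqrt 2) * (2 * \<i> * C) = \<i> * ((2 / of_real (sqrt 2)) * X * C)" for X C :: complex
    by simp
  then have "exp (- (of_real pi * \<i> / 8)) / of_real (sqrt 2) * (2 * \<i> * C) = \<i> * (of_real (sqrt 2) * exp (- (of_real pi * \<i> / 8)) * C)" for C
    by (simp only: r2)
  with saddle_gauss_closed_form[of "(1 + p) / 2"]
  have "saddle_gauss ((1 + p) / 2) * (2 * - cos (of_real pi * p)) =
      \<i> * (of_real (sqrt 2) * exp (- (of_real pi * \<i> / 8)) * cos (of_real pi * p / 2)) - \<i> * exp (- (of_real pi * \<i> / 2 * p\<^sup>2))"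
    by (simp only: c s e)
  then have "- (saddle_gauss ((1 + p) / 2) * (2 * - cos (of_real pi * p))) =
     - (\<i> * (of_real (sqrt 2) * exp (- (of_real pi * \<i> / 8)) * cos (of_real pi * p / 2)) - \<i> * exp (- (of_real pi * \<i> / 2 * p\<^sup>2)))"
    by simp
  then show ?thesis by (simp only: mult_minus_right minus_minus minus_diff_eq right_diff_distrib)
qed

text \<open>Off the zeros of the cosine the closed form is the quotient defining G, up to
  conjugation; the continuity of \<open>saddle_gauss\<close> supplies the limits that
  \<open>remove_sings\<close> inserts at the zeros.\<close>

lemma riemann_G_bar_eq: "riemann_G_bar p = - 2 * \<i> * saddle_gauss ((1 + p) / 2)"
proof -
  define F where "F = (\<lambda>q. (exp (of_real pi * \<i> / 2 * q\<^sup>2)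
        - of_real (sqrt 2) * exp (of_real pi * \<i> / 8) * cos (of_real pi * q / 2)) / cos (of_real pi * q))"
  define g where "g = (\<lambda>q. cnj (- 2 * \<i> * saddle_gauss ((1 + cnj q) / 2)))"
  have Fg: "F q = g q" if nz: "cos (of_real pi * q) \<noteq> 0" for q
  proof -
    let ?p = "cnj q"
    have nzp: "cos (of_real pi * ?p) \<noteq> 0"
      using nz by (metis cnj_cos complex_cnj_cancel_iff complex_cnj_complex_of_real complex_cnj_mult complex_cnj_zero)
    have "- 2 * \<i> * saddle_gauss ((1 + ?p) / 2) * cos (of_real pi * ?p) =
        - \<i> * (saddle_gauss ((1 + ?p) / 2) * (2 * cos (of_real pi * ?p)))"
      by simp
    also have "\<dots> = exp (- (of_real pi * \<i> / 2 * ?p\<^sup>2)) - of_real (sqrt 2) * exp (- (of_real pi * \<i> / 8)) * cos (of_real pi * ?p / 2)"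
      unfolding saddle_gauss_closed_form_centred by simp
    finally have "- 2 * \<i> * saddle_gauss ((1 + ?p) / 2) =
      (exp (- (of_real pi * \<i> / 2 * ?p\<^sup>2)) - of_real (sqrt 2) * exp (- (of_real pi * \<i> / 8)) * cos (of_real pi * ?p / 2)) / cos (of_real pi * ?p)"
      using nzp by (simp add: field_simps)
    from this[THEN arg_cong[of _ _ cnj]] show ?thesis by (simp add: g_def F_def exp_cnj cnj_cos)
  qed
  have cont: "continuous_on UNIV saddle_gauss"
    by (rule holomorphic_on_imp_continuous_on[OF holomorphic_saddle_gauss])
  have "continuous_on UNIV g"
    unfolding g_def by (intro continuous_intros continuous_on_compose2[OF cont]) auto
  then have "(g \<longlongrightarrow> g (cnj p)) (at (cnj p))"
    by (simp add: continuous_on_eq_continuous_at isContD)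
  then have "(F \<longlongrightarrow> g (cnj p)) (at (cnj p))"
    by (rule Lim_transform_eventually) (use eventually_cos_nonzero[of "cnj p"] in eventually_elim, simp add: Fg)
  then have "remove_sings F (cnj p) = g (cnj p)" by (rule remove_sings_eqI)
  moreover have "riemann_G = remove_sings F" unfolding riemann_G_def F_def ..
  ultimately show ?thesis by (simp add: riemann_G_bar_def g_def)
qed

section \<open>Lower bound for the main term\<close>

lemma cosh_real_ge_quadratic: "1 + x\<^sup>2 / 2 \<le> cosh (x :: real)"
proof -
  have *: "1 + x\<^sup>2 / 2 \<le> cosh x" if "x \<ge> 0" for x :: real
  proof -
    have "cosh 0 - 0\<^sup>2 / 2 \<le> cosh x - x\<^sup>2 / 2"
      by (rule DERIV_nonneg_imp_nondecreasing[OF that])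
         (auto intro!: derivative_eq_intros exI simp: sinh_real_ge_self)
    then show ?thesis by simp
  qed
  from *[of x] *[of "-x"] show ?thesis by (cases "x \<ge> 0") auto
qed

lemma cosh_real_le_exp: "x \<ge> 0 \<Longrightarrow> cosh x \<le> exp (x :: real)"
  by (simp add: cosh_def field_simps)

text \<open>Both cos phi - cos (3 phi/2) and sin phi contain the factor sin (phi/4): its cofactor is
  at most 2 in the first and 4 cos (phi/4) cos (phi/2) > 2 in the second.\<close>

lemma cos_minus_sin_less:
  fixes \<phi> :: real
  assumes "0 < \<phi>" "\<phi> \<le> pi / 4"
  shows "cos \<phi> - sin \<phi> < cos (3/2 * \<phi>)"
proof -
  have "cos \<phi> - cos (3/2 * \<phi>) = 2 * sin (5/4 * \<phi>) * sin (\<phi> / 4)"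
    using cos_diff_cos[of \<phi> "3/2 * \<phi>"] by (simp add: field_simps)
  also have "\<dots> \<le> 2 * 1 * sin (\<phi> / 4)"
    using assms by (intro mult_right_mono mult_left_mono sin_le_one sin_ge_zero) auto
  also have "\<dots> < 4 * (cos (\<phi> / 4) * cos (\<phi> / 2)) * sin (\<phi> / 4)"
  proof (rule mult_strict_right_mono)
    have "sqrt 2 / 2 \<le> cos (\<phi> / 4)" "sqrt 2 / 2 < cos (\<phi> / 2)"
      using cos_monotone_0_pi_le[of "\<phi>/4" "pi/4"] cos_monotone_0_pi[of "\<phi>/2" "pi/4"] assms by (auto simp: cos_45)
    then have "sqrt 2 / 2 * (sqrt 2 / 2) < cos (\<phi> / 4) * cos (\<phi> / 2)"
      by (intro mult_le_less_imp_less) auto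
    then show "2 * 1 < 4 * (cos (\<phi> / 4) * cos (\<phi> / 2))" by (simp add: mult_ac)
    show "0 < sin (\<phi> / 4)" using assms by (intro sin_gt_zero) auto
  qed
  also have "4 * (cos (\<phi> / 4) * cos (\<phi> / 2)) * sin (\<phi> / 4) = sin \<phi>"
  proof -
    have "sin \<phi> = 2 * sin (\<phi>/2) * cos (\<phi>/2)" using sin_double[of "\<phi>/2"] by simp
    also have "sin (\<phi>/2) = 2 * sin (\<phi>/4) * cos (\<phi>/4)" using sin_double[of "\<phi>/4"] by simp
    finally show ?thesis by simp
  qed
  finally show ?thesis by simp
qed

text \<open>With p = x + i y, the vanishing of the numerator reads exp (pi x y) exp (-i A) = sqrt 2
  cos (pi p/2). The sine equation can fix the sign of A, that is, the side of the hyperbola x^2 -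
  y^2 = 1/4. For x >= 0 the cosine equation then fails unless x = 1/2; for x < 0 the equation of
  squared moduli decides.\<close>

lemma saddle_gauss_zero_real:
  fixes x y :: real
  defines "A \<equiv> pi * (x\<^sup>2 - y\<^sup>2) / 2 - pi / 8"
  assumes y: "y \<ge> 0" and xy: "\<bar>x + y\<bar> \<le> 1"
    and re: "exp (pi * x * y) * cos A = sqrt 2 * cos (pi * x / 2) * cosh (pi * y / 2)"
    and im: "exp (pi * x * y) * sin A = sqrt 2 * sin (pi * x / 2) * sinh (pi * y / 2)"
  shows "y = 0 \<and> (x = 1/2 \<or> x = -1/2)"
proof (cases "x \<ge> 0")
  case True
  have b: "x \<le> 1" "y \<le> 1" using True y xy by auto
  have sq: "0 \<le> x\<^sup>2" "0 \<le> y\<^sup>2" "x\<^sup>2 \<le> 1" "y\<^sup>2 \<le> 1"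
    using True y b by (auto simp: power_le_one)
  have "0 \<le> sqrt 2 * sin (pi * x / 2) * sinh (pi * y / 2)"
    using True y b by (intro mult_nonneg_nonneg sin_ge_zero) auto
  then have sA: "sin A \<ge> 0" unfolding im[symmetric] by (simp add: zero_le_mult_iff)
  \<comment> \<open>In this range A > -pi, so a nonnegative sine forces A >= 0.\<close>
  have "A \<ge> 0"
  proof (rule ccontr)
    assume "\<not> A \<ge> 0"
    moreover have "- pi < A"
    proof -
      have "-1 \<le> x\<^sup>2 - y\<^sup>2" using sq by linarith
      then have "pi * (-1) \<le> pi * (x\<^sup>2 - y\<^sup>2)" by (intro mult_left_mono) auto
      then show ?thesis using pi_gt_zero unfolding A_def by linarith
    qed
    ultimately have "0 < sin (- A)" by (intro sin_gt_zero) auto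
    then show False using sA by simp
  qed
  then have "pi * (1/4) \<le> pi * (x\<^sup>2 - y\<^sup>2)" by (simp add: A_def)
  then have d: "1/4 \<le> x\<^sup>2 - y\<^sup>2" by simp
  then have "1/4 \<le> x\<^sup>2" using sq by linarith
  then have "(1/2)\<^sup>2 \<le> x\<^sup>2" by (simp add: power2_eq_square)
  then have x: "1/2 \<le> x" using True by (rule power2_le_imp_le)
  show ?thesis
  proof (cases "x = 1/2")
    case True
    have "x\<^sup>2 = 1/4" unfolding \<open>x = 1/2\<close> by (simp add: power2_eq_square)
    then have "y\<^sup>2 = 0" using d sq by linarith
    then show ?thesis using True by simp
  next
    case False
    \<comment> \<open>The offset of x from 1/2 as an angle: sqrt 2 cos (pi x/2) becomes cos phi -
      sin phi, and x <= 1 will give A <= 3 phi/2.\<close>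
    define \<phi> where "\<phi> = pi * (x - 1/2) / 2"
    have \<phi>: "0 < \<phi>" "\<phi> \<le> pi / 4" using x b False by (auto simp: \<phi>_def)
    have "sqrt 2 * cos (pi * x / 2) = sqrt 2 * cos (pi / 4 + \<phi>)" by (simp add: \<phi>_def field_simps)
    also have "\<dots> = cos \<phi> - sin \<phi>"
      by (simp add: cos_add cos_45 sin_45 right_diff_distrib flip: mult.assoc)
    also have "\<dots> < cos (3/2 * \<phi>)" by (rule cos_minus_sin_less[OF \<phi>])
    also have "\<dots> \<le> cos A"
    proof (rule cos_monotone_0_pi_le)
      have "x\<^sup>2 - 1/4 = (x - 1/2) * (x + 1/2)" by (simp add: power2_eq_square algebra_simps)
      also have "\<dots> \<le> (x - 1/2) * (3/2)" using x b by (intro mult_left_mono) auto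
      finally have "x\<^sup>2 - y\<^sup>2 - 1/4 \<le> (x - 1/2) * (3/2)" using sq(2) by linarith
      then have "pi * (x\<^sup>2 - y\<^sup>2 - 1/4) \<le> pi * ((x - 1/2) * (3/2))" by (intro mult_left_mono) auto
      then show "A \<le> 3/2 * \<phi>" by (simp add: A_def \<phi>_def field_simps)
    qed (use \<open>A \<ge> 0\<close> \<phi> in auto)
    finally have lt: "sqrt 2 * cos (pi * x / 2) < cos A" .
    have cx: "0 \<le> cos (pi * x / 2)" using True b by (intro cos_ge_zero) (auto intro: order_trans[of _ 0])
    have "sqrt 2 * cos (pi * x / 2) * cosh (pi * y / 2) < cos A * cosh (pi * y / 2)"
      using lt by (intro mult_strict_right_mono) auto
    also have "\<dots> \<le> cos A * exp (pi * x * y)"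
    proof (rule mult_left_mono)
      have "cosh (pi * y / 2) \<le> exp (pi * y / 2)" using y by (intro cosh_real_le_exp) auto
      also have "\<dots> \<le> exp (pi * x * y)"
        using mult_right_mono[OF x, of "pi * y"] y by (simp add: mult_ac)
      finally show "cosh (pi * y / 2) \<le> exp (pi * x * y)" .
      show "0 \<le> cos A" using lt cx by (meson less_imp_le order_trans mult_nonneg_nonneg real_sqrt_ge_zero zero_le_numeral)
    qed
    finally show ?thesis using re by (simp add: mult.commute)
  qed
next
  case False
  define \<xi> where "\<xi> = - x"
  have \<xi>: "\<xi> > 0" "x = - \<xi>" using False by (auto simp: \<xi>_def)
  \<comment> \<open>Sum of the squares of the two equations; the angle A disappears.\<close>
  have mod: "exp (- 2 * pi * \<xi> * y) = cosh (pi * y) + cos (pi * \<xi>)"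
  proof -
    let ?a = "pi * x / 2" and ?b = "pi * y / 2"
    have "exp (- 2 * pi * \<xi> * y) = (exp (pi * x * y))\<^sup>2" by (simp add: \<xi> flip: exp_double)
    also have "\<dots> = (exp (pi * x * y) * cos A)\<^sup>2 + (exp (pi * x * y) * sin A)\<^sup>2"
      by (simp add: power_mult_distrib flip: distrib_left)
    also have "\<dots> = 2 * ((cos ?a)\<^sup>2 * (cosh ?b)\<^sup>2) + 2 * ((sin ?a)\<^sup>2 * (sinh ?b)\<^sup>2)"
      unfolding re im by (simp add: power_mult_distrib)
    also have "\<dots> = 2 * (cosh ?b)\<^sup>2 - 1 + (1 - 2 * (sin ?a)\<^sup>2)"
      by (simp add: cosh_square_eq sin_squared_eq algebra_simps)
    also have "2 * (cosh ?b)\<^sup>2 - 1 = cosh (2 * ?b)" using cosh_double[of ?b] by (simp add: sinh_square_eq)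
    also have "1 - 2 * (sin ?a)\<^sup>2 = cos (2 * ?a)" by (rule cos_double_sin[symmetric])
    finally show ?thesis by (simp add: \<xi>)
  qed
  have e1: "exp (- 2 * pi * \<xi> * y) \<le> 1" using \<xi> y by simp
  show ?thesis
  proof (cases "\<xi> \<le> 1/2")
    case True
    have "0 \<le> cos (pi * \<xi>)" using True \<xi> by (intro cos_ge_zero) (auto intro: order_trans[of _ 0])
    moreover have "1 + (pi * y)\<^sup>2 / 2 \<le> cosh (pi * y)" by (rule cosh_real_ge_quadratic)
    moreover have "0 \<le> (pi * y)\<^sup>2" by simp
    ultimately have "(pi * y)\<^sup>2 = 0" "cos (pi * \<xi>) = 0" using e1 mod by linarith+
    then have "y = 0" by simp
    have "\<xi> = 1/2"
    proof (rule ccontr)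
      assume "\<xi> \<noteq> 1/2"
      then have "0 < cos (pi * \<xi>)" using True \<xi> by (intro cos_gt_zero) auto
      then show False using \<open>cos (pi * \<xi>) = 0\<close> by simp
    qed
    with \<open>y = 0\<close> \<xi> show ?thesis by simp
  next
    case False
    then have \<xi>2: "1/2 < \<xi>" by simp
    have q: "1 + (pi * y)\<^sup>2 / 2 \<le> exp (- 2 * pi * \<xi> * y) - cos (pi * \<xi>)"
      using cosh_real_ge_quadratic[of "pi * y"] mod by simp
    \<comment> \<open>Otherwise the left side of \<open>q\<close> is at least 1 + 9/8, while its
      right side is at most 2.\<close>
    have y2: "y < 1/2"
    proof (rule ccontr)
      assume "\<not> y < 1/2"
      then have "3 * (1/2) \<le> pi * y" using pi_gt3 by (intro mult_mono) auto
      then have "(3/2)\<^sup>2 \<le> (pi * y)\<^sup>2" by (intro power_mono) auto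
      then have "9/4 \<le> (pi * y)\<^sup>2" by (simp add: power2_eq_square)
      then show False using q e1 cos_ge_minus_one[of "pi * \<xi>"] by linarith
    qed
    have \<xi>3: "\<xi> < 3/2" using xy y2 \<xi> by auto
    have sq: "y\<^sup>2 < (1/2)\<^sup>2" "(1/2)\<^sup>2 < \<xi>\<^sup>2" "\<xi>\<^sup>2 < (3/2)\<^sup>2" "0 \<le> y\<^sup>2"
      using y y2 \<xi>2 \<xi>3 by (auto intro!: power_strict_mono simp del: power_divide)
    have "0 \<le> sin (pi * \<xi> / 2) * sinh (pi * y / 2)"
      using y \<xi>3 \<xi> by (intro mult_nonneg_nonneg sin_ge_zero) auto
    then have "0 \<le> sqrt 2 * (sin (pi * \<xi> / 2) * sinh (pi * y / 2))" by (rule mult_nonneg_nonneg[rotated]) simp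
    moreover have "exp (pi * x * y) * sin A = - (sqrt 2 * (sin (pi * \<xi> / 2) * sinh (pi * y / 2)))"
      by (subst im) (simp add: \<xi>)
    ultimately have "exp (pi * x * y) * sin A \<le> 0" by simp
    then have sA: "sin A \<le> 0" by (simp add: mult_le_0_iff)
    have "A \<le> 0"
    proof (rule ccontr)
      assume "\<not> A \<le> 0"
      moreover have "A < pi"
      proof -
        have "\<xi>\<^sup>2 < 9/4" using sq(3) by (simp add: power2_eq_square)
        then have "\<xi>\<^sup>2 - y\<^sup>2 < 9/4" using sq(4) by linarith
        then have "pi * (\<xi>\<^sup>2 - y\<^sup>2) < pi * (9/4)" by (intro mult_strict_left_mono) auto
        then show ?thesis using pi_gt_zero unfolding A_def \<xi> power2_minus by linarith
      qed
      ultimately have "0 < sin A" by (intro sin_gt_zero) auto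
      then show False using sA by simp
    qed
    then have "pi * (\<xi>\<^sup>2 - y\<^sup>2) \<le> pi * (1/4)" unfolding A_def \<xi> power2_minus by linarith
    then have d: "\<xi>\<^sup>2 - 1/4 \<le> y\<^sup>2" by simp
    \<comment> \<open>Linear bound at the zero 1/2 of the cosine. Combined with the hyperbola
      inequality \<open>d\<close> it yields (pi y)^2 / 2 <= pi y^2, impossible for y > 0 because pi
      > 2.\<close>
    have "- cos (pi * \<xi>) = sin (pi * (\<xi> - 1/2))"
      by (simp add: right_diff_distrib sin_diff)
    also have "\<dots> \<le> pi * (\<xi> - 1/2)" using \<xi>2 by (intro sin_x_le_x) auto
    also have "\<dots> \<le> pi * ((\<xi> - 1/2) * (\<xi> + 1/2))" using \<xi>2 mult_left_mono[of 1 "\<xi> + 1/2" "\<xi> - 1/2"] by simp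
    also have "(\<xi> - 1/2) * (\<xi> + 1/2) = \<xi>\<^sup>2 - 1/4" by (simp add: power2_eq_square algebra_simps)
    also have "pi * (\<xi>\<^sup>2 - 1/4) \<le> pi * y\<^sup>2" using d by simp
    finally have "(pi * y)\<^sup>2 / 2 \<le> pi * y\<^sup>2" using q e1 by linarith
    moreover have "(pi * y)\<^sup>2 / 2 = pi * (pi / 2 * y\<^sup>2)" by (simp add: power2_eq_square)
    ultimately have "pi * (pi / 2 * y\<^sup>2) \<le> pi * y\<^sup>2" by (simp only:)
    then have "pi / 2 * y\<^sup>2 \<le> 1 * y\<^sup>2"
      by (subst (asm) mult_le_cancel_left_pos) simp_all
    moreover have "1/4 < \<xi>\<^sup>2" using sq(2) by (simp add: power2_eq_square)
    then have "0 < y\<^sup>2" using d by linarith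
    ultimately have "pi / 2 \<le> 1" by (simp only: mult_le_cancel_right)
    then show ?thesis using pi_gt3 by simp
  qed
qed


text \<open>Both sides of the equation are even in p, so only Im p >= 0 has to be treated;
  multiplying by exp (pi i/8) gives the real form above.\<close>

lemma saddle_gauss_zero:
  assumes p: "exp (- (of_real pi * \<i> / 2 * p\<^sup>2)) = of_real (sqrt 2) * exp (- (of_real pi * \<i> / 8)) * cos (of_real pi * p / 2)"
    and strip: "\<bar>Re p + Im p\<bar> \<le> 1"
  shows "p = 1/2 \<or> p = -1/2"
proof -
  have main: "q = 1/2 \<or> q = -1/2"
    if q: "exp (- (of_real pi * \<i> / 2 * q\<^sup>2)) = of_real (sqrt 2) * exp (- (of_real pi * \<i> / 8)) * cos (of_real pi * q / 2)"
      and strip: "\<bar>Re q + Im q\<bar> \<le> 1" and Im: "Im q \<ge> 0" for q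
  proof -
    define x y where "x = Re q" and "y = Im q"
    have qxy: "q = Complex x y" by (simp add: x_def y_def)
    define A where "A = pi * (x\<^sup>2 - y\<^sup>2) / 2 - pi / 8"
    have "exp (of_real pi * \<i> / 8 + - (of_real pi * \<i> / 2 * q\<^sup>2)) = of_real (sqrt 2) * cos (of_real pi * q / 2)"
      unfolding exp_add q by (simp flip: exp_add)
    moreover have "of_real pi * \<i> / 8 + - (of_real pi * \<i> / 2 * q\<^sup>2) = Complex (pi * x * y) (- A)"
      by (simp add: complex_eq_iff qxy A_def power2_eq_square field_simps)
    ultimately have eq: "exp (Complex (pi * x * y) (- A)) = of_real (sqrt 2) * cos (of_real pi * q / 2)" by simp
    have "cos (of_real pi * q / 2) = cos (of_real (pi * x / 2) + \<i> * of_real (pi * y / 2))"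
      by (simp add: qxy complex_eq_iff Complex_eq field_simps)
    also have "\<dots> = Complex (cos (pi * x / 2) * cosh (pi * y / 2)) (- (sin (pi * x / 2) * sinh (pi * y / 2)))"
      by (simp add: cos_add complex_eq_iff Re_cos Im_cos Re_sin Im_sin cosh_def sinh_def field_simps exp_minus)
    finally have c: "cos (of_real pi * q / 2) = \<dots>" .
    have "y = 0 \<and> (x = 1/2 \<or> x = -1/2)"
    proof (rule saddle_gauss_zero_real)
      show "exp (pi * x * y) * cos (pi * (x\<^sup>2 - y\<^sup>2) / 2 - pi / 8) = sqrt 2 * cos (pi * x / 2) * cosh (pi * y / 2)"
        using eq[THEN arg_cong[of _ _ Re]] unfolding c A_def[symmetric] by (simp add: Re_exp)
      show "exp (pi * x * y) * sin (pi * (x\<^sup>2 - y\<^sup>2) / 2 - pi / 8) = sqrt 2 * sin (pi * x / 2) * sinh (pi * y / 2)"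
        using eq[THEN arg_cong[of _ _ Im]] unfolding c A_def[symmetric] by (simp add: Im_exp)
    qed (use strip Im in \<open>auto simp: x_def y_def\<close>)
    then show ?thesis by (auto simp: qxy complex_eq_iff)
  qed
  show ?thesis
  proof (cases "Im p \<ge> 0")
    case True
    then show ?thesis using main[OF p strip] by simp
  next
    case False
    have "- p = 1/2 \<or> - p = - 1/2"
    proof (rule main)
      show "\<bar>Re (- p) + Im (- p)\<bar> \<le> 1" using strip by auto
    qed (use False p in auto)
    then show ?thesis by (metis minus_divide_left minus_minus)
  qed
qed

text \<open>The candidates p = 1/2 and p = -1/2 correspond to z = 3/4 and z = 1/4, where
  \<open>saddle_gauss_quarter\<close> and the reflection exclude a zero.\<close>

lemma saddle_gauss_nonzero:
  assumes "\<bar>Re p + Im p\<bar> \<le> 1"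
  shows "saddle_gauss ((1 + p) / 2) \<noteq> 0"
proof
  assume z: "saddle_gauss ((1 + p) / 2) = 0"
  then have "exp (- (of_real pi * \<i> / 2 * p\<^sup>2)) = of_real (sqrt 2) * exp (- (of_real pi * \<i> / 8)) * cos (of_real pi * p / 2)"
    using saddle_gauss_closed_form_centred[of p] by simp
  from saddle_gauss_zero[OF this assms] have "(1 + p) / 2 = 1/4 \<or> (1 + p) / 2 = 1 - 1/4"
  proof
    assume "p = 1/2"
    show ?thesis unfolding \<open>p = 1/2\<close> by simp
  next
    assume "p = -1/2"
    show ?thesis unfolding \<open>p = -1/2\<close> by simp
  qed
  then show False using z saddle_gauss_quarter saddle_gauss_reflect[of "1/4"] by metis
qed

text \<open>For |Im p| >= 1 the cosine dominates the numerator, because Re p Im p <= 0 keeps the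
  Gaussian at modulus at most 1; dividing by cos (pi p) leaves the rate exp (-pi |Im p| / 2). The
  rest of the strip is compact and free of zeros.\<close>

lemma saddle_gauss_lower_bound:
  "\<exists>C>0. \<forall>p. \<bar>Re p + Im p\<bar> \<le> 1 \<longrightarrow> C * exp (- (pi * \<bar>Im p\<bar> / 2)) \<le> norm (saddle_gauss ((1 + p) / 2))"
proof -
  have large: "(3/20) * exp (- (pi * \<bar>Im p\<bar> / 2)) \<le> norm (saddle_gauss ((1 + p) / 2))"
    if p: "\<bar>Re p + Im p\<bar> \<le> 1" "1 \<le> \<bar>Im p\<bar>" for p
  proof -
    define y where "y = \<bar>Im p\<bar>"
    define E where "E = exp (pi * y / 2)"
    have y: "1 \<le> y" using p by (simp add: y_def)
    have "3/2 \<le> pi * y / 2" using mult_mono[of 3 pi 1 y] pi_gt3 y by auto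
    then have "exp (3/2) \<le> E" by (simp add: E_def)
    moreover have "1 + 3/2 + (3/2)\<^sup>2 / 2 \<le> exp (3/2 :: real)" by (rule exp_lower_Taylor_quadratic) simp
    ultimately have E: "7/2 \<le> E" by (simp add: power2_eq_square)
    have "Re p * Im p \<le> 0"
    proof -
      have "Re p * Im p = (Re p + Im p) * Im p - (Im p)\<^sup>2" by (simp add: power2_eq_square algebra_simps)
      also have "(Re p + Im p) * Im p \<le> \<bar>Re p + Im p\<bar> * \<bar>Im p\<bar>" by (simp flip: abs_mult)
      also have "\<dots> \<le> 1 * \<bar>Im p\<bar>" using p by (intro mult_right_mono) auto
      also have "1 * \<bar>Im p\<bar> - (Im p)\<^sup>2 \<le> 0" using mult_right_mono[OF y, of y] by (simp add: y_def power2_eq_square)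
      finally show ?thesis by simp
    qed
    then have e1: "norm (exp (- (of_real pi * \<i> / 2 * p\<^sup>2))) \<le> 1"
      by (simp add: Im_power2 mult_le_0_iff zero_le_mult_iff mult.assoc)
    have c1: "norm (cos (of_real pi * p / 2)) \<ge> sinh (pi * y / 2)"
    proof -
      have s: "sin_den ((1 + p) / 2) = 2 * \<i> * cos (of_real pi * p / 2)"
        by (simp add: sin_den_eq ring_distribs add_divide_distrib sin_add)
      have "\<bar>sinh (pi * Im p / 2)\<bar> = sinh (pi * y / 2)"
        using y by (cases "Im p \<ge> 0") (auto simp: y_def abs_if mult_less_0_iff)
      then show ?thesis using norm_sin_den_ge_sinh[of "(1 + p) / 2"] unfolding s by (simp add: norm_mult)
    qed
    have c2: "norm (cos (of_real pi * p)) \<le> E\<^sup>2"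
    proof -
      have "norm (cos (of_real pi * p)) \<le> (norm (exp (\<i> * (of_real pi * p))) + norm (exp (- (\<i> * (of_real pi * p))))) / 2"
        unfolding cos_exp_eq norm_divide norm_numeral by (intro divide_right_mono norm_triangle_ineq) auto
      also have "\<dots> = cosh (pi * y)"
        by (simp add: cosh_def y_def abs_if add.commute)
      also have "\<dots> \<le> exp (pi * y)" using y by (intro cosh_real_le_exp) auto
      finally show ?thesis by (simp add: E_def flip: exp_double)
    qed
    have "sqrt 2 \<ge> 7/5" by (rule real_le_rsqrt) (simp add: power2_eq_square)
    moreover have "sinh (pi * y / 2) \<ge> (E - 1/3) / 2"
    proof -
      have "sinh (pi * y / 2) = (E - inverse E) / 2" by (simp add: sinh_def E_def exp_minus)
      moreover have "inverse E \<le> inverse 3" using E by (intro le_imp_inverse_le) auto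
      ultimately show ?thesis by simp
    qed
    ultimately have "7/5 * ((E - 1/3) / 2) \<le> sqrt 2 * norm (cos (of_real pi * p / 2))"
      using c1 E by (intro mult_mono) auto
    \<comment> \<open>The losses 7/30 and 1 fit into the slack (7/10 - 3/10) E, as E >= 7/2.\<close>
    moreover have "3/10 * E \<le> a - b" if "7/5 * ((E - 1/3) / 2) \<le> a" "b \<le> 1" for a b
      using that E by (simp add: field_simps)
    ultimately have "3/10 * E \<le> sqrt 2 * norm (cos (of_real pi * p / 2)) - norm (exp (- (of_real pi * \<i> / 2 * p\<^sup>2)))"
      using e1 by blast
    also have "\<dots> \<le> norm (exp (- (of_real pi * \<i> / 2 * p\<^sup>2)) - of_real (sqrt 2) * exp (- (of_real pi * \<i> / 8)) * cos (of_real pi * p / 2))"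
      using norm_triangle_ineq2[of "of_real (sqrt 2) * exp (- (of_real pi * \<i> / 8)) * cos (of_real pi * p / 2)" "exp (- (of_real pi * \<i> / 2 * p\<^sup>2))"]
      by (simp add: norm_mult norm_minus_commute)
    also have "\<dots> = norm (saddle_gauss ((1 + p) / 2)) * (2 * norm (cos (of_real pi * p)))"
      using saddle_gauss_closed_form_centred[of p, THEN arg_cong[of _ _ norm]] by (simp add: norm_mult)
    also have "\<dots> \<le> norm (saddle_gauss ((1 + p) / 2)) * (2 * E\<^sup>2)"
      using c2 by (intro mult_left_mono) auto
    finally have "3/20 * inverse E \<le> norm (saddle_gauss ((1 + p) / 2))"
      using E by (simp add: power2_eq_square field_simps)
    then show ?thesis by (simp add: E_def y_def exp_minus)
  qed
  let ?K = "{p. \<bar>Re p + Im p\<bar> \<le> 1 \<and> \<bar>Im p\<bar> \<le> 1}"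
  have K: "compact ?K"
  proof (rule compact_eq_bounded_closed[THEN iffD2], rule conjI)
    show "bounded ?K"
    proof (rule boundedI)
      fix p assume "p \<in> ?K"
      then show "norm p \<le> 3" using cmod_le[of p] by auto
    qed
    show "closed ?K" by (intro closed_Collect_conj closed_Collect_le continuous_intros)
  qed
  have K0: "?K \<noteq> {}" by (auto intro: exI[of _ 0])
  have "continuous_on ?K (\<lambda>p. saddle_gauss ((1 + p) / 2))"
    by (rule continuous_on_compose2[OF holomorphic_on_imp_continuous_on[OF holomorphic_saddle_gauss]])
       (auto intro!: continuous_intros)
  then have "continuous_on ?K (\<lambda>p. norm (saddle_gauss ((1 + p) / 2)))" by (rule continuous_on_norm)
  from continuous_attains_inf[OF K K0 this]
  obtain p0 where p0: "p0 \<in> ?K" "\<And>p. p \<in> ?K \<Longrightarrow> norm (saddle_gauss ((1 + p0) / 2)) \<le> norm (saddle_gauss ((1 + p) / 2))"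
    by blast
  define c where "c = norm (saddle_gauss ((1 + p0) / 2))"
  have c: "c > 0" using saddle_gauss_nonzero[of p0] p0(1) by (simp add: c_def)
  show ?thesis
  proof (intro exI[of _ "min c (3/20)"] conjI allI impI)
    fix p assume p: "\<bar>Re p + Im p\<bar> \<le> 1"
    let ?e = "exp (- (pi * \<bar>Im p\<bar> / 2))"
    show "min c (3/20) * ?e \<le> norm (saddle_gauss ((1 + p) / 2))"
    proof (cases "\<bar>Im p\<bar> \<le> 1")
      case True
      have "min c (3/20) * ?e \<le> c * 1" using c by (intro mult_mono) auto
      also have "\<dots> \<le> norm (saddle_gauss ((1 + p) / 2))" using p0(2)[of p] p True by (simp add: c_def)
      finally show ?thesis .
    next
      case False
      have "min c (3/20) * ?e \<le> 3/20 * ?e" by (intro mult_right_mono) auto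
      also have "\<dots> \<le> norm (saddle_gauss ((1 + p) / 2))" using large p False by simp
      finally show ?thesis .
    qed
  qed (use c in auto)
qed

section \<open>The saddle point estimate\<close>

text \<open>
  For \<open>\<eta> = b se (k + i)\<close> and \<open>x = b se (X + i)\<close> with \<open>b > 0\<close>, the quantity \<open>\<pi> b\<^sup>2 descent k X\<close> is the real
  part of the phase at \<open>x\<close> minus that at \<open>\<eta>\<close>; moving \<open>X\<close> moves \<open>x\<close> along the line through \<open>\<eta>\<close>.
\<close>

definition descent :: "real \<Rightarrow> real \<Rightarrow> real" where
  "descent k X = (k\<^sup>2 - 1) * ln ((1 + X\<^sup>2) / (1 + k\<^sup>2)) + 4 * k * (arctan X - arctan k) + k\<^sup>2 - X\<^sup>2"

lemma one_plus_square_pos: "0 < 1 + (x::real)\<^sup>2"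
  by (simp add: add_pos_nonneg)

text \<open>After adding (X - k)^2 the derivative in X is -2 (X - k) (k X + 1) / (1 + X^2), which
  for nonnegative k and X changes sign only at X = k.\<close>

lemma descent_nonneg:
  assumes "k \<ge> 0" "X \<ge> 0"
  shows "descent k X \<le> - (X - k)\<^sup>2"
proof -
  define D where "D = (\<lambda>X. (k\<^sup>2 - 1) * (ln (1 + X\<^sup>2) - ln (1 + k\<^sup>2)) + 4 * k * (arctan X - arctan k) + k\<^sup>2 - X\<^sup>2 + (X - k)\<^sup>2)"
  have deriv: "(D has_real_derivative - (2 * (X - k) * (k * X + 1) / (1 + X\<^sup>2))) (at X)" for X
  proof -
    have "1 + X\<^sup>2 \<noteq> 0" using one_plus_square_pos[of X] by simp
    then have "(k\<^sup>2 - 1) * (2 * X / (1 + X\<^sup>2)) + 4 * k * (1 / (1 + X\<^sup>2)) - 2 * X + 2 * (X - k)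
      = - (2 * (X - k) * (k * X + 1) / (1 + X\<^sup>2))"
      by (simp add: divide_simps) (simp add: power2_eq_square algebra_simps)
    moreover have "(D has_real_derivative (k\<^sup>2 - 1) * (2 * X / (1 + X\<^sup>2)) + 4 * k * (1 / (1 + X\<^sup>2)) - 2 * X + 2 * (X - k)) (at X)"
      unfolding D_def using one_plus_square_pos[of X]
      by (auto intro!: derivative_eq_intros simp: divide_inverse)
    ultimately show ?thesis by simp
  qed
  have "D X \<le> D k"
  proof (cases "X \<le> k")
    case True
    then show ?thesis
    proof (rule DERIV_nonneg_imp_nondecreasing)
      fix y assume y: "X \<le> y" "y \<le> k"
      have "0 \<le> - (2 * (y - k) * (k * y + 1) / (1 + y\<^sup>2))"
        using y assms one_plus_square_pos[of y] by (simp add: divide_nonpos_pos mult_nonpos_nonneg)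
      then show "\<exists>l. (D has_real_derivative l) (at y) \<and> 0 \<le> l" using deriv by blast
    qed
  next
    case False
    then have "k \<le> X" by simp
    then show ?thesis
    proof (rule DERIV_nonpos_imp_nonincreasing)
      fix y assume y: "k \<le> y" "y \<le> X"
      have "0 \<le> 2 * (y - k) * (k * y + 1) / (1 + y\<^sup>2)"
        using y assms one_plus_square_pos[of y] by (intro divide_nonneg_pos mult_nonneg_nonneg) auto
      then show "\<exists>l. (D has_real_derivative l) (at y) \<and> l \<le> 0" using deriv[of y] by (intro exI conjI) auto
    qed
  qed
  moreover have "D k = 0" by (simp add: D_def)
  moreover have "D X = descent k X + (X - k)\<^sup>2"
    using one_plus_square_pos[of X] one_plus_square_pos[of k] by (simp add: D_def descent_def ln_div)
  ultimately show ?thesis by simp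
qed

lemma arctan_ge: "x \<ge> 0 \<Longrightarrow> x / (1 + x\<^sup>2) \<le> arctan x"
proof -
  assume x: "x \<ge> 0"
  have "(1 + 0\<^sup>2) * arctan 0 - 0 \<le> (1 + x\<^sup>2) * arctan x - x"
  proof (rule DERIV_nonneg_imp_nondecreasing[OF x])
    fix y :: real assume y: "0 \<le> y"
    have "((\<lambda>x. (1 + x\<^sup>2) * arctan x - x) has_real_derivative 2 * y * arctan y) (at y)"
      using one_plus_square_pos[of y] by (auto intro!: derivative_eq_intros simp: divide_simps)
    moreover have "0 \<le> 2 * y * arctan y" using y by simp
    ultimately show "\<exists>l. ((\<lambda>x. (1 + x\<^sup>2) * arctan x - x) has_real_derivative l) (at y) \<and> 0 \<le> l"
      by blast
  qed
  then show ?thesis using one_plus_square_pos[of x] by (simp add: divide_le_eq mult.commute)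
qed

lemma descent_minus: "descent k (- X) = descent k X - 8 * k * arctan X"
  by (simp add: descent_def arctan_minus algebra_simps)

text \<open>For k, X >= 0 \<open>descent_nonneg\<close> suffices. At X = -Y it only yields (Y -
  k)^2, which is too weak near Y = k; there the term 8 k arctan Y of \<open>descent_minus\<close>
  takes over. The rate depends on a bound for |k| because arctan is bounded while (Y + k)^2 exceeds
  (Y - k)^2 by 4 k Y.\<close>

lemma descent_le:
  assumes "\<bar>k\<bar> \<le> k0"
  shows "descent k X \<le> - (2 / (9 * (1 + (2 * k0 + 1)\<^sup>2))) * (X - k)\<^sup>2"
proof -
  define M where "M = 1 + (2 * k0 + 1)\<^sup>2"
  have k0: "k0 \<ge> 0" using assms by linarith
  have "1\<^sup>2 \<le> (2 * k0 + 1)\<^sup>2" using k0 by (intro power_mono) auto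
  then have M: "M \<ge> 2" by (simp add: M_def)
  \<comment> \<open>The constant serves two regimes at once: at most 2 / M for the excess 4 k Y, at
    most 1/9 for large Y.\<close>
  have \<kappa>: "2 / (9 * M) \<le> 1/9" "2 / (9 * M) \<le> 2 / M" "2 / (9 * M) \<ge> 0" using M by (auto simp: field_simps)
  have main: "descent k X \<le> - (2 / (9 * M)) * (X - k)\<^sup>2" if k: "0 \<le> k" "k \<le> k0" for k X
  proof (cases "X \<ge> 0")
    case True
    have "descent k X \<le> - (X - k)\<^sup>2" using k True by (intro descent_nonneg)
    also have "\<dots> \<le> - (2 / (9 * M)) * (X - k)\<^sup>2"
      using mult_right_mono[of "2 / (9 * M)" 1 "(X - k)\<^sup>2"] \<kappa> by simp
    finally show ?thesis .
  next
    case False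
    define Y where "Y = - X"
    have Y: "Y \<ge> 0" "X = - Y" using False by (auto simp: Y_def)
    have aY: "arctan Y \<ge> 0" using Y by simp
    have 1: "descent k X \<le> - (Y - k)\<^sup>2 - 8 * k * arctan Y"
      using descent_nonneg[OF k(1) Y(1)] unfolding Y(2) descent_minus by simp
    have "(2 / (9 * M)) * (Y + k)\<^sup>2 \<le> (Y - k)\<^sup>2 + 8 * k * arctan Y"
    proof (cases "Y \<le> 2 * k + 1")
      case True
      have "Y\<^sup>2 \<le> (2 * k0 + 1)\<^sup>2" using True k Y by (intro power_mono) auto
      then have "Y / M \<le> Y / (1 + Y\<^sup>2)"
        unfolding M_def using Y one_plus_square_pos[of Y] by (intro divide_left_mono) (auto intro!: mult_pos_pos one_plus_square_pos)
      also have "\<dots> \<le> arctan Y" by (rule arctan_ge[OF Y(1)])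
      finally have "8 * k * (Y / M) \<le> 8 * k * arctan Y" using k by (intro mult_left_mono) auto
      moreover have "(2 / (9 * M)) * (Y + k)\<^sup>2 = (2 / (9 * M)) * (Y - k)\<^sup>2 + (2 / (9 * M)) * (4 * k * Y)"
        by (simp add: power2_eq_square algebra_simps add_divide_distrib diff_divide_distrib)
      moreover have "(2 / (9 * M)) * (Y - k)\<^sup>2 \<le> 1 * (Y - k)\<^sup>2" using \<kappa> by (intro mult_right_mono) auto
      moreover have "(2 / (9 * M)) * (4 * k * Y) \<le> (2 / M) * (4 * k * Y)" using k Y by (intro mult_right_mono \<kappa>(2)) auto
      moreover have "(2 / M) * (4 * k * Y) = 8 * k * (Y / M)" by simp
      ultimately show ?thesis by linarith
    next
      case False
      \<comment> \<open>Beyond 2 k + 1 the distance Y - k is already a third of Y + k, and the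
        arctangent may be dropped.\<close>
      then have "(Y + k) / 3 \<le> Y - k" using k by simp
      then have "((Y + k) / 3)\<^sup>2 \<le> (Y - k)\<^sup>2" using k Y by (intro power_mono) auto
      then have "1/9 * (Y + k)\<^sup>2 \<le> (Y - k)\<^sup>2" by (simp add: power_divide)
      moreover have "(2 / (9 * M)) * (Y + k)\<^sup>2 \<le> 1/9 * (Y + k)\<^sup>2" using \<kappa> by (intro mult_right_mono) auto
      moreover have "0 \<le> 8 * k * arctan Y" using k aY by simp
      ultimately show ?thesis by linarith
    qed
    moreover have "(X - k)\<^sup>2 = (Y + k)\<^sup>2" unfolding Y(2) by (simp add: power2_eq_square algebra_simps)
    ultimately show ?thesis using 1 by simp
  qed
  show ?thesis
  proof (cases "k \<ge> 0")
    case True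
    then show ?thesis using main[of k X] assms by (simp add: M_def)
  next
    case False
    have "descent k X = descent (- k) (- X)" by (simp add: descent_def arctan_minus algebra_simps)
    also have "\<dots> \<le> - (2 / (9 * M)) * (- X - - k)\<^sup>2" using main[of "- k" "- X"] assms False by simp
    also have "(- X - - k)\<^sup>2 = (X - k)\<^sup>2" by (simp add: power2_eq_square algebra_simps)
    finally show ?thesis by (simp add: M_def)
  qed
qed

text \<open>With 2 pi i eta^2 = s - 1 this is the exponent of x^(s - 1) exp (-pi i x^2). Its
  derivative 2 pi i (eta^2 / x - x) vanishes at eta.\<close>

definition phase :: "complex \<Rightarrow> complex \<Rightarrow> complex" where
  "phase \<eta> x = 2 * of_real pi * \<i> * \<eta>\<^sup>2 * Ln x - of_real pi * \<i> * x\<^sup>2"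

text \<open>The argument of X + i is pi/2 - arctan X for every real X, and the rotation by -pi/4
  keeps it inside the principal range.\<close>

lemma Ln_rotated:
  assumes "b > 0"
  shows "Ln (of_real b * se * Complex X 1) = Complex (ln b + ln (1 + X\<^sup>2) / 2) (pi / 4 - arctan X)"
proof (rule Ln_unique)
  have p: "1 + X\<^sup>2 > 0" by (rule one_plus_square_pos)
  have "exp (ln (1 + X\<^sup>2) / 2) = sqrt (1 + X\<^sup>2)"
    using p by (simp add: ln_sqrt[symmetric])
  then have "exp (Complex (ln b + ln (1 + X\<^sup>2) / 2) (pi / 4 - arctan X)) = of_real (b * sqrt (1 + X\<^sup>2)) * cis (pi / 4 - arctan X)"
    using assms by (simp add: exp_eq_polar exp_add)
  also have "cis (pi / 4 - arctan X) = se * cis (pi / 2 - arctan X)"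
    by (simp add: se_def cis_mult)
  also have "of_real (b * sqrt (1 + X\<^sup>2)) * (se * cis (pi / 2 - arctan X)) = of_real b * se * Complex X 1"
  proof -
    have "of_real (sqrt (1 + X\<^sup>2)) * cis (pi / 2 - arctan X) = Complex X 1"
      using p by (simp add: complex_eq_iff cos_diff sin_diff cos_arctan sin_arctan)
    then show ?thesis by (simp add: mult_ac)
  qed
  finally show "exp (Complex (ln b + ln (1 + X\<^sup>2) / 2) (pi / 4 - arctan X)) = of_real b * se * Complex X 1" .
qed (use arctan_bounded[of X] pi_gt_zero in auto)

lemma phase_rotated:
  assumes b: "b > 0"
  defines "z \<equiv> \<lambda>X. of_real b * se * Complex X 1"
  shows "Re (phase (z k) (z X) - phase (z k) (z k)) = pi * b\<^sup>2 * descent k X"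
proof -
  have z2: "(z X)\<^sup>2 = - \<i> * of_real (b\<^sup>2) * Complex (X\<^sup>2 - 1) (2 * X)" for X
  proof -
    have "(Complex X 1)\<^sup>2 = Complex (X\<^sup>2 - 1) (2 * X)" by (simp add: complex_eq_iff power2_eq_square)
    then show ?thesis by (simp add: z_def power_mult_distrib se_simps)
  qed
  have "phase (z k) (z X) - phase (z k) (z k) =
     of_real (2 * pi * b\<^sup>2) * (Complex (k\<^sup>2 - 1) (2 * k) * (Ln (z X) - Ln (z k)))
       - of_real (pi * b\<^sup>2) * (Complex (X\<^sup>2 - 1) (2 * X) - Complex (k\<^sup>2 - 1) (2 * k))"
    unfolding phase_def z2 by (simp add: algebra_simps)
  also have "Ln (z X) - Ln (z k) = Complex ((ln (1 + X\<^sup>2) - ln (1 + k\<^sup>2)) / 2) (arctan k - arctan X)"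
    unfolding z_def Ln_rotated[OF b] by (simp add: complex_eq_iff diff_divide_distrib)
  finally have "Re (phase (z k) (z X) - phase (z k) (z k)) =
      2 * pi * b\<^sup>2 * ((k\<^sup>2 - 1) * ((ln (1 + X\<^sup>2) - ln (1 + k\<^sup>2)) / 2) - 2 * k * (arctan k - arctan X))
       - pi * b\<^sup>2 * (X\<^sup>2 - k\<^sup>2)"
    by simp
  also have "\<dots> = pi * b\<^sup>2 * descent k X"
    using one_plus_square_pos[of X] one_plus_square_pos[of k]
    by (simp add: descent_def ln_div) (simp add: field_simps)
  finally show ?thesis .
qed

section \<open>The sector condition and the expansion at the saddle\<close>

lemma Re_add_Im_le_norm: "Re z + Im z \<le> sqrt 2 * norm z"
proof -
  have "(Re z + Im z)\<^sup>2 \<le> 2 * ((Re z)\<^sup>2 + (Im z)\<^sup>2)"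
    using zero_le_power2[of "Re z - Im z"] by (simp add: power2_sum power2_diff)
  also have "\<dots> = (sqrt 2 * norm z)\<^sup>2" by (simp add: power_mult_distrib cmod_power2)
  finally show ?thesis by (rule power2_le_imp_le) simp
qed

text \<open>Here b is the distance of eta from the line Re + Im = 0 and k the coordinate along
  \<open>se\<close> in units of b, so motion in direction \<open>se\<close> changes only k.\<close>

lemma rotated_form:
  assumes "Re \<eta> + Im \<eta> > 0"
  defines "b \<equiv> (Re \<eta> + Im \<eta>) / sqrt 2" and "k \<equiv> (Re \<eta> - Im \<eta>) / (Re \<eta> + Im \<eta>)"
  shows "b > 0" "\<eta> = of_real b * se * Complex k 1" "\<eta> + of_real u * se = of_real b * se * Complex (k + u / b) 1"
    "b * \<bar>k\<bar> \<le> norm \<eta>"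
proof -
  show b: "b > 0" using assms by (simp add: b_def)
  have bk: "b * k = (Re \<eta> - Im \<eta>) / sqrt 2" using assms(1) by (simp add: b_def k_def)
  have s: "sqrt 2 * b = Re \<eta> + Im \<eta>" "sqrt 2 * (b * k) = Re \<eta> - Im \<eta>"
    unfolding bk by (simp_all add: b_def)
  show *: "\<eta> = of_real b * se * Complex k 1"
  proof (rule complex_eqI)
    have "Re (of_real b * se * Complex k 1) = (sqrt 2 * (b * k) + sqrt 2 * b) / 2"
      by (simp add: se_simps algebra_simps)
    then show "Re \<eta> = Re (of_real b * se * Complex k 1)" unfolding s by simp
    have "Im (of_real b * se * Complex k 1) = (sqrt 2 * b - sqrt 2 * (b * k)) / 2"
      by (simp add: se_simps algebra_simps)
    then show "Im \<eta> = Im (of_real b * se * Complex k 1)" unfolding s by simp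
  qed
  have "Complex (k + u / b) 1 = Complex k 1 + of_real (u / b)" by (simp add: complex_eq_iff)
  then have "of_real b * se * Complex (k + u / b) 1 = of_real b * se * Complex k 1 + of_real u * se"
    using b by (simp add: algebra_simps)
  then show "\<eta> + of_real u * se = of_real b * se * Complex (k + u / b) 1" using * by simp
  have "norm \<eta> = b * norm (Complex k 1)" by (subst *) (use b in \<open>simp add: norm_mult se_simps\<close>)
  moreover have "\<bar>k\<bar> \<le> norm (Complex k 1)" using abs_Re_le_cmod[of "Complex k 1"] by simp
  ultimately show "b * \<bar>k\<bar> \<le> norm \<eta>" using b by simp
qed

text \<open>The sector condition says s0 |eta| <= b, hence |k| <= 1 / s0, and
  \<open>descent_le\<close> applies with k0 = 1 / s0. The factors b^2 cancel, so the Gaussian rate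
  in u does not depend on eta.\<close>

lemma phase_descent:
  fixes \<eta> :: complex and s0 u :: real
  assumes s0: "s0 > 0" and \<eta>: "\<eta> \<noteq> 0" "s0 * norm \<eta> \<le> (Re \<eta> + Im \<eta>) / sqrt 2"
  shows "Re (phase \<eta> (\<eta> + of_real u * se) - phase \<eta> \<eta>) \<le> - (2 * pi / (9 * (1 + (2 / s0 + 1)\<^sup>2))) * u\<^sup>2"
proof -
  have "0 < s0 * norm \<eta>" using s0 \<eta> by simp
  then have "0 < (Re \<eta> + Im \<eta>) / sqrt 2" using \<eta>(2) by (rule less_le_trans)
  then have pos: "Re \<eta> + Im \<eta> > 0" by (simp add: zero_less_divide_iff)
  define b where "b = (Re \<eta> + Im \<eta>) / sqrt 2"
  define k where "k = (Re \<eta> - Im \<eta>) / (Re \<eta> + Im \<eta>)"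
  note rot = rotated_form[OF pos, folded b_def k_def]
  have "b * \<bar>k\<bar> \<le> b * (1 / s0)"
  proof -
    have "s0 * (b * \<bar>k\<bar>) \<le> s0 * norm \<eta>" using rot(4) s0 by simp
    also have "\<dots> \<le> b" using \<eta>(2) by (simp add: b_def)
    finally show ?thesis using s0 by (simp add: field_simps)
  qed
  then have k: "\<bar>k\<bar> \<le> 1 / s0" using rot(1) by (rule mult_left_le_imp_le)
  have "Re (phase \<eta> (\<eta> + of_real u * se) - phase \<eta> \<eta>) = pi * b\<^sup>2 * descent k (k + u / b)"
    unfolding rot(3) using phase_rotated[OF rot(1), of k "k + u / b"] rot(2) by simp
  also have "\<dots> \<le> pi * b\<^sup>2 * (- (2 / (9 * (1 + (2 * (1 / s0) + 1)\<^sup>2))) * (k + u / b - k)\<^sup>2)"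
    by (intro mult_left_mono descent_le k) auto
  also have "\<dots> = - (2 * pi / (9 * (1 + (2 / s0 + 1)\<^sup>2))) * (b\<^sup>2 * (u / b)\<^sup>2)"
    by simp
  also have "b\<^sup>2 * (u / b)\<^sup>2 = u\<^sup>2" using rot(1) by (simp add: power_divide)
  finally show ?thesis .
qed

text \<open>The derivative at xi factors as 2 pi i (eta - xi) (eta / xi + 1). Along the segment Re
  xi + Im xi keeps at least half of Re eta + Im eta, so |eta / xi| <= 2 / s0.\<close>

lemma phase_offset:
  fixes \<eta> :: complex and s0 u \<delta> :: real
  assumes s0: "s0 > 0" and \<eta>: "\<eta> \<noteq> 0" "s0 * norm \<eta> \<le> (Re \<eta> + Im \<eta>) / sqrt 2"
    and \<delta>: "\<bar>\<delta>\<bar> \<le> 1/2" "(Re \<eta> + Im \<eta>) / 2 \<le> Re \<eta> + Im \<eta> + \<delta>"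
  defines "x0 \<equiv> \<eta> + of_real u * se"
  shows "norm (phase \<eta> (x0 + of_real \<delta>) - phase \<eta> x0) \<le> pi * (1 + 2 / s0) * (\<bar>u\<bar> + 1)"
proof -
  have "0 < s0 * norm \<eta>" using s0 \<eta> by simp
  then have "0 < (Re \<eta> + Im \<eta>) / sqrt 2" using \<eta>(2) by (rule less_le_trans)
  then have pos: "Re \<eta> + Im \<eta> > 0" by (simp add: zero_less_divide_iff)
  have "norm (phase \<eta> (x0 + of_real \<delta>) - phase \<eta> x0) \<le> (2 * pi * (\<bar>u\<bar> + 1/2) * (1 + 2 / s0)) * norm (x0 + of_real \<delta> - x0)"
  proof (rule field_differentiable_bound)
    show "convex (closed_segment x0 (x0 + of_real \<delta>))" by simp
    fix \<xi> assume "\<xi> \<in> closed_segment x0 (x0 + of_real \<delta>)"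
    then obtain r where r: "0 \<le> r" "r \<le> 1" "\<xi> = (1 - r) *\<^sub>R x0 + r *\<^sub>R (x0 + of_real \<delta>)" by (auto simp: in_segment)
    have \<xi>: "\<xi> = \<eta> + of_real u * se + of_real (r * \<delta>)"
      unfolding r(3) x0_def by (simp add: scaleR_conv_of_real algebra_simps)
    define rd where "rd = r * \<delta>"
    have "(Re \<eta> + Im \<eta>) / 2 \<le> Re \<eta> + Im \<eta> + rd"
    proof (cases "\<delta> \<ge> 0")
      case True
      then have "0 \<le> rd" using r by (simp add: rd_def)
      then show ?thesis using pos by (simp add: field_simps)
    next
      case False
      then have "\<delta> \<le> rd" using r mult_right_mono_neg[of r 1 \<delta>] by (simp add: rd_def)
      then show ?thesis using \<delta> by linarith
    qed
    also have "Re \<eta> + Im \<eta> + rd = Re \<xi> + Im \<xi>" unfolding \<xi> rd_def by (simp add: se_simps)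
    finally have ri: "(Re \<eta> + Im \<eta>) / 2 \<le> Re \<xi> + Im \<xi>" .
    then have posx: "Re \<xi> + Im \<xi> > 0" using pos by (simp add: field_simps)
    then have nz: "\<xi> \<noteq> 0" and \<xi>_cut: "\<xi> \<notin> \<real>\<^sub>\<le>\<^sub>0" by (auto simp: complex_nonpos_Reals_iff)
    show "(phase \<eta> has_field_derivative 2 * of_real pi * \<i> * \<eta>\<^sup>2 * inverse \<xi> - of_real pi * \<i> * (2 * \<xi>)) (at \<xi> within closed_segment x0 (x0 + of_real \<delta>))"
      unfolding phase_def[abs_def]
      by (rule DERIV_subset[where s = UNIV]) (use \<xi>_cut in \<open>auto intro!: derivative_eq_intros\<close>)
    have "s0 * norm \<eta> \<le> sqrt 2 * norm \<xi> * 2 / sqrt 2"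
    proof -
      have "(Re \<eta> + Im \<eta>) / sqrt 2 \<le> (sqrt 2 * norm \<xi> * 2) / sqrt 2"
        using ri Re_add_Im_le_norm[of \<xi>] by (intro divide_right_mono) auto
      then show ?thesis using \<eta>(2) by simp
    qed
    then have q: "norm \<eta> / norm \<xi> \<le> 2 / s0" using nz s0 by (simp add: field_simps)
    have "2 * of_real pi * \<i> * \<eta>\<^sup>2 * inverse \<xi> - of_real pi * \<i> * (2 * \<xi>) = 2 * of_real pi * \<i> * ((\<eta> - \<xi>) * (\<eta> / \<xi> + 1))"
      using nz by (simp add: field_simps power2_eq_square)
    also have "norm \<dots> = 2 * pi * (norm (\<eta> - \<xi>) * norm (\<eta> / \<xi> + 1))" by (simp add: norm_mult)
    also have "\<dots> \<le> 2 * pi * ((\<bar>u\<bar> + 1/2) * (1 + 2 / s0))"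
    proof (intro mult_left_mono mult_mono)
      have "\<eta> - \<xi> = - (of_real u * se + of_real (r * \<delta>))" by (simp add: \<xi>)
      then have "norm (\<eta> - \<xi>) \<le> norm (of_real u * se) + norm (of_real (r * \<delta>) :: complex)"
        by (simp only: norm_minus_cancel norm_triangle_ineq)
      also have "\<dots> \<le> \<bar>u\<bar> + 1/2"
        using mult_mono[of r 1 "\<bar>\<delta>\<bar>" "1/2"] r \<delta> by (simp add: norm_mult se_simps abs_mult)
      finally show "norm (\<eta> - \<xi>) \<le> \<bar>u\<bar> + 1/2" .
      show "norm (\<eta> / \<xi> + 1) \<le> 1 + 2 / s0"
        using norm_triangle_ineq[of "\<eta> / \<xi>" 1] q by (simp add: norm_divide)
    qed auto
    finally show "norm (2 * of_real pi * \<i> * \<eta>\<^sup>2 * inverse \<xi> - of_real pi * \<i> * (2 * \<xi>)) \<le> 2 * pi * (\<bar>u\<bar> + 1/2) * (1 + 2 / s0)"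
      by (simp add: mult.assoc)
  qed auto
  also have "\<dots> \<le> (2 * pi * (\<bar>u\<bar> + 1) * (1 + 2 / s0)) * (1/2)"
    using \<delta> s0 by (intro mult_mono) auto
  also have "2 * pi * A * B * (1/2) = pi * B * A" for A B :: real by simp
  finally show ?thesis .
qed

text \<open>The derivative of the remainder is y^2 / (1 + y), and |1 + y| >= 3/4 gives the constant
  4/3.\<close>

lemma Ln_taylor_bound:
  assumes "norm z \<le> 1/4"
  shows "norm (Ln (1 + z) - z + z\<^sup>2 / 2) \<le> 4/3 * norm z ^ 3"
proof -
  have "norm ((Ln (1 + z) - z + z\<^sup>2 / 2) - (Ln (1 + 0) - 0 + 0\<^sup>2 / 2)) \<le> (4/3 * norm z ^ 2) * norm (z - 0)"
  proof (rule field_differentiable_bound[where S = "cball 0 (norm z)"])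
    fix y :: complex assume "y \<in> cball 0 (norm z)"
    then have y: "norm y \<le> norm z" by simp
    then have "\<bar>Re y\<bar> < 1" using abs_Re_le_cmod[of y] assms by linarith
    then have 1: "1 + y \<notin> \<real>\<^sub>\<le>\<^sub>0" and nz: "1 + y \<noteq> 0" by (auto simp: complex_nonpos_Reals_iff complex_eq_iff)
    have "y\<^sup>2 * inverse (1 + y) = inverse (1 + y) - 1 + y" using nz by (simp add: field_simps power2_eq_square)
    then show "((\<lambda>z. Ln (1 + z) - z + z\<^sup>2 / 2) has_field_derivative y\<^sup>2 * inverse (1 + y)) (at y within cball 0 (norm z))"
      using 1 by (auto intro!: derivative_eq_intros)
    have "3/4 \<le> norm (1 + y)" using norm_triangle_ineq2[of 1 "- y"] y assms by simp
    then have "inverse (norm (1 + y)) \<le> inverse (3/4)" by (intro le_imp_inverse_le) auto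
    then have "norm y ^ 2 * inverse (norm (1 + y)) \<le> norm z ^ 2 * (4/3)"
      using y by (intro mult_mono power_mono) auto
    then show "norm (y\<^sup>2 * inverse (1 + y)) \<le> 4/3 * norm z ^ 2" by (simp add: norm_mult norm_power norm_inverse)
  qed auto
  then show ?thesis by (simp add: power3_eq_cube power2_eq_square)
qed

lemma Im_Ln_half_plane:
  assumes "Re z + Im z > 0"
  shows "- (pi / 4) < Im (Ln z)" "Im (Ln z) < 3 * pi / 4"
proof -
  have "Im (Ln z) = pi / 4 - arctan ((Re z - Im z) / (Re z + Im z))"
    by (subst rotated_form(2)[OF assms], subst Ln_rotated[OF rotated_form(1)[OF assms]]) simp
  then show "- (pi / 4) < Im (Ln z)" "Im (Ln z) < 3 * pi / 4"
    using arctan_bounded[of "(Re z - Im z) / (Re z + Im z)"] by linarith+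
qed

text \<open>The linear terms cancel at the saddle, while logarithm and square contribute -pi i w^2
  each. Ln (eta + w) - Ln eta = Ln (1 + w / eta) needs no branch correction because both points lie
  in one half-plane.\<close>

lemma phase_taylor:
  assumes \<eta>: "Re \<eta> + Im \<eta> > 0" "Re (\<eta> + w) + Im (\<eta> + w) > 0" and w: "norm w \<le> norm \<eta> / 4"
  obtains h where "phase \<eta> (\<eta> + w) - phase \<eta> \<eta> = - (2 * of_real pi * \<i> * w\<^sup>2) + h"
    "norm h \<le> 8 * pi / 3 * (norm w ^ 3 / norm \<eta>)"
proof -
  define z where "z = w / \<eta>"
  have "z \<noteq> 0" if "Re z + Im z > 0" for z using that by auto
  from this[OF \<eta>(1)] this[OF \<eta>(2)] have nz: "\<eta> \<noteq> 0" "\<eta> + w \<noteq> 0" .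
  have wz: "w = \<eta> * z" using nz by (simp add: z_def)
  have z: "norm z \<le> 1/4" using w nz by (simp add: z_def norm_divide field_simps)
  have L: "Ln (1 + z) = Ln (\<eta> + w) - Ln \<eta>"
  proof (rule Ln_unique)
    show "exp (Ln (\<eta> + w) - Ln \<eta>) = 1 + z" using nz by (simp add: exp_diff z_def field_simps)
    show "- pi < Im (Ln (\<eta> + w) - Ln \<eta>)" "Im (Ln (\<eta> + w) - Ln \<eta>) \<le> pi"
      using Im_Ln_half_plane[OF \<eta>(1)] Im_Ln_half_plane[OF \<eta>(2)] by auto
  qed
  define r where "r = Ln (1 + z) - z + z\<^sup>2 / 2"
  have "phase \<eta> (\<eta> + w) - phase \<eta> \<eta> = 2 * of_real pi * \<i> * \<eta>\<^sup>2 * Ln (1 + z) - of_real pi * \<i> * ((\<eta> + w)\<^sup>2 - \<eta>\<^sup>2)"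
    unfolding phase_def L by (simp add: algebra_simps)
  also have "Ln (1 + z) = r + z - z\<^sup>2 / 2" by (simp add: r_def)
  also have "2 * of_real pi * \<i> * \<eta>\<^sup>2 * (r + z - z\<^sup>2 / 2) - of_real pi * \<i> * ((\<eta> + w)\<^sup>2 - \<eta>\<^sup>2)
      = - (2 * of_real pi * \<i> * w\<^sup>2) + 2 * of_real pi * \<i> * \<eta>\<^sup>2 * r"
    unfolding wz by (simp add: power2_eq_square algebra_simps)
  finally have 1: "phase \<eta> (\<eta> + w) - phase \<eta> \<eta> = - (2 * of_real pi * \<i> * w\<^sup>2) + 2 * of_real pi * \<i> * \<eta>\<^sup>2 * r" .
  have "norm (2 * of_real pi * \<i> * \<eta>\<^sup>2 * r) = 2 * pi * norm \<eta> ^ 2 * norm r" by (simp add: norm_mult norm_power)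
  also have "\<dots> \<le> 2 * pi * norm \<eta> ^ 2 * (4/3 * norm z ^ 3)"
    unfolding r_def by (intro mult_left_mono Ln_taylor_bound z) auto
  also have "\<dots> = 8 * pi / 3 * (norm w ^ 3 / norm \<eta>)"
    using nz by (simp add: z_def norm_divide power_divide power2_eq_square power3_eq_cube)
  finally show ?thesis using that 1 by blast
qed

lemma cube_le_exp: "x \<ge> 0 \<Longrightarrow> x ^ 3 \<le> 27 * exp (x :: real)"
proof -
  assume x: "x \<ge> 0"
  have "x / 3 \<le> exp (x / 3)" using exp_ge_add_one_self[of "x / 3"] by linarith
  then have "(x / 3) ^ 3 \<le> exp (x / 3) ^ 3" using x by (intro power_mono) auto
  also have "\<dots> = exp x" by (simp flip: exp_of_nat_mult)
  finally show ?thesis by (simp add: power_divide)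
qed

lemma norm_exp_minus_1_le: "norm (exp z - 1) \<le> norm z * exp (norm (z :: complex))"
proof -
  have "norm (exp z - exp 0) \<le> exp (norm z) * norm (z - 0)"
  proof (rule field_differentiable_bound[where S = "cball 0 (norm z)"])
    fix y :: complex assume "y \<in> cball 0 (norm z)"
    then show "norm (exp y) \<le> exp (norm z)" using complex_Re_le_cmod[of y] by simp
  qed (auto intro!: derivative_eq_intros)
  then show ?thesis by (simp add: mult.commute)
qed

text \<open>Only the cross term 2 delta u \<open>se\<close> can raise the exponent; sqrt 2 <= 3/2,
  pi <= 4 and |delta| <= 1/2 give the rate 6.\<close>

lemma norm_gauss_offset_le:
  fixes \<delta> u :: real
  assumes "\<bar>\<delta>\<bar> \<le> 1/2"
  shows "norm (exp (- (2 * of_real pi * \<i> * (of_real \<delta> + of_real u * se)\<^sup>2))) \<le> exp (6 * \<bar>u\<bar> - 2 * pi * u\<^sup>2)"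
proof -
  have w2: "(of_real \<delta> + of_real u * se)\<^sup>2 = of_real (\<delta>\<^sup>2) + of_real (2 * \<delta> * u) * se - \<i> * of_real (u\<^sup>2)"
    by (simp add: power2_sum power_mult_distrib se_simps algebra_simps)
  have "Re (- (2 * of_real pi * \<i> * (of_real \<delta> + of_real u * se)\<^sup>2)) = - (2 * sqrt 2 * pi * (\<delta> * u)) - 2 * pi * u\<^sup>2"
    unfolding w2 by (simp add: se_simps algebra_simps)
  moreover have "- (2 * sqrt 2 * pi * (\<delta> * u)) \<le> 6 * \<bar>u\<bar>"
  proof -
    have s: "sqrt 2 \<le> 3/2" by (rule real_le_lsqrt) (auto simp: power2_eq_square)
    have p: "pi \<le> 4" using pi_less_4 by simp
    have "- (2 * sqrt 2 * pi * (\<delta> * u)) \<le> 2 * sqrt 2 * pi * (\<bar>\<delta>\<bar> * \<bar>u\<bar>)"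
    proof -
      have "- (\<delta> * u) \<le> \<bar>\<delta>\<bar> * \<bar>u\<bar>"
        using abs_ge_minus_self[of "\<delta> * u"] by (simp only: abs_mult)
      then have "2 * sqrt 2 * pi * (- (\<delta> * u)) \<le> 2 * sqrt 2 * pi * (\<bar>\<delta>\<bar> * \<bar>u\<bar>)"
        by (rule mult_left_mono) simp
      then show ?thesis by (simp only: mult_minus_right)
    qed
    also have "\<dots> \<le> 2 * (3/2) * 4 * (1/2 * \<bar>u\<bar>)"
      by (intro mult_mono s p assms order_refl) auto
    also have "2 * (3/2) * 4 * (1/2 * \<bar>u\<bar>) = 6 * \<bar>u\<bar>" by simp
    finally show ?thesis .
  qed
  ultimately show ?thesis by (simp only: norm_exp_eq_Re exp_le_cancel_iff)
qed

lemma phase_bound: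
  fixes \<eta> :: complex and s0 u \<delta> :: real
  assumes s0: "s0 > 0" and \<eta>: "\<eta> \<noteq> 0" "s0 * norm \<eta> \<le> (Re \<eta> + Im \<eta>) / sqrt 2"
    and \<delta>: "\<bar>\<delta>\<bar> \<le> 1/2" "(Re \<eta> + Im \<eta>) / 2 \<le> Re \<eta> + Im \<eta> + \<delta>"
  shows "norm (exp (phase \<eta> (\<eta> + of_real u * se + of_real \<delta>) - phase \<eta> \<eta>))
     \<le> exp (pi * (1 + 2 / s0) * (\<bar>u\<bar> + 1) - (2 * pi / (9 * (1 + (2 / s0 + 1)\<^sup>2))) * u\<^sup>2)"
proof -
  let ?x0 = "\<eta> + of_real u * se"
  have "Re (phase \<eta> (?x0 + of_real \<delta>) - phase \<eta> \<eta>)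
     = Re (phase \<eta> (?x0 + of_real \<delta>) - phase \<eta> ?x0) + Re (phase \<eta> ?x0 - phase \<eta> \<eta>)" by simp
  also have "\<dots> \<le> pi * (1 + 2 / s0) * (\<bar>u\<bar> + 1) + (- (2 * pi / (9 * (1 + (2 / s0 + 1)\<^sup>2))) * u\<^sup>2)"
    by (intro add_mono phase_descent[OF s0 \<eta>] order_trans[OF complex_Re_le_cmod] phase_offset[OF s0 \<eta> \<delta>])
  finally show ?thesis by simp
qed

text \<open>For |w| <= |eta| / 4 the remainder h is O(|w|^3 / |eta|) and also at most quadratic in
  u, so exp |h| is absorbed by the Gaussian. Farther out the two exponentials are bounded
  separately, and the factor 1 / |eta| comes from 1 <= 4 |w| / |eta|.\<close>

lemma saddle_pointwise:
  fixes \<eta> :: complex and s0 u \<delta> :: real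
  assumes s0: "s0 > 0" and \<eta>: "\<eta> \<noteq> 0" "s0 * norm \<eta> \<le> (Re \<eta> + Im \<eta>) / sqrt 2"
    and \<delta>: "\<bar>\<delta>\<bar> \<le> 1/2" "(Re \<eta> + Im \<eta>) / 2 \<le> Re \<eta> + Im \<eta> + \<delta>"
  defines "w \<equiv> of_real \<delta> + of_real u * se"
    and "\<kappa> \<equiv> 2 * pi / (9 * (1 + (2 / s0 + 1)\<^sup>2))" and "C1 \<equiv> pi * (1 + 2 / s0)"
  shows "norm (exp (phase \<eta> (\<eta> + w) - phase \<eta> \<eta>) - exp (- (2 * of_real pi * \<i> * w\<^sup>2)))
     \<le> 300 / norm \<eta> * exp (C1 + 3 + (C1 + 10) * \<bar>u\<bar> - \<kappa> * u\<^sup>2)"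
proof -
  have C1: "C1 \<ge> 0" using s0 by (simp add: C1_def)
  \<comment> \<open>4 pi/3 = 2 pi - 2 pi/3 is what remains of the Gaussian rate after the loss from
    exp |h|.\<close>
  have \<kappa>: "\<kappa> \<le> 4 * pi / 3"
  proof -
    have "2 * pi / (9 * (1 + (2 / s0 + 1)\<^sup>2)) \<le> 2 * pi / (9 * 1)"
      by (intro divide_left_mono mult_left_mono) (auto intro!: mult_pos_pos add_pos_nonneg)
    also have "\<dots> \<le> 4 * pi / 3" using pi_gt_zero by simp
    finally show ?thesis by (simp add: \<kappa>_def)
  qed
  have nw: "norm w \<le> \<bar>u\<bar> + 1/2"
    unfolding w_def using norm_triangle_ineq[of "of_real \<delta>" "of_real u * se"] \<delta> by (simp add: norm_mult se_simps)
  have n\<eta>: "norm \<eta> > 0" using \<eta> by simp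
  have g: "norm (exp (- (2 * of_real pi * \<i> * w\<^sup>2))) \<le> exp (6 * \<bar>u\<bar> - 2 * pi * u\<^sup>2)"
    unfolding w_def by (rule norm_gauss_offset_le[OF \<delta>(1)])
  show ?thesis
  proof (cases "norm w \<le> norm \<eta> / 4")
    case True
    have "0 < s0 * norm \<eta>" using s0 \<eta> by simp
    then have "0 < (Re \<eta> + Im \<eta>) / sqrt 2" using \<eta>(2) by (rule less_le_trans)
    then have pos: "Re \<eta> + Im \<eta> > 0" by (simp add: zero_less_divide_iff)
    have "Re (\<eta> + w) + Im (\<eta> + w) = Re \<eta> + Im \<eta> + \<delta>" by (simp add: w_def se_simps)
    moreover have "0 < Re \<eta> + Im \<eta> + \<delta>" using pos \<delta>(2) by (auto intro: less_le_trans)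
    ultimately have pos': "Re (\<eta> + w) + Im (\<eta> + w) > 0" by (simp only:)
    obtain h where h: "phase \<eta> (\<eta> + w) - phase \<eta> \<eta> = - (2 * of_real pi * \<i> * w\<^sup>2) + h"
      "norm h \<le> 8 * pi / 3 * (norm w ^ 3 / norm \<eta>)"
      using phase_taylor[OF pos pos' True] by blast
    have "norm w ^ 3 / norm \<eta> \<le> norm w ^ 2 * (1/4)"
    proof -
      have "norm w ^ 2 * norm w \<le> norm w ^ 2 * (norm \<eta> / 4)" using True by (intro mult_left_mono) auto
      then show ?thesis using n\<eta> by (simp add: field_simps power2_eq_square power3_eq_cube)
    qed
    then have "8 * pi / 3 * (norm w ^ 3 / norm \<eta>) \<le> 8 * pi / 3 * (norm w ^ 2 * (1/4))" by (intro mult_left_mono) auto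
    also have "\<dots> \<le> 8 * pi / 3 * ((\<bar>u\<bar> + 1/2)\<^sup>2 * (1/4))" using nw by (intro mult_left_mono mult_right_mono power_mono) auto
    also have "\<dots> = 2 * pi / 3 * u\<^sup>2 + 2 * pi / 3 * \<bar>u\<bar> + pi / 6"
      by (simp add: power2_sum field_simps)
    also have "\<dots> \<le> 2 * pi / 3 * u\<^sup>2 + 3 * \<bar>u\<bar> + 1"
      using pi_less_4 by (intro add_mono mult_right_mono) auto
    finally have h2: "norm h \<le> 2 * pi / 3 * u\<^sup>2 + 3 * \<bar>u\<bar> + 1" using h(2) by linarith
    \<comment> \<open>From pi < 4 one has 8 pi/3 <= 11, and 27 is the constant of
      \<open>cube_le_exp\<close>: 11 times 27 is 297.\<close>
    have h3: "norm h \<le> 300 / norm \<eta> * exp (\<bar>u\<bar> + 1/2)"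
    proof -
      have "norm w ^ 3 \<le> 27 * exp (norm w)" by (rule cube_le_exp) simp
      also have "\<dots> \<le> 27 * exp (\<bar>u\<bar> + 1/2)" using nw by simp
      finally have "8 * pi / 3 * (norm w ^ 3 / norm \<eta>) \<le> 11 * ((27 * exp (\<bar>u\<bar> + 1/2)) / norm \<eta>)"
        using n\<eta> pi_less_4 by (intro mult_mono divide_right_mono) auto
      also have "\<dots> = 297 / norm \<eta> * exp (\<bar>u\<bar> + 1/2)" by simp
      also have "\<dots> \<le> 300 / norm \<eta> * exp (\<bar>u\<bar> + 1/2)"
        using n\<eta> by (intro mult_right_mono divide_right_mono) auto
      finally show ?thesis using h(2) by linarith
    qed
    have "exp (phase \<eta> (\<eta> + w) - phase \<eta> \<eta>) - exp (- (2 * of_real pi * \<i> * w\<^sup>2))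
        = exp (- (2 * of_real pi * \<i> * w\<^sup>2)) * (exp h - 1)"
      unfolding h(1) exp_add by (simp add: algebra_simps)
    also have "norm \<dots> \<le> exp (6 * \<bar>u\<bar> - 2 * pi * u\<^sup>2) * ((300 / norm \<eta> * exp (\<bar>u\<bar> + 1/2)) * exp (2 * pi / 3 * u\<^sup>2 + 3 * \<bar>u\<bar> + 1))"
      unfolding norm_mult
      by (intro mult_mono g order_trans[OF norm_exp_minus_1_le] h3 exp_le_cancel_iff[THEN iffD2] h2) (use n\<eta> in auto)
    also have "\<dots> = 300 / norm \<eta> * exp ((6 * \<bar>u\<bar> - 2 * pi * u\<^sup>2) + (\<bar>u\<bar> + 1/2) + (2 * pi / 3 * u\<^sup>2 + 3 * \<bar>u\<bar> + 1))"
      by (simp only: exp_add mult_ac)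
    also have "\<dots> \<le> 300 / norm \<eta> * exp (C1 + 3 + (C1 + 10) * \<bar>u\<bar> - \<kappa> * u\<^sup>2)"
    proof (intro mult_left_mono exp_le_cancel_iff[THEN iffD2])
      have "\<kappa> * u\<^sup>2 \<le> 4 * pi / 3 * u\<^sup>2" using \<kappa> by (intro mult_right_mono) auto
      moreover have "4 * pi / 3 * u\<^sup>2 = 2 * pi * u\<^sup>2 - 2 * pi / 3 * u\<^sup>2" by (simp add: field_simps)
      moreover have "(C1 + 10) * \<bar>u\<bar> = C1 * \<bar>u\<bar> + 10 * \<bar>u\<bar>" by (simp add: algebra_simps)
      moreover have "0 \<le> C1 * \<bar>u\<bar>" using C1 by simp
      ultimately show "(6 * \<bar>u\<bar> - 2 * pi * u\<^sup>2) + (\<bar>u\<bar> + 1/2) + (2 * pi / 3 * u\<^sup>2 + 3 * \<bar>u\<bar> + 1)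
          \<le> C1 + 3 + (C1 + 10) * \<bar>u\<bar> - \<kappa> * u\<^sup>2"
        using C1 abs_ge_zero[of u] by linarith
    qed simp
    finally show ?thesis .
  next
    case False
    have "exp (\<bar>u\<bar> + 1/2) \<ge> norm w" using nw exp_ge_add_one_self[of "\<bar>u\<bar> + 1/2"] by linarith
    moreover have "1 \<le> 4 * norm w / norm \<eta>" using False n\<eta> by (simp add: field_simps)
    moreover have "4 * norm w / norm \<eta> \<le> 4 * exp (\<bar>u\<bar> + 1/2) / norm \<eta>"
      using calculation(1) n\<eta> by (intro divide_right_mono) auto
    ultimately have one: "1 \<le> 4 * exp (\<bar>u\<bar> + 1/2) / norm \<eta>" by linarith
    have b1: "norm (exp (phase \<eta> (\<eta> + w) - phase \<eta> \<eta>)) \<le> exp (C1 * (\<bar>u\<bar> + 1) - \<kappa> * u\<^sup>2)"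
      using phase_bound[OF s0 \<eta> \<delta>, of u] by (simp add: w_def \<kappa>_def C1_def add_ac)
    have "norm (exp (phase \<eta> (\<eta> + w) - phase \<eta> \<eta>) - exp (- (2 * of_real pi * \<i> * w\<^sup>2)))
       \<le> exp (C1 * (\<bar>u\<bar> + 1) - \<kappa> * u\<^sup>2) + exp (6 * \<bar>u\<bar> - 2 * pi * u\<^sup>2)"
      by (rule order_trans[OF norm_triangle_ineq4 add_mono[OF b1 g]])
    also have "\<dots> \<le> exp (C1 + (C1 + 6) * \<bar>u\<bar> - \<kappa> * u\<^sup>2) + exp (C1 + (C1 + 6) * \<bar>u\<bar> - \<kappa> * u\<^sup>2)"
    proof (intro add_mono exp_le_cancel_iff[THEN iffD2])
      have "\<kappa> \<le> 2 * pi" using \<kappa> pi_gt_zero by linarith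
      then have "\<kappa> * u\<^sup>2 \<le> 2 * pi * u\<^sup>2" by (intro mult_right_mono) auto
      moreover have "0 \<le> C1 * \<bar>u\<bar>" using C1 by simp
      moreover have "(C1 + 6) * \<bar>u\<bar> = C1 * \<bar>u\<bar> + 6 * \<bar>u\<bar>" by (simp add: algebra_simps)
      ultimately show "6 * \<bar>u\<bar> - 2 * pi * u\<^sup>2 \<le> C1 + (C1 + 6) * \<bar>u\<bar> - \<kappa> * u\<^sup>2"
        using C1 by linarith
    qed (simp add: algebra_simps)
    also have "\<dots> = 2 * exp (C1 + (C1 + 6) * \<bar>u\<bar> - \<kappa> * u\<^sup>2) * 1" by simp
    also have "\<dots> \<le> 2 * exp (C1 + (C1 + 6) * \<bar>u\<bar> - \<kappa> * u\<^sup>2) * (4 * exp (\<bar>u\<bar> + 1/2) / norm \<eta>)"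
      by (intro mult_left_mono one) auto
    also have "\<dots> = 8 / norm \<eta> * exp (C1 + (C1 + 6) * \<bar>u\<bar> - \<kappa> * u\<^sup>2 + (\<bar>u\<bar> + 1/2))"
      unfolding exp_add by simp
    also have "\<dots> \<le> 300 / norm \<eta> * exp (C1 + 3 + (C1 + 10) * \<bar>u\<bar> - \<kappa> * u\<^sup>2)"
      by (intro mult_mono divide_right_mono exp_le_cancel_iff[THEN iffD2]) (auto simp: algebra_simps)
    finally show ?thesis .
  qed
qed

section \<open>The integral along the line through m + 1/2\<close>

lemma sin_den_add_nat: "sin_den (x + of_nat m) = (-1) ^ m * sin_den x"
proof (induction m)
  case (Suc m)
  have "x + of_nat (Suc m) = (x + of_nat m) + 1" by simp
  then show ?case using Suc by (simp only: sin_den_add_1) simp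
qed simp

text \<open>Away from the real axis the sinh bound gives the full exponential. Near the axis it
  degenerates, but there the sine is, up to sign, a cosine of small argument, because the line
  crosses the axis midway between two integers.\<close>

lemma norm_sin_den_half_line_ge:
  fixes m :: nat and t :: real
  defines "x \<equiv> of_real (real m + 1/2) + of_real t * se"
  shows "exp (pi * \<bar>Im x\<bar>) / 2 \<le> norm (sin_den x)"
proof -
  define \<beta> where "\<beta> = pi * \<bar>Im x\<bar>"
  have \<beta>: "\<beta> \<ge> 0" by (simp add: \<beta>_def)
  show ?thesis
  proof (cases "\<beta> \<ge> 1/2")
    case True
    have "exp 1 \<le> exp (2 * \<beta>)" using True by simp
    moreover have "2 \<le> exp (1 :: real)" using exp_ge_add_one_self[of "1 :: real"] by simp
    ultimately have "2 \<le> exp (2 * \<beta>)" by (simp del: exp_le_cancel_iff)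
    then have "exp (- \<beta>) * 2 \<le> exp (- \<beta>) * exp (2 * \<beta>)" by (intro mult_left_mono) auto
    also have "\<dots> = exp \<beta>" by (simp flip: exp_add)
    finally have "exp \<beta> / 2 \<le> 2 * sinh \<beta>" by (simp add: sinh_def)
    also have "\<dots> = 2 * \<bar>sinh (pi * Im x)\<bar>"
      by (cases "Im x \<ge> 0") (auto simp: \<beta>_def abs_if mult_less_0_iff)
    also have "\<dots> \<le> norm (sin_den x)" by (rule norm_sin_den_ge_sinh)
    finally show ?thesis by (simp add: \<beta>_def)
  next
    case False
    define y where "y = of_real t * se"
    have Rey: "Re y = - Im y" by (simp add: y_def se_simps)
    have Imx: "Im x = Im y" by (simp add: x_def y_def)
    have "x = (y + 1/2) + of_nat m" by (simp add: x_def y_def)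
    then have "norm (sin_den x) = norm (sin_den (y + 1/2))" by (simp add: sin_den_add_nat norm_mult norm_power)
    also have "\<dots> = 2 * norm (cos (of_real pi * y))"
      by (simp add: sin_den_eq norm_mult ring_distribs sin_add)
    finally have 2: "2 * \<bar>Re (cos (of_real pi * y))\<bar> \<le> norm (sin_den x)" using abs_Re_le_cmod[of "cos (of_real pi * y)"] by simp
    have "Re (cos (of_real pi * y)) = cos (pi * Re y) * cosh (pi * Im y)"
      by (simp add: Re_cos cosh_def)
    also have "cos (pi * Re y) = cos \<beta>"
      using cos_abs_real[of "pi * Re y"] by (simp add: Rey Imx \<beta>_def abs_mult)
    finally have *: "2 * \<bar>cos \<beta> * cosh (pi * Im y)\<bar> \<le> norm (sin_den x)" using 2 by (simp only:)
    have "cos (pi / 3) \<le> cos \<beta>"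
      using False \<beta> pi_gt3 by (intro cos_monotone_0_pi_le) auto
    then have "1/2 \<le> cos \<beta>" by (simp add: cos_60)
    then have "1/2 * 1 \<le> cos \<beta> * cosh (pi * Im y)" by (intro mult_mono cosh_real_ge_1) auto
    then have 1: "1 \<le> norm (sin_den x)" using * by simp
    have "exp \<beta> \<le> exp (1/2)" using False by simp
    moreover have "exp (1/2 :: real) \<le> 2"
    proof (rule power2_le_imp_le)
      have "(exp (1/2 :: real))\<^sup>2 = exp 1" by (simp flip: exp_double)
      also have "\<dots> \<le> 2\<^sup>2" using exp_le by simp
      finally show "(exp (1/2 :: real))\<^sup>2 \<le> 2\<^sup>2" .
    qed simp
    ultimately have "exp \<beta> / 2 \<le> norm (sin_den x)" using 1 by linarith
    then show ?thesis by (simp only: \<beta>_def)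
  qed
qed

lemma line_integral_translate:
  "line_integral d c f = (\<integral>t. f (of_real c + of_real (t + r) * d) * d \<partial>lborel)"
  using lborel_integral_real_affine[of 1 "\<lambda>t. f (of_real c + of_real t * d) * d" r]
  by (simp add: line_integral_def add.commute)

lemma line_integral_translate_line:
  "line_integral d (c + a) f = line_integral d c (\<lambda>x. f (x + of_real a))"
  by (simp add: line_integral_def add_ac)

lemma exp_quadratic_integrable:
  fixes K L \<kappa> :: real
  assumes "\<kappa> > 0"
  shows "integrable lborel (\<lambda>t. exp (L + K * \<bar>t\<bar> - \<kappa> * t\<^sup>2))"
proof -
  have "integrable lborel (\<lambda>t. complex_of_real (exp (L + K * \<bar>t\<bar> - \<kappa> * t\<^sup>2)))"
    by (rule inverse_square_decay_integrable[where T = 1 and A = "exp (L + (K + 2)\<^sup>2 / (4 * \<kappa>))"])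
       (use assms exp_quadratic_le_inverse_square[OF assms] in \<open>auto intro!: continuous_intros\<close>)
  from integrable_norm[OF this] show ?thesis by simp
qed

lemma exp_quadratic_majorant:
  fixes f :: "real \<Rightarrow> complex" and K L \<kappa> :: real
  assumes "\<kappa> > 0" "continuous_on UNIV f" "\<And>t. norm (f t) \<le> exp (L + K * \<bar>t\<bar> - \<kappa> * t\<^sup>2)"
  shows "integrable lborel f"
proof (rule Bochner_Integration.integrable_bound[OF exp_quadratic_integrable[OF assms(1), of L K]])
  show "f \<in> borel_measurable lborel" using borel_measurable_continuous_onI[OF assms(2)] by simp
qed (use assms(3) in auto)

text \<open>The pointwise estimate is integrated against 1 / \<open>sin_den\<close>, which
  contributes at most 2 exp (-pi |Im eta|) exp (pi |u|); the factor exp (pi |u|) disappears in the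
  Gaussian majorant.\<close>

lemma saddle_estimate:
  fixes s0 :: real
  assumes s0: "s0 > 0"
  shows "\<exists>C. \<forall>\<eta> m. \<eta> \<noteq> 0 \<longrightarrow> s0 * norm \<eta> \<le> (Re \<eta> + Im \<eta>) / sqrt 2 \<longrightarrow>
      real m \<le> Re \<eta> + Im \<eta> \<longrightarrow> Re \<eta> + Im \<eta> < real m + 1 \<longrightarrow>
      norm (line_integral se (real m + 1/2) (\<lambda>x. exp (phase \<eta> x - phase \<eta> \<eta>) / sin_den x)
          - (-1) ^ m * saddle_gauss (\<eta> - of_nat m))
        \<le> C / norm \<eta> * exp (- (pi * \<bar>Im \<eta>\<bar>))"
proof -
  define \<kappa> where "\<kappa> = 2 * pi / (9 * (1 + (2 / s0 + 1)\<^sup>2))"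
  define C1 where "C1 = pi * (1 + 2 / s0)"
  have \<kappa>: "\<kappa> > 0" unfolding \<kappa>_def by (intro divide_pos_pos mult_pos_pos add_pos_nonneg) auto
  define I where "I = (\<integral>t. exp (C1 + 3 + (C1 + 10 + pi) * \<bar>t\<bar> - \<kappa> * t\<^sup>2) \<partial>lborel)"
  show ?thesis
  proof (intro exI[of _ "600 * I"] allI impI)
    fix \<eta> :: complex and m :: nat
    assume \<eta>: "\<eta> \<noteq> 0" "s0 * norm \<eta> \<le> (Re \<eta> + Im \<eta>) / sqrt 2"
      and m: "real m \<le> Re \<eta> + Im \<eta>" "Re \<eta> + Im \<eta> < real m + 1"
    \<comment> \<open>The horizontal displacement from eta to the line through m + 1/2.\<close>
    define \<delta> where "\<delta> = real m + 1/2 - (Re \<eta> + Im \<eta>)"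
    have \<delta>1: "\<bar>\<delta>\<bar> \<le> 1/2" using m by (intro abs_leI) (simp_all add: \<delta>_def field_simps)
    \<comment> \<open>Amounts to m + 1/2 >= (Re eta + Im eta) / 2. The case m = 0 is the tight one:
      the line can be almost twice as close to Re + Im = 0 as eta.\<close>
    have \<delta>2: "(Re \<eta> + Im \<eta>) / 2 \<le> Re \<eta> + Im \<eta> + \<delta>" using m by (simp add: \<delta>_def)
    define w where "w = (\<lambda>u::real. of_real \<delta> + of_real u * se)"
    let ?c = "real m + 1/2"
    \<comment> \<open>The parameter is shifted so that u = 0 is the point eta + delta.\<close>
    have x: "of_real ?c + of_real (u + - (sqrt 2 * Im \<eta>)) * se = \<eta> + w u" for u
      by (simp add: complex_eq_iff w_def \<delta>_def se_simps field_simps)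
    have Imx: "\<bar>Im \<eta>\<bar> - \<bar>u\<bar> \<le> \<bar>Im (\<eta> + w u)\<bar>" for u
    proof -
      have "sqrt 2 / 2 \<le> 1" using real_sqrt_le_mono[of 2 4] by simp
      then have "\<bar>u * (sqrt 2 / 2)\<bar> \<le> \<bar>u\<bar>"
        using mult_left_mono[of "sqrt 2 / 2" 1 "\<bar>u\<bar>"] by (simp add: abs_mult)
      moreover have "Im (\<eta> + w u) = Im \<eta> - u * (sqrt 2 / 2)" by (simp add: w_def se_simps)
      ultimately show ?thesis by linarith
    qed
    have den: "inverse (norm (sin_den (\<eta> + w u))) \<le> 2 * exp (- (pi * \<bar>Im (\<eta> + w u)\<bar>))" for u
    proof -
      have "exp (pi * \<bar>Im (\<eta> + w u)\<bar>) / 2 \<le> norm (sin_den (\<eta> + w u))"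
        using norm_sin_den_half_line_ge[of m "u + - (sqrt 2 * Im \<eta>)"] unfolding x .
      then have "inverse (norm (sin_den (\<eta> + w u))) \<le> inverse (exp (pi * \<bar>Im (\<eta> + w u)\<bar>) / 2)"
        by (intro le_imp_inverse_le) auto
      also have "inverse (exp y / 2) = 2 * exp (- y)" for y :: real
        unfolding exp_minus inverse_divide by (rule divide_inverse)
      finally show ?thesis .
    qed
    have den2: "inverse (norm (sin_den (\<eta> + w u))) \<le> 2" for u
      by (rule order_trans[OF den]) simp
    have nz: "sin_den (\<eta> + w u) \<noteq> 0" for u
    proof
      assume "sin_den (\<eta> + w u) = 0"
      moreover have "exp (pi * \<bar>Im (\<eta> + w u)\<bar>) / 2 \<le> norm (sin_den (\<eta> + w u))"
        using norm_sin_den_half_line_ge[of m "u + - (sqrt 2 * Im \<eta>)"] unfolding x .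
      ultimately show False by (simp add: not_le)
    qed
    have posx: "\<eta> + w u \<notin> \<real>\<^sub>\<le>\<^sub>0" for u
    proof -
      have "Re (\<eta> + w u) + Im (\<eta> + w u) = real m + 1/2" by (simp add: w_def \<delta>_def se_simps)
      then show ?thesis using of_nat_0_le_iff[of m, where 'a = real] by (auto simp: complex_nonpos_Reals_iff)
    qed
    let ?P = "\<lambda>u. exp (phase \<eta> (\<eta> + w u) - phase \<eta> \<eta>) / sin_den (\<eta> + w u) * se"
    let ?Q = "\<lambda>u. exp (- (2 * of_real pi * \<i> * (w u)\<^sup>2)) / sin_den (\<eta> + w u) * se"
    have cw: "continuous_on UNIV w" unfolding w_def by (intro continuous_intros)
    have intP: "integrable lborel ?P"
    proof (rule exp_quadratic_majorant[OF \<kappa>])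
      show "continuous_on UNIV ?P"
        unfolding phase_def using nz posx by (intro continuous_intros cw) auto
      fix u
      have "norm (?P u) = norm (exp (phase \<eta> (\<eta> + of_real u * se + of_real \<delta>) - phase \<eta> \<eta>)) * inverse (norm (sin_den (\<eta> + w u)))"
        by (simp add: norm_mult norm_divide se_simps divide_inverse norm_inverse w_def add_ac)
      also have "\<dots> \<le> exp (C1 * (\<bar>u\<bar> + 1) - \<kappa> * u\<^sup>2) * 2"
        unfolding \<kappa>_def C1_def by (intro mult_mono phase_bound[OF s0 \<eta> \<delta>1 \<delta>2] den2) auto
      also have "\<dots> \<le> exp (C1 * (\<bar>u\<bar> + 1) - \<kappa> * u\<^sup>2) * exp 1"
        using exp_ge_add_one_self[of "1::real"] by (intro mult_left_mono) auto
      also have "\<dots> = exp (C1 + 1 + C1 * \<bar>u\<bar> - \<kappa> * u\<^sup>2)" by (simp add: algebra_simps flip: exp_add)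
      finally show "norm (?P u) \<le> exp (C1 + 1 + C1 * \<bar>u\<bar> - \<kappa> * u\<^sup>2)" .
    qed
    have intQ: "integrable lborel ?Q"
    proof (rule exp_quadratic_majorant)
      show "continuous_on UNIV ?Q" using nz by (intro continuous_intros cw) auto
      fix u
      have "norm (?Q u) = norm (exp (- (2 * of_real pi * \<i> * (w u)\<^sup>2))) * inverse (norm (sin_den (\<eta> + w u)))"
        by (simp only: norm_mult norm_divide se_simps divide_inverse mult_1_right norm_inverse)
      also have "\<dots> \<le> exp (6 * \<bar>u\<bar> - 2 * pi * u\<^sup>2) * 2"
        unfolding w_def by (intro mult_mono norm_gauss_offset_le \<delta>1 den2[unfolded w_def]) auto
      also have "\<dots> \<le> exp (6 * \<bar>u\<bar> - 2 * pi * u\<^sup>2) * exp 1"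
        using exp_ge_add_one_self[of "1::real"] by (intro mult_left_mono) auto
      also have "\<dots> = exp (1 + 6 * \<bar>u\<bar> - 2 * pi * u\<^sup>2)" by (simp add: algebra_simps flip: exp_add)
      finally show "norm (?Q u) \<le> exp (1 + 6 * \<bar>u\<bar> - 2 * pi * u\<^sup>2)" .
    qed simp
    have P: "line_integral se ?c (\<lambda>x. exp (phase \<eta> x - phase \<eta> \<eta>) / sin_den x) = (\<integral>u. ?P u \<partial>lborel)"
      unfolding line_integral_translate[of se ?c _ "- (sqrt 2 * Im \<eta>)"] x ..
    have Q: "(-1) ^ m * saddle_gauss (\<eta> - of_nat m) = (\<integral>u. ?Q u \<partial>lborel)"
    proof -
      have "(\<integral>u. ?Q u \<partial>lborel) = (\<integral>u. exp (- (2 * of_real pi * \<i> * ((\<eta> + w u) - \<eta>)\<^sup>2)) / sin_den (\<eta> + w u) * se \<partial>lborel)"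
        by simp
      also have "\<dots> = line_integral se ?c (\<lambda>x. exp (- (2 * of_real pi * \<i> * (x - \<eta>)\<^sup>2)) / sin_den x)"
        unfolding line_integral_translate[of se ?c _ "- (sqrt 2 * Im \<eta>)"] x ..
      \<comment> \<open>Translation by m brings the line back to 1/2, and \<open>sin_den\<close>
        contributes the sign (-1)^m.\<close>
      also have "?c = 1/2 + real m" by simp
      also have "line_integral se (1/2 + real m) (\<lambda>x. exp (- (2 * of_real pi * \<i> * (x - \<eta>)\<^sup>2)) / sin_den x)
        = line_integral se (1/2) (\<lambda>x. (-1) ^ m * (exp (- (2 * of_real pi * \<i> * (x - (\<eta> - of_nat m))\<^sup>2)) / sin_den x))"
      proof -
        have "x + of_nat m - \<eta> = x - (\<eta> - of_nat m)" for x by simp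
        moreover have "X / ((-1) ^ m * Y) = (-1) ^ m * (X / Y)" for X Y :: complex
          by (cases "even m") auto
        ultimately show ?thesis
          unfolding line_integral_translate_line of_real_of_nat_eq by (simp only: sin_den_add_nat)
      qed
      also have "\<dots> = (-1) ^ m * saddle_gauss (\<eta> - of_nat m)"
        unfolding line_integral_def saddle_gauss_def by (simp only: mult.assoc integral_mult_right_zero)
      finally show ?thesis by simp
    qed
    have "norm (line_integral se ?c (\<lambda>x. exp (phase \<eta> x - phase \<eta> \<eta>) / sin_den x) - (-1) ^ m * saddle_gauss (\<eta> - of_nat m))
       = norm (\<integral>u. ?P u - ?Q u \<partial>lborel)"
      unfolding P Q using intP intQ by (simp only: Bochner_Integration.integral_diff)
    also have "\<dots> \<le> (\<integral>u. 600 / norm \<eta> * exp (- (pi * \<bar>Im \<eta>\<bar>)) * exp (C1 + 3 + (C1 + 10 + pi) * \<bar>u\<bar> - \<kappa> * u\<^sup>2) \<partial>lborel)"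
    proof (rule Bochner_Integration.integral_norm_bound_integral)
      show "integrable lborel (\<lambda>u. ?P u - ?Q u)" using intP intQ by (rule Bochner_Integration.integrable_diff)
      show "integrable lborel (\<lambda>u. 600 / norm \<eta> * exp (- (pi * \<bar>Im \<eta>\<bar>)) * exp (C1 + 3 + (C1 + 10 + pi) * \<bar>u\<bar> - \<kappa> * u\<^sup>2))"
        by (intro integrable_mult_right exp_quadratic_integrable \<kappa>)
      fix u
      have "?P u - ?Q u = (exp (phase \<eta> (\<eta> + w u) - phase \<eta> \<eta>) - exp (- (2 * of_real pi * \<i> * (w u)\<^sup>2))) * inverse (sin_den (\<eta> + w u)) * se"
        by (simp only: divide_inverse left_diff_distrib)
      also have "norm \<dots> = norm (exp (phase \<eta> (\<eta> + w u) - phase \<eta> \<eta>) - exp (- (2 * of_real pi * \<i> * (w u)\<^sup>2))) * inverse (norm (sin_den (\<eta> + w u)))"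
        by (simp only: norm_mult se_simps norm_inverse mult_1_right)
      also have "\<dots> \<le> (300 / norm \<eta> * exp (C1 + 3 + (C1 + 10) * \<bar>u\<bar> - \<kappa> * u\<^sup>2)) * (2 * exp (- (pi * \<bar>Im (\<eta> + w u)\<bar>)))"
        unfolding w_def \<kappa>_def C1_def
        by (intro mult_mono saddle_pointwise[OF s0 \<eta> \<delta>1 \<delta>2] den[unfolded w_def]) auto
      also have "\<dots> \<le> (300 / norm \<eta> * exp (C1 + 3 + (C1 + 10) * \<bar>u\<bar> - \<kappa> * u\<^sup>2)) * (2 * (exp (- (pi * \<bar>Im \<eta>\<bar>)) * exp (pi * \<bar>u\<bar>)))"
      proof (intro mult_left_mono)
        have "pi * (\<bar>Im \<eta>\<bar> - \<bar>u\<bar>) \<le> pi * \<bar>Im (\<eta> + w u)\<bar>" by (intro mult_left_mono Imx) auto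
        then show "exp (- (pi * \<bar>Im (\<eta> + w u)\<bar>)) \<le> exp (- (pi * \<bar>Im \<eta>\<bar>)) * exp (pi * \<bar>u\<bar>)"
          unfolding exp_add[symmetric] exp_le_cancel_iff by (simp only: right_diff_distrib)
      qed auto
      also have "\<dots> = 600 / norm \<eta> * exp (- (pi * \<bar>Im \<eta>\<bar>)) * (exp (C1 + 3 + (C1 + 10) * \<bar>u\<bar> - \<kappa> * u\<^sup>2) * exp (pi * \<bar>u\<bar>))"
        by simp
      also have "exp (C1 + 3 + (C1 + 10) * \<bar>u\<bar> - \<kappa> * u\<^sup>2) * exp (pi * \<bar>u\<bar>) = exp (C1 + 3 + (C1 + 10 + pi) * \<bar>u\<bar> - \<kappa> * u\<^sup>2)"
        by (simp add: algebra_simps flip: exp_add)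
      finally show "norm (?P u - ?Q u) \<le> 600 / norm \<eta> * exp (- (pi * \<bar>Im \<eta>\<bar>)) * exp (C1 + 3 + (C1 + 10 + pi) * \<bar>u\<bar> - \<kappa> * u\<^sup>2)" .
    qed
    also have "\<dots> = 600 * I / norm \<eta> * exp (- (pi * \<bar>Im \<eta>\<bar>))"
      unfolding I_def by (simp only: integral_mult_right_zero) simp
    finally show "norm (line_integral se ?c (\<lambda>x. exp (phase \<eta> x - phase \<eta> \<eta>) / sin_den x) - (-1) ^ m * saddle_gauss (\<eta> - of_nat m))
        \<le> 600 * I / norm \<eta> * exp (- (pi * \<bar>Im \<eta>\<bar>))" .
  qed
qed

section \<open>The conjugate auxiliary function\<close>

definition riemann_kernel :: "complex \<Rightarrow> complex \<Rightarrow> complex" where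
  "riemann_kernel s x = exp (- s * Ln x) * exp (- (of_real pi * \<i> * x\<^sup>2)) / sin_den x"

definition riemann_aux_bar :: "real \<Rightarrow> complex \<Rightarrow> complex" where
  "riemann_aux_bar c s = line_integral se c (riemann_kernel s)"

lemma line_not_nonpos:
  assumes "c > 0"
  shows "of_real c + of_real t * se \<notin> \<real>\<^sub>\<le>\<^sub>0"
proof
  assume *: "of_real c + of_real t * se \<in> \<real>\<^sub>\<le>\<^sub>0"
  then have "t * sqrt 2 = 0" by (simp add: complex_nonpos_Reals_iff se_simps)
  then show False using * assms by (simp add: complex_nonpos_Reals_iff)
qed

text \<open>A linear bound is enough, since the Gaussian absorbs it. The 5 consists of 1 for the
  logarithm of the modulus and 4 > pi for the argument.\<close>

lemma norm_Ln_le: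
  assumes "norm x \<ge> 1/2"
  shows "norm (Ln x) \<le> norm x + 5"
proof -
  have nz: "x \<noteq> 0" using assms by auto
  have "norm (Ln x) \<le> \<bar>Re (Ln x)\<bar> + \<bar>Im (Ln x)\<bar>" by (rule cmod_le)
  also have "\<bar>Re (Ln x)\<bar> \<le> norm x + 1"
  proof -
    have "ln (norm x) \<le> norm x" using nz ln_le_minus_one[of "norm x"] by simp
    moreover have "- ln (norm x) \<le> 1"
    proof -
      have "- ln (norm x) = ln (inverse (norm x))" using nz by (simp add: ln_inverse)
      also have "\<dots> \<le> inverse (norm x) - 1" using nz by (intro ln_le_minus_one) auto
      also have "inverse (norm x) \<le> inverse (1/2)" using assms by (intro le_imp_inverse_le) auto
      finally show ?thesis by simp
    qed
    moreover have "Re (Ln x) = ln (norm x)" using nz by simp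
    ultimately show ?thesis using norm_ge_zero[of x] by linarith
  qed
  also have "\<bar>Im (Ln x)\<bar> \<le> 4"
    using mpi_less_Im_Ln[OF nz] Im_Ln_le_pi[OF nz] pi_less_4 by (simp add: abs_le_iff)
  finally show ?thesis by simp
qed

text \<open>Stated with a bound \<open>S\<close> for |s|, so that the majorant is locally uniform in
  s.\<close>

lemma riemann_kernel_bound:
  assumes "\<bar>c\<bar> \<le> B" "1 \<le> \<bar>t\<bar>" "norm s \<le> S"
  shows "norm (riemann_kernel s (of_real c + of_real t * se)) \<le> exp (S * (B + 5) + (S + 2 * pi * B) * \<bar>t\<bar> - pi * t\<^sup>2)"
proof -
  let ?x = "of_real c + of_real t * se"
  have S: "S \<ge> 0" using assms norm_ge_zero[of s] by linarith
  have "norm ?x \<ge> 1/2" using Im_line_ge[OF assms(2), of c] abs_Im_le_cmod[of ?x] by linarith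
  then have "norm (Ln ?x) \<le> norm ?x + 5" by (rule norm_Ln_le)
  also have "\<dots> \<le> B + \<bar>t\<bar> + 5" using norm_line_le[of c t] assms by linarith
  finally have "norm (- s * Ln ?x) \<le> S * (B + \<bar>t\<bar> + 5)"
    using assms S by (simp add: norm_mult mult_mono)
  then have 1: "norm (exp (- s * Ln ?x)) \<le> exp (S * (B + \<bar>t\<bar> + 5))"
    using complex_Re_le_cmod[of "- s * Ln ?x"] by simp
  have 2: "norm (exp (- (of_real pi * \<i> * ?x\<^sup>2))) \<le> exp (2 * pi * B * \<bar>t\<bar> - pi * t\<^sup>2)"
    using norm_gauss_line_le[of 1 c B t 0] assms by simp
  have "norm (riemann_kernel s ?x) \<le> norm (exp (- s * Ln ?x) * exp (- (of_real pi * \<i> * ?x\<^sup>2))) / 1"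
    unfolding riemann_kernel_def norm_divide
    by (intro divide_left_mono norm_sin_den_line_ge assms) (use norm_sin_den_line_ge[OF assms(2), of c] in auto)
  also have "\<dots> \<le> exp (S * (B + \<bar>t\<bar> + 5)) * exp (2 * pi * B * \<bar>t\<bar> - pi * t\<^sup>2)"
    unfolding norm_mult div_by_1 by (intro mult_mono 1 2) auto
  also have "\<dots> = exp (S * (B + 5) + (S + 2 * pi * B) * \<bar>t\<bar> - pi * t\<^sup>2)"
    by (simp add: algebra_simps flip: exp_add)
  finally show ?thesis .
qed

lemma riemann_kernel_decay:
  assumes "\<bar>c\<bar> \<le> B" "1 \<le> \<bar>t\<bar>" "norm s \<le> S"
  shows "norm (riemann_kernel s (of_real c + of_real t * se)) \<le> exp (S * (B + 5) + (S + 2 * pi * B + 2)\<^sup>2 / (4 * pi)) / t\<^sup>2"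
  by (rule order_trans[OF riemann_kernel_bound[OF assms] exp_quadratic_le_inverse_square]) (use assms in auto)

lemma continuous_riemann_kernel:
  assumes "c > 0" "c \<notin> \<int>"
  shows "continuous_on UNIV (\<lambda>t. riemann_kernel s (of_real c + of_real t * se))"
  unfolding riemann_kernel_def
  by (intro continuous_intros) (use line_not_nonpos[OF assms(1)] not_Ints_line[OF assms(2)] in \<open>auto simp: sin_den_eq_0_iff\<close>)

lemma sin_den_nonzero_strip_nat:
  assumes "z \<in> strip (real n - 1) (real n + 1)" "z \<noteq> of_nat n"
  shows "sin_den z \<noteq> 0"
proof
  assume "sin_den z = 0"
  then obtain k where k: "z = of_int k" by (auto simp: sin_den_eq_0_iff elim: Ints_cases)
  then have "real n - 1 < real_of_int k" "real_of_int k < real n + 1" using assms by (auto simp: strip_def)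
  then have "k = int n" by linarith
  then show False using k assms by simp
qed

lemma holomorphic_riemann_kernel:
  assumes "A \<subseteq> {z. 0 < Re z + Im z}" "\<And>z. z \<in> A \<Longrightarrow> sin_den z \<noteq> 0"
  shows "riemann_kernel s holomorphic_on A"
  unfolding riemann_kernel_def[abs_def]
  by (intro holomorphic_intros) (use assms in \<open>auto simp: complex_nonpos_Reals_iff\<close>)

lemma riemann_aux_bar_eq_half:
  assumes "0 < c" "c < 1"
  shows "riemann_aux_bar c s = riemann_aux_bar (1/2) s"
proof -
  have *: "line_integral se c1 (riemann_kernel s) = line_integral se c2 (riemann_kernel s)"
    if "0 < c1" "c1 \<le> c2" "c2 < 1" for c1 c2
  proof (rule line_integral_shift[where U = "strip 0 1" and T = 1])
    show "riemann_kernel s holomorphic_on strip 0 1"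
    proof (rule holomorphic_riemann_kernel)
      fix z assume "z \<in> strip 0 1"
      moreover from this have "z \<noteq> 0" by (auto simp: strip_def)
      ultimately show "sin_den z \<noteq> 0" using sin_den_nonzero_strip_nat[of z 0] by (auto simp: strip_def)
    qed (auto simp: strip_def)
    show "norm (riemann_kernel s (of_real c + of_real t * se)) \<le> exp (norm s * (1 + 5) + (norm s + 2 * pi * 1 + 2)\<^sup>2 / (4 * pi)) / t\<^sup>2"
      if "c \<in> {c1..c2}" "1 \<le> \<bar>t\<bar>" for c t
      using that \<open>0 < c1\<close> \<open>c2 < 1\<close> by (intro riemann_kernel_decay) auto
  qed (use that in \<open>auto simp: open_convex_strip\<close>)
  show ?thesis
    unfolding riemann_aux_bar_def using *[of c "1/2"] *[of "1/2" c] assms by (cases "c \<le> 1/2") auto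
qed

text \<open>At an integer N the sign exp (-pi i N^2) = (-1)^N cancels the sign in the residue of 1 /
  \<open>sin_den\<close>, so that crossing N contributes exactly N^(-s).\<close>

lemma riemann_aux_bar_cross:
  "line_integral se (real n + 1/2) (riemann_kernel s) - line_integral se (real (Suc n) + 1/2) (riemann_kernel s)
     = exp (- s * Ln (of_nat (Suc n)))"
proof -
  let ?N = "Suc n"
  have "line_integral se (real n + 1/2) (riemann_kernel s) - line_integral se (real (Suc n) + 1/2) (riemann_kernel s)
     = 2 * pi * \<i> * (exp (- s * Ln (of_nat ?N)) / (2 * of_real pi * \<i>))"
  proof (rule line_integral_residue[where U = "strip (real ?N - 1) (real ?N + 1)" and n = "real ?N" and T = 1])
    show "riemann_kernel s holomorphic_on strip (real ?N - 1) (real ?N + 1) - {of_real (real ?N)}"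
      by (rule holomorphic_riemann_kernel) (use sin_den_nonzero_strip_nat[of _ ?N] in \<open>auto simp: strip_def\<close>)
    have cut: "(of_nat ?N :: complex) \<notin> \<real>\<^sub>\<le>\<^sub>0" by (auto simp: complex_nonpos_Reals_iff)
    have "((\<lambda>z. exp (- s * Ln z) * exp (- (of_real pi * \<i> * z\<^sup>2)) * ((z - of_nat ?N) / sin_den z)) \<longlongrightarrow>
       exp (- s * Ln (of_nat ?N)) * exp (- (of_real pi * \<i> * (of_nat ?N)\<^sup>2)) * ((-1) ^ ?N / (2 * of_real pi * \<i>))) (at (of_nat ?N))"
      by (intro tendsto_intros sin_den_residue cut)
    moreover have "exp (- (of_real pi * \<i> * (of_nat ?N)\<^sup>2)) = ((-1) ^ ?N :: complex)"
    proof -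
      have "(-1) ^ (?N ^ 2) = ((-1) ^ ?N :: complex)" by (cases "even ?N") simp_all
      then show ?thesis using exp_minus_of_nat_pi_i[of "?N ^ 2"] by (simp add: mult_ac del: of_nat_Suc)
    qed
    moreover have "(-1) ^ ?N * ((-1) ^ ?N / (2 * of_real pi * \<i>)) = 1 / (2 * of_real pi * \<i> :: complex)"
      by (cases "even n") auto
    ultimately have "((\<lambda>z. exp (- s * Ln z) * exp (- (of_real pi * \<i> * z\<^sup>2)) * ((z - of_nat ?N) / sin_den z)) \<longlongrightarrow>
       exp (- s * Ln (of_nat ?N)) * (1 / (2 * of_real pi * \<i>))) (at (of_nat ?N))"
      by (simp only: mult.assoc)
    then show "((\<lambda>z. (z - of_real (real ?N)) * riemann_kernel s z) \<longlongrightarrow> exp (- s * Ln (of_nat ?N)) / (2 * of_real pi * \<i>)) (at (of_real (real ?N)))"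
      by (simp add: riemann_kernel_def mult_ac)
    show "norm (riemann_kernel s (of_real c + of_real t * se)) \<le> exp (norm s * ((real ?N + 1) + 5) + (norm s + 2 * pi * (real ?N + 1) + 2)\<^sup>2 / (4 * pi)) / t\<^sup>2"
      if "c \<in> {real n + 1/2..real (Suc n) + 1/2}" "1 \<le> \<bar>t\<bar>" for c t
      using that by (intro riemann_kernel_decay) auto
  qed (auto simp: open_convex_strip se_simps)
  then show ?thesis by simp
qed

lemma riemann_aux_bar_shift:
  assumes "0 < c" "c < 1"
  shows "riemann_aux_bar c s = (\<Sum>n=1..m. exp (- s * Ln (of_nat n))) + line_integral se (real m + 1/2) (riemann_kernel s)"
proof (induction m)
  case 0
  then show ?case using riemann_aux_bar_eq_half[OF assms] by (simp add: riemann_aux_bar_def)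
next
  case (Suc m)
  then show ?case using riemann_aux_bar_cross[of m s] by (simp add: algebra_simps del: of_nat_Suc)
qed

lemma holomorphic_riemann_aux_bar:
  assumes c: "0 < c" "c < 1"
  shows "riemann_aux_bar c holomorphic_on UNIV"
proof -
  let ?x = "\<lambda>t. of_real c + of_real t * se"
  have nI: "c \<notin> \<int>" using c by (auto elim!: Ints_cases)
  have nz: "sin_den (?x t) \<noteq> 0" for t by (simp add: sin_den_eq_0_iff not_Ints_line nI)
  have cut: "?x t \<notin> \<real>\<^sub>\<le>\<^sub>0" for t by (rule line_not_nonpos[OF c(1)])
  have "(\<lambda>s. \<integral>t. riemann_kernel s (?x t) * se \<partial>lborel) holomorphic_on UNIV"
  proof (rule holomorphic_on_integral_parameter)
    show "((\<lambda>s. riemann_kernel s (?x t) * se) has_field_derivative riemann_kernel s (?x t) * (- Ln (?x t)) * se) (at s)" for s t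
      unfolding riemann_kernel_def using nz[of t] by (auto intro!: derivative_eq_intros)
    show "continuous_on UNIV (\<lambda>t. riemann_kernel s (?x t) * se)" for s
      by (intro continuous_intros continuous_riemann_kernel c nI)
    show "continuous_on (UNIV \<times> UNIV) (\<lambda>(s, t). riemann_kernel s (?x t) * (- Ln (?x t)) * se)"
      using nz cut unfolding riemann_kernel_def split_def by (intro continuous_intros) auto
    fix s :: complex
    let ?A = "exp ((norm s + 1) * (1 + 5) + ((norm s + 1) + 2 * pi * 1 + 2)\<^sup>2 / (4 * pi))"
    have bd: "norm (riemann_kernel w (?x t) * se) \<le> ?A / t\<^sup>2" if "w \<in> ball s 1" "1 \<le> \<bar>t\<bar>" for w t
    proof -
      have w: "norm w \<le> norm s + 1"
        using that norm_triangle_ineq2[of w s] by (auto simp: dist_norm norm_minus_commute)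
      have "norm (riemann_kernel w (?x t) * se) = norm (riemann_kernel w (?x t))" by (simp add: norm_mult se_simps)
      also have "\<dots> \<le> ?A / t\<^sup>2" using that c by (intro riemann_kernel_decay w) auto
      finally show ?thesis .
    qed
    show "\<exists>e>0. \<exists>A. \<exists>T>0. \<forall>w\<in>ball s e. \<forall>t. T \<le> \<bar>t\<bar> \<longrightarrow> norm (riemann_kernel w (?x t) * se) \<le> A / t\<^sup>2"
      by (rule exI[of _ 1], rule conjI, simp, rule exI[of _ ?A], rule exI[of _ 1]) (use bd in auto)
  qed auto
  then show ?thesis unfolding riemann_aux_bar_def[abs_def] line_integral_def .
qed

lemma sin_den_cnj: "sin_den (cnj x) = - cnj (sin_den x)"
  by (simp add: sin_den_eq cnj_sin)

text \<open>The original direction is minus the conjugate of \<open>se\<close>. Replacing t by -t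
  makes the points conjugate; the two remaining signs, from the direction and from conjugating
  \<open>sin_den\<close>, cancel.\<close>

lemma riemann_aux_eq_cnj:
  assumes c: "0 < c"
  shows "riemann_aux c s = cnj (riemann_aux_bar c (cnj s))"
proof -
  let ?e = "cis (- (3 * pi / 4))"
  have e: "?e = - cnj se"
  proof -
    have "- (3 * pi / 4) = pi / 4 - pi" by simp
    then have "?e = - cis (pi / 4)" by (simp only: cis_divide[symmetric]) simp
    then show ?thesis by (simp add: se_def cis_cnj)
  qed
  let ?f = "\<lambda>x. exp (- s * Ln x) * exp (of_real pi * \<i> * x\<^sup>2) / sin_den x"
  have "riemann_aux c s = (\<integral>t. ?f (of_real c + of_real t * ?e) * ?e \<partial>lborel)"
    unfolding riemann_aux_def Let_def sin_den_def ..
  also have "\<dots> = (\<integral>t. ?f (of_real c + of_real (0 + -1 * t) * ?e) * ?e \<partial>lborel)"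
    using lborel_integral_real_affine[of "-1" "\<lambda>t. ?f (of_real c + of_real t * ?e) * ?e" 0] by simp
  also have "\<dots> = (\<integral>t. cnj (riemann_kernel (cnj s) (of_real c + of_real t * se) * se) \<partial>lborel)"
  proof -
    have "?f (of_real c + of_real (0 + -1 * t) * ?e) * ?e = cnj (riemann_kernel (cnj s) (of_real c + of_real t * se) * se)" for t
    proof -
      define y where "y = of_real c + of_real t * se"
      have cy: "of_real c + of_real (0 + -1 * t) * ?e = cnj y" by (simp add: y_def e)
      have "Ln (cnj y) = cnj (Ln y)" using line_not_nonpos[OF c, of t] by (simp add: cnj_Ln y_def)
      then show ?thesis
        unfolding cy y_def[symmetric] riemann_kernel_def sin_den_cnj by (simp add: exp_cnj e)
    qed
    then show ?thesis by (simp only:)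
  qed
  also have "\<dots> = cnj (riemann_aux_bar c (cnj s))"
    unfolding riemann_aux_bar_def line_integral_def by (rule integral_bounded_linear'[OF bounded_linear_cnj bounded_linear_cnj]) simp
  finally show ?thesis .
qed

lemma holomorphic_riemann_aux:
  assumes "0 < c" "c < 1"
  shows "riemann_aux c holomorphic_on UNIV"
proof -
  have "(cnj \<circ> riemann_aux_bar c \<circ> cnj) holomorphic_on UNIV"
    by (rule holomorphic_on_compose_cnj_cnj)
       (auto intro: holomorphic_on_subset[OF holomorphic_riemann_aux_bar[OF assms]])
  moreover have "riemann_aux c = cnj \<circ> riemann_aux_bar c \<circ> cnj"
    by (simp add: fun_eq_iff riemann_aux_eq_cnj[OF assms(1)])
  ultimately show ?thesis by simp
qed

section \<open>The functional equation\<close>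

text \<open>The power r^a extended by 0 to r <= 0. For a > 0 it is continuous, so half-line
  integrals fall under the whole-line criteria.\<close>

definition pos_powr :: "real \<Rightarrow> real \<Rightarrow> real" where
  "pos_powr a r = max r 0 powr a"

lemma pos_powr_simps: "r > 0 \<Longrightarrow> pos_powr a r = r powr a" "r \<le> 0 \<Longrightarrow> pos_powr a r = 0"
  "0 \<le> pos_powr a r"
  by (auto simp: pos_powr_def max_def)

lemma continuous_pos_powr: "a > 0 \<Longrightarrow> continuous_on UNIV (pos_powr a)"
  unfolding pos_powr_def by (intro continuous_on_powr' continuous_intros) auto

lemma pos_powr_exp_decay:
  fixes a \<epsilon> r :: real
  assumes "a > 0" "\<epsilon> > 0" "1 \<le> \<bar>r\<bar>"
  shows "pos_powr a r * exp (- (\<epsilon> * r)) \<le> exp (- (a + 2) * ln (\<epsilon> / (a + 2))) / r\<^sup>2"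
proof (cases "r > 0")
  case True
  \<comment> \<open>Chosen so that ln (r delta) <= r delta, multiplied by a + 2, cancels the
    exponential exactly.\<close>
  define \<delta> where "\<delta> = \<epsilon> / (a + 2)"
  have \<delta>: "\<delta> > 0" using assms by (simp add: \<delta>_def)
  have "ln r = ln (r * \<delta>) - ln \<delta>" using True \<delta> by (simp add: ln_mult)
  also have "ln (r * \<delta>) \<le> r * \<delta>" using True \<delta> ln_le_minus_one[of "r * \<delta>"] by simp
  finally have "(a + 2) * ln r \<le> (a + 2) * (r * \<delta> - ln \<delta>)" using assms by (intro mult_left_mono) auto
  also have "\<dots> = \<epsilon> * r - (a + 2) * ln \<delta>" using assms by (simp add: \<delta>_def field_simps)
  finally have *: "(a + 2) * ln r - \<epsilon> * r \<le> - (a + 2) * ln \<delta>" by (simp add: algebra_simps)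
  have "r powr a * r\<^sup>2 = r powr (a + 2)" using True by (simp add: powr_add)
  then have "(pos_powr a r * exp (- (\<epsilon> * r))) * r\<^sup>2 = exp ((a + 2) * ln r - \<epsilon> * r)"
    using True by (simp add: pos_powr_simps powr_def exp_diff exp_minus field_simps)
  also have "\<dots> \<le> exp (- (a + 2) * ln \<delta>)" using * by (simp only: exp_le_cancel_iff)
  finally show ?thesis using True by (simp add: field_simps \<delta>_def)
qed (use assms in \<open>simp add: pos_powr_simps\<close>)

lemma Gamma_laplace_integrable:
  assumes "a > 0" "Re z > 0"
  shows "integrable lborel (\<lambda>r. of_real (pos_powr a r) * exp (- (z * of_real r)))"
proof (rule inverse_square_decay_integrable[where T = 1 and A = "exp (- (a + 2) * ln (Re z / (a + 2)))"])
  show "continuous_on UNIV (\<lambda>r. of_real (pos_powr a r) * exp (- (z * of_real r)))"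
    by (intro continuous_intros continuous_pos_powr assms)
  show "norm (of_real (pos_powr a r) * exp (- (z * of_real r))) \<le> exp (- (a + 2) * ln (Re z / (a + 2))) / r\<^sup>2"
    if "1 \<le> \<bar>r\<bar>" for r
    using pos_powr_exp_decay[OF assms that] by (simp add: norm_mult pos_powr_simps)
qed simp

text \<open>For positive real z a rescaling of r leads to Euler's integral; both sides are
  holomorphic in the right half-plane, and the identity theorem does the rest.\<close>

lemma Gamma_laplace:
  assumes a: "a > 0" and z: "Re z > 0"
  shows "(\<integral>r. of_real (pos_powr a r) * exp (- (z * of_real r)) \<partial>lborel) = Gamma (of_real (a + 1)) * exp (- of_real (a + 1) * Ln z)"
proof -
  define F where "F = (\<lambda>z::complex. \<integral>r. of_real (pos_powr a r) * exp (- (z * of_real r)) \<partial>lborel)"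
  let ?H = "{z. Re z > 0}"
  have hol: "F holomorphic_on ?H"
    unfolding F_def
  proof (rule holomorphic_on_integral_parameter)
    show "open ?H" by (rule open_halfspace_Re_gt)
    show "((\<lambda>z. of_real (pos_powr a r) * exp (- (z * of_real r))) has_field_derivative
        of_real (pos_powr a r) * (exp (- (z * of_real r)) * - of_real r)) (at z)" for z :: complex and r
      by (auto intro!: derivative_eq_intros)
    show "continuous_on UNIV (\<lambda>r. of_real (pos_powr a r) * exp (- (z * of_real r)))" for z :: complex
      by (intro continuous_intros continuous_pos_powr a)
    show "continuous_on (?H \<times> UNIV) (\<lambda>(z, r). of_real (pos_powr a r) * (exp (- (z * of_real r)) * - of_real r))"
      unfolding split_def
      by (intro continuous_intros continuous_on_compose2[OF continuous_pos_powr[OF a]]) auto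
    fix z :: complex assume z: "z \<in> ?H"
    let ?e = "Re z / 2"
    let ?A = "exp (- (a + 2) * ln (?e / (a + 2)))"
    have bd: "norm (of_real (pos_powr a r) * exp (- (w * of_real r))) \<le> ?A / r\<^sup>2"
      if w: "w \<in> ball z ?e" and r: "1 \<le> \<bar>r\<bar>" for w r
    proof -
      have "?e \<le> Re w" using w abs_Re_le_cmod[of "z - w"] by (auto simp: dist_norm)
      have "norm (of_real (pos_powr a r) * exp (- (w * of_real r))) = pos_powr a r * exp (- (Re w * r))"
        by (simp add: norm_mult pos_powr_simps)
      also have "\<dots> \<le> pos_powr a r * exp (- (?e * r))"
      proof (cases "r > 0")
        case True
        then have "?e * r \<le> Re w * r" using \<open>?e \<le> Re w\<close> by (intro mult_right_mono) auto
        then show ?thesis by (intro mult_left_mono) (auto simp: pos_powr_simps)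
      qed (simp add: pos_powr_simps)
      also have "\<dots> \<le> ?A / r\<^sup>2" using a z r by (intro pos_powr_exp_decay) auto
      finally show ?thesis .
    qed
    show "\<exists>e>0. \<exists>A. \<exists>T>0. \<forall>w\<in>ball z e. \<forall>r. T \<le> \<bar>r\<bar> \<longrightarrow> norm (of_real (pos_powr a r) * exp (- (w * of_real r))) \<le> A / r\<^sup>2"
      by (rule exI[of _ ?e], rule conjI, use z in simp, rule exI[of _ ?A], rule exI[of _ 1]) (use bd in auto)
  qed
  have one: "(\<integral>r. pos_powr a r * exp (- r) \<partial>lborel) = Gamma (a + 1)"
  proof -
    have "integrable lborel (\<lambda>r. norm (complex_of_real (pos_powr a r) * exp (- (1 * of_real r))))"
      by (intro integrable_norm Gamma_laplace_integrable a) simp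
    then have int: "integrable lborel (\<lambda>r. pos_powr a r * exp (- r))"
      by (simp add: norm_mult pos_powr_simps)
    have "((\<lambda>r. pos_powr a r * exp (- r)) has_integral (\<integral>r. pos_powr a r * exp (- r) \<partial>lborel)) UNIV"
      by (rule has_integral_integral_lborel[OF int])
    moreover have "((\<lambda>r. pos_powr a r * exp (- r)) has_integral Gamma (a + 1)) UNIV"
    proof -
      have "((\<lambda>t. t powr (a + 1 - 1) / exp t) has_integral Gamma (a + 1)) {0..}"
        by (rule Gamma_integral_real) (use a in simp)
      then have "((\<lambda>t. if t \<in> {0..} then t powr (a + 1 - 1) / exp t else 0) has_integral Gamma (a + 1)) UNIV"
        by (simp only: has_integral_restrict_UNIV)
      moreover have "(\<lambda>t. if t \<in> {0..} then t powr (a + 1 - 1) / exp t else 0) = (\<lambda>r. pos_powr a r * exp (- r))"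
        using a by (auto simp: fun_eq_iff pos_powr_def exp_minus divide_inverse)
      ultimately show ?thesis by simp
    qed
    ultimately show ?thesis by (rule has_integral_unique)
  qed
  have real: "F (of_real y) = Gamma (of_real (a + 1)) * exp (- of_real (a + 1) * Ln (of_real y))" if y: "y > 0" for y :: real
  proof -
    have pw: "pos_powr a (y * r) = y powr a * pos_powr a r" for r
    proof -
      have "max (y * r) 0 = y * max r 0" using y by (auto simp: max_def mult_le_0_iff)
      then show ?thesis using y by (simp add: pos_powr_def powr_mult)
    qed
    have "Gamma (a + 1) = y * (\<integral>r. y powr a * (pos_powr a r * exp (- (y * r))) \<partial>lborel)"
      using lborel_integral_real_affine[of y "\<lambda>r. pos_powr a r * exp (- r)" 0] y one
      by (simp add: pw mult.assoc)
    then have G: "Gamma (a + 1) = y powr (a + 1) * (\<integral>r. pos_powr a r * exp (- (y * r)) \<partial>lborel)"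
      using y by (simp add: powr_add)
    have "F (of_real y) = (\<integral>r. of_real (pos_powr a r * exp (- (y * r))) \<partial>lborel)"
      by (simp add: F_def exp_of_real[symmetric])
    also have "\<dots> = of_real (\<integral>r. pos_powr a r * exp (- (y * r)) \<partial>lborel)" by (rule integral_complex_of_real)
    also have "(\<integral>r. pos_powr a r * exp (- (y * r)) \<partial>lborel) = Gamma (a + 1) * exp (- (a + 1) * ln y)"
    proof -
      have cancel: "J = A * J * B" if "A * B = 1" for A B J :: real
      proof -
        have "A * J * B = J * (A * B)" by simp
        then show ?thesis using that by simp
      qed
      have "exp (- (a + 1) * ln y) = y powr - (a + 1)" using y by (simp add: powr_def)
      moreover have "y powr (a + 1) * y powr - (a + 1) = 1" using y by (simp flip: powr_add)
      ultimately show ?thesis using cancel unfolding G by (simp only:)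
    qed
    also have "of_real (Gamma (a + 1) * exp (- (a + 1) * ln y)) = Gamma (of_real (a + 1)) * exp (- of_real (a + 1) * Ln (of_real y))"
      by (simp only: of_real_mult of_real_minus exp_of_real[symmetric] Gamma_complex_of_real Ln_of_real[OF y])
    finally show ?thesis .
  qed
  have "F z - Gamma (of_real (a + 1)) * exp (- of_real (a + 1) * Ln z) = 0"
  proof (rule analytic_continuation[where S = ?H and U = "of_real ` {0<..}" and \<xi> = 1
        and f = "\<lambda>z. F z - Gamma (of_real (a + 1)) * exp (- of_real (a + 1) * Ln z)"])
    show "(\<lambda>z. F z - Gamma (of_real (a + 1)) * exp (- of_real (a + 1) * Ln z)) holomorphic_on ?H"
      by (intro holomorphic_intros hol) (auto simp: complex_nonpos_Reals_iff)
    show "open ?H" by (rule open_halfspace_Re_gt)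
    show "connected ?H" by (intro convex_connected convex_halfspace_Re_gt)
    show "of_real ` {0<..} \<subseteq> ?H" by auto
    show "1 islimpt (of_real ` {0<..} :: complex set)"
      unfolding islimpt_approachable
    proof (intro allI impI)
      fix e :: real assume e: "e > 0"
      define y :: complex where "y = of_real (1 + e / 2)"
      have "y \<in> of_real ` {0<..}" unfolding y_def using e by (intro imageI) simp
      moreover have y1: "y - 1 = of_real (e / 2)" by (simp add: y_def)
      then have "norm (y - 1) = e / 2" using e by (simp only: norm_of_real)
      then have "y \<noteq> 1" "dist y 1 < e" using e by (auto simp: dist_norm)
      ultimately show "\<exists>x'\<in>of_real ` {0<..}. x' \<noteq> (1::complex) \<and> dist x' 1 < e" by blast
    qed
  qed (use real z in auto)
  then show ?thesis by (simp add: F_def)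
qed

section \<open>Laplace transforms along the ray of direction exp (pi i/4)\<close>

lemma Ln_se: "Ln se = - (\<i> * of_real (pi / 4))"
proof -
  have "- (pi / 4) \<le> pi" using pi_gt_zero by linarith
  then show ?thesis by (intro Ln_unique) (auto simp: se_def cis_conv_exp)
qed

lemma Ln_se_mult:
  assumes "Re x + Im x > 0"
  shows "Ln (se * x) = Ln x - \<i> * of_real (pi / 4)"
proof (rule Ln_unique)
  have "x \<noteq> 0" using assms by auto
  then show "exp (Ln x - \<i> * of_real (pi / 4)) = se * x"
    unfolding diff_conv_add_uminus exp_add by (simp add: se_def cis_conv_exp)
qed (use Im_Ln_half_plane[OF assms] in auto)

lemma Re_se_line: "Re (se * (of_real c + of_real t * se)) = c * sqrt 2 / 2"
  by (simp add: se_simps algebra_simps)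

text \<open>
  On the ray through \<open>exp (\<pi>i/4)\<close>, parametrised as \<open>a = i r se\<close>, the closed form of \<open>mordell 1\<close>
  splits the kernel into a geometric series and a Mordell integral.
\<close>

lemma ray_split:
  assumes "r > 0"
  defines "a \<equiv> \<i> * of_real r * se"
  shows "exp (- of_real (pi * r\<^sup>2)) / sin_den a = mordell 1 (1/2) a + exp (of_real pi * \<i> * a) / sin_den a"
    and "(\<lambda>n. - exp (- (2 * of_real pi * (of_nat n + 1) * se * of_real r))) sums (exp (of_real pi * \<i> * a) / sin_den a)"
proof -
  have a2: "a\<^sup>2 = \<i> * of_real (r\<^sup>2)" by (simp add: a_def power_mult_distrib se_simps)
  have nz: "sin_den a \<noteq> 0"
  proof
    assume "sin_den a = 0"
    then have "Im a = 0" by (auto simp: sin_den_eq_0_iff elim: Ints_cases)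
    then show False using assms by (simp add: a_def se_simps)
  qed
  have "of_real pi * \<i> * a\<^sup>2 = - of_real (pi * r\<^sup>2)" unfolding a2 by (simp add: mult.assoc)
  then show "exp (- of_real (pi * r\<^sup>2)) / sin_den a = mordell 1 (1/2) a + exp (of_real pi * \<i> * a) / sin_den a"
    using mordell_1_closed_form[of a] nz by (simp add: field_simps)
  \<comment> \<open>This is exp (2 pi i a), of modulus less than 1 on the ray; the quotient becomes
    q / (q - 1).\<close>
  define q where "q = exp (- (2 * of_real pi * se * of_real r))"
  have q1: "norm q < 1" using assms by (simp add: q_def se_simps)
  have pia: "of_real pi * \<i> * a = - (of_real pi * se * of_real r)"
    by (simp add: a_def mult.assoc)
  have e: "exp (of_real pi * \<i> * a) = q * exp (- (of_real pi * \<i> * a))"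
    unfolding pia q_def exp_add[symmetric] by (simp add: algebra_simps)
  have "1 - q \<noteq> 0" using q1 by auto
  have "exp (of_real pi * \<i> * a) / sin_den a = q / (q - 1)"
  proof -
    have "sin_den a = (q - 1) * exp (- (of_real pi * \<i> * a))"
      unfolding sin_den_def by (subst e) (simp add: algebra_simps)
    then show ?thesis by (subst e) simp
  qed
  also have "\<dots> = - q * (1 / (1 - q))" using \<open>1 - q \<noteq> 0\<close> by (simp add: field_simps)
  finally have "(\<lambda>n. - q * q ^ n) sums (exp (of_real pi * \<i> * a) / sin_den a)"
    using sums_mult[OF geometric_sums[OF q1], of "- q"] by simp
  moreover have "- q * q ^ n = - exp (- (2 * of_real pi * (of_nat n + 1) * se * of_real r))" for n
  proof -
    have "q * q ^ n = exp (of_nat (Suc n) * (- (2 * of_real pi * se * of_real r)))"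
      unfolding exp_of_nat_mult q_def by simp
    then show ?thesis by (simp add: algebra_simps)
  qed
  ultimately show "(\<lambda>n. - exp (- (2 * of_real pi * (of_nat n + 1) * se * of_real r))) sums (exp (of_real pi * \<i> * a) / sin_den a)"
    by simp
qed

text \<open>Term by term, the Laplace transform at 2 pi n \<open>se\<close> produces n^(-s) with s =
  a + 1, and \<open>G\<close> collects Gamma (s), (2 pi)^(-s) and the phase of
  \<open>se\<close>^(-s). The interchange rests on the L1 norms, which are multiples of
  n^(-s).\<close>

lemma ray_series_integral:
  assumes a: "a > 0"
  defines "G \<equiv> Gamma (of_real (a + 1)) * exp (- of_real (a + 1) * of_real (ln (2 * pi))) * exp (\<i> * of_real (pi * (a + 1) / 4)) :: complex"
    and "g \<equiv> \<lambda>r. exp (of_real pi * \<i> * (\<i> * of_real r * se)) / sin_den (\<i> * of_real r * se)"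
  shows "integrable lborel (\<lambda>r. of_real (pos_powr a r) * g r)"
    and "(\<integral>r. of_real (pos_powr a r) * g r \<partial>lborel) = - (G * (\<Sum>n. 1 / of_nat (Suc n) powr of_real (a + 1)))"
proof -
  define z where "z = (\<lambda>n. 2 * of_real pi * (of_nat n + 1) * se)"
  define f where "f = (\<lambda>n r. - (of_real (pos_powr a r) * exp (- (z n * of_real r))))"
  have Rez: "Re (z n) = pi * sqrt 2 * (real n + 1)" for n by (simp add: z_def se_simps)
  then have Rez0: "Re (z n) > 0" for n by simp
  have intf: "integrable lborel (f n)" for n
    unfolding f_def by (intro Bochner_Integration.integrable_minus Gamma_laplace_integrable a Rez0)
  have sumsf: "(\<lambda>n. f n r) sums (of_real (pos_powr a r) * g r)" for r
  proof (cases "r > 0")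
    case True
    from sums_mult[OF ray_split(2)[OF True], of "of_real (pos_powr a r)"]
    show ?thesis by (simp add: f_def g_def z_def)
  qed (simp add: f_def pos_powr_simps)
  have normf: "(\<integral>r. norm (f n r) \<partial>lborel) = norm (Gamma (of_real (a + 1)) :: complex) * exp (- (a + 1) * ln (pi * sqrt 2 * (real n + 1)))" for n
  proof -
    let ?y = "pi * sqrt 2 * (real n + 1)"
    have y: "?y > 0" by simp
    have nn: "norm (f n r) = pos_powr a r * exp (- (?y * r))" for r
      by (simp add: f_def norm_mult pos_powr_simps Rez)
    have "of_real (\<integral>r. norm (f n r) \<partial>lborel) = (\<integral>r. of_real (pos_powr a r * exp (- (?y * r))) \<partial>lborel :: complex)"
      unfolding nn by (rule integral_complex_of_real[symmetric])
    also have "\<dots> = (\<integral>r. of_real (pos_powr a r) * exp (- (of_real ?y * of_real r)) \<partial>lborel)"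
      by (simp only: of_real_mult of_real_minus exp_of_real[symmetric])
    also have "\<dots> = Gamma (of_real (a + 1)) * exp (- of_real (a + 1) * Ln (of_real ?y))"
      by (rule Gamma_laplace) (use a y in auto)
    also have "exp (- of_real (a + 1) * Ln (of_real ?y)) = of_real (exp (- (a + 1) * ln ?y))"
      by (subst Ln_of_real[OF y]) (simp only: of_real_mult[symmetric] of_real_minus[symmetric] exp_of_real)
    finally have eq: "of_real (\<integral>r. norm (f n r) \<partial>lborel) = Gamma (of_real (a + 1)) * complex_of_real (exp (- (a + 1) * ln ?y))" .
    have "(\<integral>r. norm (f n r) \<partial>lborel) \<ge> 0" by (rule Bochner_Integration.integral_nonneg) simp
    then have "(\<integral>r. norm (f n r) \<partial>lborel) = norm (complex_of_real (\<integral>r. norm (f n r) \<partial>lborel))" by simp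
    also have "\<dots> = norm (Gamma (of_real (a + 1)) :: complex) * exp (- (a + 1) * ln ?y)"
      unfolding eq norm_mult by simp
    finally show ?thesis .
  qed
  have summ: "summable (\<lambda>n. \<integral>r. norm (f n r) \<partial>lborel)"
  proof -
    have "summable (\<lambda>n. real n powr (- (a + 1)))" using a by (simp add: summable_real_powr_iff)
    then have "summable (\<lambda>n. real (Suc n) powr (- (a + 1)))" by (subst summable_Suc_iff)
    then have "summable (\<lambda>n. norm (Gamma (of_real (a + 1)) :: complex) * (exp (- (a + 1) * ln (pi * sqrt 2)) * real (Suc n) powr (- (a + 1))))"
      by (intro summable_mult)
    moreover have "exp (- (a + 1) * ln (pi * sqrt 2 * (real n + 1))) = exp (- (a + 1) * ln (pi * sqrt 2)) * real (Suc n) powr (- (a + 1))" for n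
    proof -
      have "ln (pi * sqrt 2 * (real n + 1)) = ln (pi * sqrt 2) + ln (real n + 1)" by (simp add: ln_mult)
      then show ?thesis by (simp add: powr_def distrib_left exp_add add.commute)
    qed
    ultimately show ?thesis unfolding normf by simp
  qed
  have AEs: "AE r in lborel. summable (\<lambda>n. norm (f n r))"
  proof (rule AE_I2)
    fix r :: real
    show "summable (\<lambda>n. norm (f n r))"
    proof (cases "r > 0")
      case True
      have "norm (exp (- (2 * pi * (sqrt 2 / 2) * r))) < 1" using True by simp
      then have "summable (\<lambda>n. exp (- (2 * pi * (sqrt 2 / 2) * r)) ^ Suc n)"
        by (subst summable_Suc_iff) (rule summable_geometric)
      then have "summable (\<lambda>n. pos_powr a r * exp (- (2 * pi * (sqrt 2 / 2) * r)) ^ Suc n)" by (rule summable_mult)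
      moreover have "norm (f n r) = pos_powr a r * exp (- (2 * pi * (sqrt 2 / 2) * r)) ^ Suc n" for n
      proof -
        have "norm (f n r) = pos_powr a r * exp (- (pi * sqrt 2 * (real n + 1) * r))"
          by (simp add: f_def norm_mult pos_powr_simps Rez)
        also have "- (pi * sqrt 2 * (real n + 1) * r) = real (Suc n) * (- (2 * pi * (sqrt 2 / 2) * r))"
          by (simp add: algebra_simps)
        finally show ?thesis by (simp only: exp_of_nat_mult)
      qed
      ultimately show ?thesis by simp
    qed (simp add: f_def pos_powr_simps)
  qed
  have fsum: "(\<Sum>n. f n r) = of_real (pos_powr a r) * g r" for r
    using sumsf[of r] by (rule sums_unique[symmetric])
  show "integrable lborel (\<lambda>r. of_real (pos_powr a r) * g r)"
    using integrable_suminf[OF intf AEs summ] unfolding fsum .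
  have each: "(\<integral>r. f n r \<partial>lborel) = - (G * (1 / of_nat (Suc n) powr of_real (a + 1)))" for n
  proof -
    have z: "z n = of_real (real (Suc n)) * (of_real (2 * pi) * se)" by (simp add: z_def algebra_simps)
    have LZ: "Ln (z n) = of_real (ln (real (Suc n))) + (of_real (ln (2 * pi)) + Ln se)"
    proof -
      have "Ln (z n) = Ln (of_real (real (Suc n))) + Ln (of_real (2 * pi) * se)"
        unfolding z by (rule Ln_times_of_real) (simp_all add: se_simps)
      also have "Ln (of_real (2 * pi) * se) = Ln (of_real (2 * pi)) + Ln se"
        by (rule Ln_times_of_real) (simp_all add: se_simps)
      finally show ?thesis by (simp only: Ln_of_real[of "2 * pi"] Ln_of_real[of "real (Suc n)"] pi_gt_zero zero_less_mult_iff of_nat_0_less_iff zero_less_Suc zero_less_numeral simp_thms)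
    qed
    have Lnat: "Ln (of_nat (Suc n)) = of_real (ln (real (Suc n)))"
      using Ln_of_nat[of "Suc n"] by simp
    have L: "- of_real (a + 1) * Ln (z n) = - of_real (a + 1) * of_real (ln (2 * pi)) + \<i> * of_real (pi * (a + 1) / 4) + - (of_real (a + 1) * Ln (of_nat (Suc n)))"
      unfolding LZ Ln_se Lnat by (simp add: field_simps del: of_nat_Suc)
    have "(\<integral>r. f n r \<partial>lborel) = - (Gamma (of_real (a + 1)) * exp (- of_real (a + 1) * Ln (z n)))"
      unfolding f_def using Gamma_laplace[OF a Rez0, of n] by simp
    moreover have "exp (- (of_real (a + 1) * Ln (of_nat (Suc n)))) = 1 / of_nat (Suc n) powr (of_real (a + 1) :: complex)"
      by (simp add: powr_def exp_minus inverse_eq_divide del: of_nat_Suc)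
    ultimately show ?thesis
      unfolding L exp_add G_def by (simp only: mult.assoc)
  qed
  have "(\<integral>r. of_real (pos_powr a r) * g r \<partial>lborel) = (\<Sum>n. \<integral>r. f n r \<partial>lborel)"
    using integral_suminf[OF intf AEs summ] unfolding fsum .
  also have "\<dots> = (\<Sum>n. - (G * (1 / of_nat (Suc n) powr of_real (a + 1))))" by (simp only: each)
  also have "(\<Sum>n. - (G * (1 / of_nat (Suc n) powr of_real (a + 1)))) = - (G * (\<Sum>n. 1 / of_nat (Suc n) powr of_real (a + 1)))"
  proof -
    have "summable (\<lambda>n. 1 / of_nat (Suc n) powr of_real (a + 1) :: complex)"
    proof (rule summable_norm_cancel)
      have "summable (\<lambda>n. real n powr (- (a + 1)))" using a by (simp add: summable_real_powr_iff)
      then have "summable (\<lambda>n. real (Suc n) powr (- (a + 1)))" by (subst summable_Suc_iff)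
      moreover have "norm (1 / of_nat (Suc n) powr of_real (a + 1) :: complex) = real (Suc n) powr (- (a + 1))" for n
        unfolding powr_minus_divide by (simp add: norm_divide norm_powr_real_powr del: of_nat_Suc)
      ultimately show "summable (\<lambda>n. norm (1 / of_nat (Suc n) powr of_real (a + 1) :: complex))" by simp
    qed
    then show ?thesis by (simp only: suminf_minus[OF summable_mult] suminf_mult)
  qed
  finally show "(\<integral>r. of_real (pos_powr a r) * g r \<partial>lborel) = - (G * (\<Sum>n. 1 / of_nat (Suc n) powr of_real (a + 1)))" .
qed

text \<open>After exchanging the integrals, the inner one is a Laplace transform at 2 pi
  \<open>se\<close> x, whose power x^(-s) rebuilds the kernel of \<open>riemann_aux_bar\<close>.
  Since Re (\<open>se\<close> x) is constant on the line, |F| is a product of a function of r and a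
  function of v.\<close>

lemma ray_mordell_integral:
  assumes a: "a > 0"
  defines "G \<equiv> Gamma (of_real (a + 1)) * exp (- of_real (a + 1) * of_real (ln (2 * pi))) * exp (\<i> * of_real (pi * (a + 1) / 4)) :: complex"
  shows "integrable lborel (\<lambda>r. of_real (pos_powr a r) * mordell 1 (1/2) (\<i> * of_real r * se))"
    and "(\<integral>r. of_real (pos_powr a r) * mordell 1 (1/2) (\<i> * of_real r * se) \<partial>lborel) = G * riemann_aux_bar (1/2) (of_real (a + 1))"
proof -
  define x where "x = (\<lambda>v::real. of_real (1/2) + of_real v * se)"
  \<comment> \<open>The Mordell integrand at a = 0, with the zero term kept so that
    \<open>mordell_integrable\<close> matches.\<close>
  define k where "k = (\<lambda>v. exp (- (of_real (pi * real 1) * \<i> * (x v)\<^sup>2) + 2 * of_real pi * \<i> * 0 * x v) / sin_den (x v) * se)"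
  define F where "F = (\<lambda>r v. of_real (pos_powr a r) * exp (- (2 * of_real pi * se * x v * of_real r)) * k v)"
  have Re: "Re (2 * of_real pi * se * x v) = pi * sqrt 2 / 2" for v
  proof -
    have "Re (2 * of_real pi * se * x v) = 2 * pi * Re (se * x v)" by (simp add: mult.assoc)
    then show ?thesis unfolding x_def Re_se_line by simp
  qed
  have nz: "sin_den (x v) \<noteq> 0" for v
    using not_Ints_line[OF not_Ints_half] by (simp add: sin_den_eq_0_iff x_def)
  have contx: "continuous_on A x" for A unfolding x_def by (intro continuous_intros)
  have contk: "continuous_on UNIV k"
    unfolding k_def using nz by (intro continuous_intros contx) auto
  have intk: "integrable lborel k"
    unfolding k_def x_def by (intro integrable_mult_left mordell_integrable not_Ints_half) simp
  have contF: "continuous_on UNIV (case_prod F)"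
  proof -
    have "continuous_on UNIV (\<lambda>p. x (snd p))" "continuous_on UNIV (\<lambda>p. k (snd p))" "continuous_on UNIV (\<lambda>p. pos_powr a (fst p))"
      by (rule continuous_on_compose2[OF contx[of UNIV]], simp_all add: continuous_on_snd continuous_on_id)
         (rule continuous_on_compose2[OF contk], simp_all add: continuous_on_snd continuous_on_id,
          rule continuous_on_compose2[OF continuous_pos_powr[OF a]], simp_all add: continuous_on_fst continuous_on_id)
    then show ?thesis unfolding F_def split_def by (intro continuous_intros)
  qed
  have normF: "norm (F r v) = (pos_powr a r * exp (- (pi * sqrt 2 / 2 * r))) * norm (k v)" for r v
  proof -
    have "Re (- (2 * of_real pi * se * x v * of_real r)) = - (pi * sqrt 2 / 2 * r)"
      using Re[of v] by simp
    then show ?thesis by (simp only: F_def norm_mult norm_exp_eq_Re norm_of_real abs_of_nonneg[OF pos_powr_simps(3)])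
  qed
  have F_inner: "(\<lambda>v. F r v) = (\<lambda>v. of_real (pos_powr a r) * (exp (- (of_real (pi * real 1) * \<i> * (x v)\<^sup>2) + 2 * of_real pi * \<i> * (\<i> * of_real r * se) * x v) / sin_den (x v) * se))" for r
  proof
    fix v
    have e: "2 * of_real pi * \<i> * (\<i> * of_real r * se) * x v = - (2 * of_real pi * se * x v * of_real r)"
      by (simp add: mult.assoc mult.left_commute)
    show "F r v = of_real (pos_powr a r) * (exp (- (of_real (pi * real 1) * \<i> * (x v)\<^sup>2) + 2 * of_real pi * \<i> * (\<i> * of_real r * se) * x v) / sin_den (x v) * se)"
      unfolding F_def k_def exp_add e by simp
  qed
  have intF: "integrable (lborel \<Otimes>\<^sub>M lborel) (case_prod F)"
  proof (rule lborel_pair.Fubini_integrable)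
    show "case_prod F \<in> borel_measurable (lborel \<Otimes>\<^sub>M lborel)"
      using borel_measurable_continuous_onI[OF contF] by (simp add: lborel_prod)
    have "integrable lborel (\<lambda>r. norm (complex_of_real (pos_powr a r) * exp (- (of_real (pi * sqrt 2 / 2) * of_real r))))"
      by (intro integrable_norm Gamma_laplace_integrable a) simp
    also have "(\<lambda>r. norm (complex_of_real (pos_powr a r) * exp (- (of_real (pi * sqrt 2 / 2) * of_real r)))) = (\<lambda>r. pos_powr a r * exp (- (pi * sqrt 2 / 2 * r)))"
      by (simp add: norm_mult pos_powr_simps)
    finally show "integrable lborel (\<lambda>r. \<integral>v. norm (case_prod F (r, v)) \<partial>lborel)"
      unfolding prod.case normF by (simp only: integral_mult_right_zero integrable_mult_left)
    show "AE r in lborel. integrable lborel (\<lambda>v. case_prod F (r, v))"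
    proof (rule AE_I2)
      fix r :: real
      show "integrable lborel (\<lambda>v. case_prod F (r, v))"
        unfolding prod.case F_inner x_def
        by (intro integrable_mult_right integrable_mult_left mordell_integrable not_Ints_half) simp
    qed
  qed
  have M: "(\<integral>v. F r v \<partial>lborel) = of_real (pos_powr a r) * mordell 1 (1/2) (\<i> * of_real r * se)" for r
    unfolding F_inner mordell_def line_integral_def x_def by (rule integral_mult_right_zero)
  show "integrable lborel (\<lambda>r. of_real (pos_powr a r) * mordell 1 (1/2) (\<i> * of_real r * se))"
    using lborel_pair.integrable_fst[OF intF] unfolding M .
  have "(\<integral>r. of_real (pos_powr a r) * mordell 1 (1/2) (\<i> * of_real r * se) \<partial>lborel) = (\<integral>v. (\<integral>r. F r v \<partial>lborel) \<partial>lborel)"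
    unfolding M[symmetric] by (rule lborel_pair.Fubini_integral[OF intF, symmetric])
  also have "\<dots> = (\<integral>v. G * (riemann_kernel (of_real (a + 1)) (x v) * se) \<partial>lborel)"
  proof (rule Bochner_Integration.integral_cong)
    fix v :: real
    have "(\<integral>r. F r v \<partial>lborel) = (Gamma (of_real (a + 1)) * exp (- of_real (a + 1) * Ln (2 * of_real pi * se * x v))) * k v"
      unfolding F_def using Gamma_laplace[OF a, of "2 * of_real pi * se * x v"] Re[of v] by (simp only: integral_mult_left_zero) simp
    also have "Ln (2 * of_real pi * se * x v) = of_real (ln (2 * pi)) + (Ln (x v) - \<i> * of_real (pi / 4))"
    proof -
      have pos: "Re (x v) + Im (x v) > 0" by (simp add: x_def se_simps)
      have "se * x v \<noteq> 0" using pos by (auto simp: se_simps)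
      then have "Ln (of_real (2 * pi) * (se * x v)) = Ln (of_real (2 * pi)) + Ln (se * x v)"
        by (intro Ln_times_of_real) auto
      then show ?thesis using Ln_of_real[of "2 * pi"] Ln_se_mult[OF pos] by (simp add: mult.assoc)
    qed
    also have "- of_real (a + 1) * (of_real (ln (2 * pi)) + (Ln (x v) - \<i> * of_real (pi / 4)))
       = - of_real (a + 1) * of_real (ln (2 * pi)) + \<i> * of_real (pi * (a + 1) / 4) + - of_real (a + 1) * Ln (x v)"
      by (simp add: field_simps)
    also have "Gamma (of_real (a + 1)) * exp (- of_real (a + 1) * of_real (ln (2 * pi)) + \<i> * of_real (pi * (a + 1) / 4) + - of_real (a + 1) * Ln (x v)) * k v
       = G * (riemann_kernel (of_real (a + 1)) (x v) * se)"
      unfolding exp_add G_def k_def riemann_kernel_def by simp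
    finally show "(\<integral>r. F r v \<partial>lborel) = G * (riemann_kernel (of_real (a + 1)) (x v) * se)" .
  qed simp
  also have "\<dots> = G * riemann_aux_bar (1/2) (of_real (a + 1))"
    unfolding riemann_aux_bar_def line_integral_def x_def by (rule integral_mult_right_zero)
  finally show "(\<integral>r. of_real (pos_powr a r) * mordell 1 (1/2) (\<i> * of_real r * se) \<partial>lborel) = G * riemann_aux_bar (1/2) (of_real (a + 1))" .
qed

section \<open>Moving the line to the origin\<close>

lemma sin_den_minus: "sin_den (- x) = - sin_den x"
  by (simp add: sin_den_def)

text \<open>The singularity at 0 is removable, and c <= 1/2 keeps all other integers out of the
  compact parallelogram; hence a bound uniform down to c = 0.\<close>

lemma bounded_quotient_sin_den:
  "\<exists>B>0. \<forall>c t. 0 \<le> c \<longrightarrow> c \<le> 1/2 \<longrightarrow> \<bar>t\<bar> \<le> 1 \<longrightarrow>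
     norm ((of_real c + of_real t * se) / sin_den (of_real c + of_real t * se)) \<le> B"
proof -
  define g where "g = (\<lambda>z. if z = 0 then 1 / (2 * of_real pi * \<i>) else z / sin_den z)"
  define K where "K = (\<lambda>(c, t). of_real c + of_real t * se) ` ({0..1/2} \<times> {-1..1})"
  have "compact K"
    unfolding K_def split_def
    by (intro compact_continuous_image compact_Times compact_Icc continuous_intros)
  have nz: "sin_den z \<noteq> 0" if "z \<in> K" "z \<noteq> 0" for z
  proof
    assume "sin_den z = 0"
    then obtain n where n: "z = of_int n" by (auto simp: sin_den_eq_0_iff elim: Ints_cases)
    from \<open>z \<in> K\<close> obtain c t where ct: "z = of_real c + of_real t * se" "0 \<le> c" "c \<le> 1/2"
      by (auto simp: K_def)
    from n have "Im z = 0" by simp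
    then have "t = 0" unfolding ct by (simp add: se_simps)
    then have "real_of_int n = c" using n ct by (simp add: complex_eq_iff)
    then have "0 \<le> n" "n < 1" using ct by linarith+
    then have "n = 0" by simp
    then show False using n that by simp
  qed
  have "continuous_on K g"
  proof (rule continuous_at_imp_continuous_on, rule ballI)
    fix z assume z: "z \<in> K"
    show "isCont g z"
    proof (cases "z = 0")
      case True
      have "((\<lambda>z. z / sin_den z) \<longlongrightarrow> 1 / (2 * of_real pi * \<i>)) (at 0)"
        using sin_den_residue[of 0] by simp
      then have "(g \<longlongrightarrow> 1 / (2 * of_real pi * \<i>)) (at 0)"
        by (rule Lim_transform_eventually) (auto simp: g_def eventually_at_filter)
      then show ?thesis using True by (simp add: isCont_def g_def)
    next
      case False
      have "isCont (\<lambda>z. z / sin_den z) z"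
        unfolding sin_den_def using nz[OF z False] by (intro continuous_intros) (simp add: sin_den_def)
      moreover have "\<forall>\<^sub>F w in nhds z. g w = w / sin_den w"
        using t1_space_nhds[OF False] by eventually_elim (simp add: g_def)
      ultimately show ?thesis using isCont_cong by fastforce
    qed
  qed
  then have "bounded (g ` K)" using \<open>compact K\<close> by (intro compact_imp_bounded compact_continuous_image)
  then obtain B where B: "B > 0" "\<And>z. z \<in> K \<Longrightarrow> norm (g z) \<le> B" by (auto simp: bounded_pos)
  show ?thesis
  proof (intro exI[of _ B] conjI allI impI B)
    fix c t :: real assume ct: "0 \<le> c" "c \<le> 1/2" "\<bar>t\<bar> \<le> 1"
    let ?x = "of_real c + of_real t * se"
    have "?x \<in> K" unfolding K_def using ct by (intro image_eqI[of _ _ "(c, t)"]) auto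
    then show "norm (?x / sin_den ?x) \<le> B" using B(2)[of ?x] B(1) by (cases "?x = 0") (auto simp: g_def)
  qed
qed

text \<open>Writing x^a / \<open>sin_den\<close> x as x^(a - 1) times x / \<open>sin_den\<close> x
  spends one power of x, available as a > 1, on the pole at 0. The majorant is independent of c, as
  dominated convergence requires.\<close>

lemma riemann_kernel_majorant:
  assumes a: "a > 1"
  shows "\<exists>B>0. \<forall>c t. 0 \<le> c \<longrightarrow> c \<le> 1/2 \<longrightarrow>
     norm (riemann_kernel (of_real (- a)) (of_real c + of_real t * se)) \<le> B * exp ((a + pi) * \<bar>t\<bar> - pi * t\<^sup>2 + a)"
proof -
  obtain B where B: "B > 0" "\<And>c t. 0 \<le> c \<Longrightarrow> c \<le> 1/2 \<Longrightarrow> \<bar>t\<bar> \<le> 1 \<Longrightarrow>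
     norm ((of_real c + of_real t * se) / sin_den (of_real c + of_real t * se)) \<le> B"
    using bounded_quotient_sin_den by blast
  show ?thesis
  proof (intro exI[of _ "max B 1"] conjI allI impI)
    fix c t :: real assume c: "0 \<le> c" "c \<le> 1/2"
    define x where "x = of_real c + of_real t * se"
    have gauss: "norm (exp (- (of_real pi * \<i> * x\<^sup>2))) \<le> exp (pi * \<bar>t\<bar> - pi * t\<^sup>2)"
      using norm_gauss_line_le[of 1 c "1/2" t 0] c by (simp add: x_def)
    have nx: "norm x \<le> exp (\<bar>t\<bar> + 1)"
      using norm_line_le[of c t] c exp_ge_add_one_self[of "\<bar>t\<bar> + 1"] unfolding x_def by linarith
    have "norm (exp (of_real a * Ln x)) / norm (sin_den x) \<le> max B 1 * exp (a * (\<bar>t\<bar> + 1))"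
    proof (cases "x = 0")
      case True
      \<comment> \<open>Here the denominator is 0 and the quotient is 0 by convention.\<close>
      then show ?thesis by (simp add: sin_den_def)
    next
      case False
      have pw: "norm (exp (of_real a * Ln x)) = norm x powr a" using False by (simp add: powr_def)
      have le: "norm x powr b \<le> exp (b * (\<bar>t\<bar> + 1))" if "b \<ge> 0" for b
      proof -
        have "norm x powr b \<le> exp (\<bar>t\<bar> + 1) powr b" using nx that by (intro powr_mono2) auto
        then show ?thesis by (simp add: powr_def mult.commute)
      qed
      show ?thesis
      proof (cases "\<bar>t\<bar> \<le> 1")
        case True
        have "norm x powr a = norm x powr (a - 1) * norm x" using False by (simp add: powr_diff)
        then have "norm (exp (of_real a * Ln x)) / norm (sin_den x) = norm x powr (a - 1) * norm (x / sin_den x)"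
          unfolding pw by (simp add: norm_divide)
        also have "\<dots> \<le> exp ((a - 1) * (\<bar>t\<bar> + 1)) * B"
          using B(2)[OF c True] a by (intro mult_mono le) (auto simp: x_def)
        also have "\<dots> \<le> exp (a * (\<bar>t\<bar> + 1)) * max B 1"
          using B(1) by (intro mult_mono) (auto simp: algebra_simps)
        finally show ?thesis by (simp only: mult.commute)
      next
        case False
        have "norm (exp (of_real a * Ln x)) / norm (sin_den x) \<le> exp (a * (\<bar>t\<bar> + 1)) / 1"
          unfolding pw using False a norm_sin_den_line_ge[of t c]
          by (intro frac_le le) (auto simp: x_def)
        also have "\<dots> \<le> max B 1 * exp (a * (\<bar>t\<bar> + 1))" by simp
        finally show ?thesis .
      qed
    qed
    then have "norm (riemann_kernel (of_real (- a)) x) \<le> (max B 1 * exp (a * (\<bar>t\<bar> + 1))) * exp (pi * \<bar>t\<bar> - pi * t\<^sup>2)"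
      using mult_mono[OF _ gauss, of "norm (exp (of_real a * Ln x)) / norm (sin_den x)" "max B 1 * exp (a * (\<bar>t\<bar> + 1))"]
      by (simp add: riemann_kernel_def norm_divide norm_mult)
    also have "\<dots> = max B 1 * exp ((a + pi) * \<bar>t\<bar> - pi * t\<^sup>2 + a)"
      by (simp add: algebra_simps flip: exp_add)
    finally show "norm (riemann_kernel (of_real (- a)) (of_real c + of_real t * se)) \<le> max B 1 * exp ((a + pi) * \<bar>t\<bar> - pi * t\<^sup>2 + a)"
      unfolding x_def .
  qed (use B in auto)
qed

text \<open>The line through 0 consists of two rays, of argument -pi/4 for t > 0 and 3 pi/4 for t <
  0; the minus sign is the oddness of \<open>sin_den\<close>.\<close>

lemma riemann_kernel_ray:
  assumes a: "a > 0"
  defines "p \<equiv> \<lambda>r. of_real (pos_powr a r) * (exp (- of_real (pi * r\<^sup>2)) / sin_den (of_real r * se))"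
  shows "riemann_kernel (of_real (- a)) (of_real t * se) * se
     = se * exp (- (\<i> * of_real (pi * a / 4))) * p t - se * exp (\<i> * of_real (3 * pi * a / 4)) * p (- t)"
proof -
  have g: "exp (- (of_real pi * \<i> * (of_real t * se)\<^sup>2)) = exp (- of_real (pi * t\<^sup>2))"
  proof -
    have "(of_real t * se)\<^sup>2 = - (\<i> * of_real (t\<^sup>2))" by (simp add: power_mult_distrib se_simps mult.commute)
    then have "- (of_real pi * \<i> * (of_real t * se)\<^sup>2) = - of_real (pi * t\<^sup>2)" by (simp add: mult.assoc)
    then show ?thesis by (simp only:)
  qed
  have pw: "exp (of_real a * (of_real (ln r) + w)) = of_real (pos_powr a r) * exp (of_real a * w)" if "r > 0" for r and w :: complex
    using that by (simp add: pos_powr_simps powr_def distrib_left exp_add exp_of_real[symmetric])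
  consider "t > 0" | "t = 0" | "t < 0" by linarith
  then show ?thesis
  proof cases
    case 1
    have "Ln (of_real t * se) = of_real (ln t) + - (\<i> * of_real (pi / 4))"
      using 1 by (subst Ln_times_of_real) (auto simp: se_simps Ln_se Ln_of_real)
    then have "exp (of_real a * Ln (of_real t * se)) = of_real (pos_powr a t) * exp (- (\<i> * of_real (pi * a / 4)))"
      using pw[OF 1, of "- (\<i> * of_real (pi / 4))"] by (simp add: mult_ac)
    moreover have "p (- t) = 0" using 1 by (simp add: p_def pos_powr_simps)
    moreover have "p t = of_real (pos_powr a t) * (exp (- of_real (pi * t\<^sup>2)) / sin_den (of_real t * se))" by (simp only: p_def)
    ultimately show ?thesis unfolding riemann_kernel_def g by simp
  next
    case 2
    then show ?thesis by (simp add: riemann_kernel_def p_def pos_powr_simps sin_den_def)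
  next
    case 3
    have Lm: "Ln (- se) = \<i> * of_real (3 * pi / 4)"
    proof (rule Ln_unique)
      have "\<i> * of_real (3 * pi / 4) = \<i> * of_real (- (pi / 4)) + of_real pi * \<i>" by (simp add: field_simps)
      then show "exp (\<i> * of_real (3 * pi / 4)) = - se" unfolding se_def cis_conv_exp by (simp only: exp_add exp_pi_i) simp
    next
      have "- pi < 3 * pi / 4" "3 * pi / 4 \<le> pi" using pi_gt_zero by linarith+
      then show "- pi < Im (\<i> * of_real (3 * pi / 4))" "Im (\<i> * of_real (3 * pi / 4)) \<le> pi" by simp_all
    qed
    have m: "of_real t * se = of_real (- t) * (- se)" by simp
    have "Ln (of_real t * se) = of_real (ln (- t)) + \<i> * of_real (3 * pi / 4)"
      unfolding m Lm[symmetric] using 3 by (subst Ln_times_of_real) (auto simp: se_simps Ln_of_real simp flip: of_real_minus)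
    then have e: "exp (of_real a * Ln (of_real t * se)) = of_real (pos_powr a (- t)) * exp (\<i> * of_real (3 * pi * a / 4))"
      using pw[of "- t" "\<i> * of_real (3 * pi / 4)"] 3 by (simp add: mult_ac)
    have s: "sin_den (of_real (- t) * se) = - sin_den (of_real t * se)"
      using sin_den_minus[of "of_real t * se"] by simp
    have "p t = 0" using 3 by (simp add: p_def pos_powr_simps)
    moreover have "p (- t) = of_real (pos_powr a (- t)) * (exp (- of_real (pi * t\<^sup>2)) / - sin_den (of_real t * se))"
      by (simp only: p_def s power2_minus)
    ultimately show ?thesis unfolding riemann_kernel_def g using e by simp
  qed
qed

text \<open>The value does not depend on the line, so dominated convergence moves it to the line
  through 0, where both rays carry the same integral \<open>W\<close>.\<close>

lemma riemann_aux_bar_neg: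
  assumes a: "a > 1"
  defines "W \<equiv> \<integral>r. of_real (pos_powr a r) * (exp (- of_real (pi * r\<^sup>2)) / sin_den (of_real r * se)) \<partial>lborel"
  shows "riemann_aux_bar (1/2) (of_real (- a))
     = se * (exp (- (\<i> * of_real (pi * a / 4))) - exp (\<i> * of_real (3 * pi * a / 4))) * W"
proof -
  define p where "p = (\<lambda>r. of_real (pos_powr a r) * (exp (- of_real (pi * r\<^sup>2)) / sin_den (of_real r * se)))"
  define \<alpha> where "\<alpha> = se * exp (- (\<i> * of_real (pi * a / 4)))"
  define \<beta> where "\<beta> = se * exp (\<i> * of_real (3 * pi * a / 4))"
  define c where "c = (\<lambda>n. 1 / (real n + 2))"
  define f where "f = (\<lambda>n t. riemann_kernel (of_real (- a)) (of_real (c n) + of_real t * se) * se)"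
  define f0 where "f0 = (\<lambda>t. riemann_kernel (of_real (- a)) (of_real t * se) * se)"
  have a0: "a > 0" using a by simp
  have f0_eq: "f0 t = \<alpha> * p t - \<beta> * p (- t)" for t
    unfolding f0_def \<alpha>_def \<beta>_def p_def by (rule riemann_kernel_ray[OF a0])
  have \<alpha>0: "\<alpha> \<noteq> 0" by (simp add: \<alpha>_def se_simps)
  have c: "0 < c n" "c n \<le> 1/2" "c n < 1" for n by (auto simp: c_def field_simps)
  have clim: "c \<longlonglongrightarrow> 0"
  proof -
    have "(\<lambda>n. 1 / real (n + 2)) \<longlonglongrightarrow> 0" by (intro LIMSEQ_ignore_initial_segment lim_1_over_n)
    then show ?thesis by (simp add: c_def add.commute)
  qed
  obtain B where B: "\<And>c t. 0 \<le> c \<Longrightarrow> c \<le> 1/2 \<Longrightarrow>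
     norm (riemann_kernel (of_real (- a)) (of_real c + of_real t * se)) \<le> B * exp ((a + pi) * \<bar>t\<bar> - pi * t\<^sup>2 + a)"
    using riemann_kernel_majorant[OF a] by blast
  have meas_p: "p \<in> borel_measurable borel"
  proof -
    have "(\<lambda>r. complex_of_real (pos_powr a r)) \<in> borel_measurable borel"
      by (intro borel_measurable_continuous_onI continuous_intros continuous_pos_powr a0)
    moreover have "(\<lambda>r. sin_den (of_real r * se)) \<in> borel_measurable borel"
      by (intro borel_measurable_continuous_onI continuous_intros)
    moreover have "(\<lambda>r. exp (- of_real (pi * r\<^sup>2)) :: complex) \<in> borel_measurable borel"
      by (intro borel_measurable_continuous_onI continuous_intros)
    ultimately show ?thesis unfolding p_def by (intro borel_measurable_times borel_measurable_divide)
  qed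
  have meas_f0: "f0 \<in> borel_measurable lborel"
    unfolding f0_eq[abs_def] using meas_p by measurable
  have meas_f: "f n \<in> borel_measurable lborel" for n
  proof -
    have "c n \<notin> \<int>" using c[of n] by (auto elim!: Ints_cases)
    then have "continuous_on UNIV (f n)"
      unfolding f_def by (intro continuous_intros continuous_riemann_kernel c)
    then show ?thesis using borel_measurable_continuous_onI by simp
  qed
  have intB: "integrable lborel (\<lambda>t. B * exp ((a + pi) * \<bar>t\<bar> - pi * t\<^sup>2 + a))"
  proof -
    have "(\<lambda>t. B * exp ((a + pi) * \<bar>t\<bar> - pi * t\<^sup>2 + a)) = (\<lambda>t. B * exp (a + (a + pi) * \<bar>t\<bar> - pi * t\<^sup>2))"
      by (simp add: algebra_simps)
    then show ?thesis by (simp only:) (intro integrable_mult_right exp_quadratic_integrable pi_gt_zero)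
  qed
  have lim: "(\<lambda>n. f n t) \<longlonglongrightarrow> f0 t" if "t \<noteq> 0" for t
  proof -
    have Im: "Im (of_real t * se) \<noteq> 0" using that by (simp add: se_simps)
    have key: "z \<notin> \<real>\<^sub>\<le>\<^sub>0" "sin_den z \<noteq> 0" if "Im z \<noteq> 0" for z
      using that by (auto simp: complex_nonpos_Reals_iff sin_den_eq_0_iff elim: Ints_cases)
    note cut = key(1)[OF Im] and nz = key(2)[OF Im]
    have "isCont (riemann_kernel (of_real (- a))) (of_real t * se)"
      unfolding riemann_kernel_def[abs_def] sin_den_def
      by (intro continuous_intros) (use cut nz in \<open>auto simp: sin_den_def\<close>)
    moreover have "(\<lambda>n. of_real (c n) + of_real t * se) \<longlonglongrightarrow> of_real t * se"
      using tendsto_add[OF tendsto_of_real[OF clim, where 'a = complex] tendsto_const[of "of_real t * se"]] by simp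
    ultimately have "(\<lambda>n. riemann_kernel (of_real (- a)) (of_real (c n) + of_real t * se)) \<longlonglongrightarrow> riemann_kernel (of_real (- a)) (of_real t * se)"
      by (rule isCont_tendsto_compose)
    from tendsto_mult[OF this tendsto_const[of se]] show ?thesis unfolding f_def f0_def .
  qed
  have AElim: "AE t in lborel. (\<lambda>n. f n t) \<longlonglongrightarrow> f0 t"
    using AE_lborel_singleton[of "0 :: real"] by eventually_elim (rule lim)
  have AEb: "AE t in lborel. norm (f n t) \<le> B * exp ((a + pi) * \<bar>t\<bar> - pi * t\<^sup>2 + a)" for n
  proof (rule AE_I2)
    fix t
    have "norm (f n t) = norm (riemann_kernel (of_real (- a)) (of_real (c n) + of_real t * se))"
      by (simp only: f_def norm_mult se_simps mult_1_right)
    also have "\<dots> \<le> B * exp ((a + pi) * \<bar>t\<bar> - pi * t\<^sup>2 + a)"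
      using B[of "c n" t] c[of n] by simp
    finally show "norm (f n t) \<le> B * exp ((a + pi) * \<bar>t\<bar> - pi * t\<^sup>2 + a)" .
  qed
  note dom = meas_f0 meas_f intB AElim AEb
  have "(\<lambda>n. \<integral>t. f n t \<partial>lborel) \<longlonglongrightarrow> (\<integral>t. f0 t \<partial>lborel)" by (rule integral_dominated_convergence[OF dom])
  moreover have "(\<integral>t. f n t \<partial>lborel) = riemann_aux_bar (1/2) (of_real (- a))" for n
    using riemann_aux_bar_eq_half[OF c(1,3)[of n], of "of_real (- a)"]
    by (simp only: riemann_aux_bar_def line_integral_def f_def)
  ultimately have main: "riemann_aux_bar (1/2) (of_real (- a)) = (\<integral>t. f0 t \<partial>lborel)"
    using LIMSEQ_unique[OF tendsto_const] by simp
  have intf0: "integrable lborel f0" by (rule integrable_dominated_convergence[OF dom])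
  \<comment> \<open>Integrability on a single ray is read off from \<open>f0\<close> by restricting
    to t >= 0, where the other summand vanishes.\<close>
  have intp: "integrable lborel p"
  proof -
    have "integrable lborel (\<lambda>t. inverse \<alpha> * (indicator {0..} t *\<^sub>R f0 t))"
      by (intro integrable_mult_right integrable_mult_indicator intf0) auto
    moreover have "inverse \<alpha> * (indicator {0..} t *\<^sub>R f0 t) = p t" for t
    proof (cases "t \<ge> 0")
      case True
      then have "p (- t) = 0" by (simp add: p_def pos_powr_simps)
      then show ?thesis using True \<alpha>0 by (simp add: f0_eq)
    qed (simp add: p_def pos_powr_simps)
    ultimately show ?thesis by simp
  qed
  have intp': "integrable lborel (\<lambda>t. p (- t))"
    using lborel_integrable_real_affine[OF intp, of "-1" 0] by simp
  have refl: "(\<integral>t. p (- t) \<partial>lborel) = (\<integral>t. p t \<partial>lborel)"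
    using lborel_integral_real_affine[of "-1" p 0] by simp
  have "(\<integral>t. f0 t \<partial>lborel) = (\<integral>t. \<alpha> * p t \<partial>lborel) - (\<integral>t. \<beta> * p (- t) \<partial>lborel)"
    unfolding f0_eq by (intro Bochner_Integration.integral_diff integrable_mult_right intp intp')
  also have "\<dots> = (\<alpha> - \<beta>) * W"
    unfolding integral_mult_right_zero refl by (simp add: W_def p_def left_diff_distrib)
  finally show ?thesis unfolding main \<alpha>_def \<beta>_def by (simp only: right_diff_distrib)
qed

section \<open>The functional equation on the real axis\<close>

lemma cnj_se: "cnj se = \<i> * se"
  by (simp add: complex_eq_iff se_simps)

text \<open>s > 2 makes a = s - 1 > 1, as the passage to the origin demands. Conjugation carries the
  ray of \<open>W\<close> to the ray of \<open>ray_split\<close>, which yields the series and the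
  Mordell part; the phases of the two rays and of \<open>G\<close> combine to 2 cos (pi
  s/2).\<close>

lemma riemann_aux_functional_real:
  assumes s: "s > 2"
  shows "riemann_aux (1/2) (of_real (1 - s)) =
     2 * cos (of_real (pi * s / 2)) * Gamma (of_real s) * exp (- of_real s * of_real (ln (2 * pi)))
       * ((\<Sum>n. 1 / of_nat (Suc n) powr of_real s) - riemann_aux_bar (1/2) (of_real s))"
proof -
  define a where "a = s - 1"
  have a: "a > 1" "a > 0" and s_eq: "s = a + 1" using s by (auto simp: a_def)
  define D :: complex where "D = (\<Sum>n. 1 / of_nat (Suc n) powr of_real s)"
  define G where "G = (Gamma (of_real (a + 1)) * exp (- of_real (a + 1) * of_real (ln (2 * pi))) * exp (\<i> * of_real (pi * (a + 1) / 4)) :: complex)"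
  define g where "g = (\<lambda>r. exp (of_real pi * \<i> * (\<i> * of_real r * se)) / sin_den (\<i> * of_real r * se))"
  define W where "W = (\<integral>r. of_real (pos_powr a r) * (exp (- of_real (pi * r\<^sup>2)) / sin_den (of_real r * se)) \<partial>lborel)"
  have ptw: "cnj (of_real (pos_powr a r) * (exp (- of_real (pi * r\<^sup>2)) / sin_den (of_real r * se)))
      = - (of_real (pos_powr a r) * mordell 1 (1/2) (\<i> * of_real r * se) + of_real (pos_powr a r) * g r)" for r
  proof (cases "r > 0")
    case True
    have "cnj (sin_den (of_real r * se)) = - sin_den (cnj (of_real r * se))" by (simp only: sin_den_cnj minus_minus)
    also have "cnj (of_real r * se) = \<i> * of_real r * se" by (simp add: cnj_se)
    finally have sd: "cnj (sin_den (of_real r * se)) = - sin_den (\<i> * of_real r * se)" .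
    have "cnj (exp (- of_real (pi * r\<^sup>2))) = exp (- of_real (pi * r\<^sup>2))" by (simp add: exp_cnj)
    then have "cnj (of_real (pos_powr a r) * (exp (- of_real (pi * r\<^sup>2)) / sin_den (of_real r * se)))
      = - (of_real (pos_powr a r) * (exp (- of_real (pi * r\<^sup>2)) / sin_den (\<i> * of_real r * se)))"
      by (simp only: complex_cnj_mult complex_cnj_divide sd complex_cnj_complex_of_real minus_divide_right[symmetric] mult_minus_right)
    then show ?thesis unfolding ray_split(1)[OF True] g_def by (simp only: distrib_left)
  qed (simp add: pos_powr_simps)
  have "cnj W = (\<integral>r. cnj (of_real (pos_powr a r) * (exp (- of_real (pi * r\<^sup>2)) / sin_den (of_real r * se))) \<partial>lborel)"
    unfolding W_def by (rule integral_bounded_linear'[OF bounded_linear_cnj bounded_linear_cnj, symmetric]) simp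
  also have "\<dots> = (\<integral>r. - (of_real (pos_powr a r) * mordell 1 (1/2) (\<i> * of_real r * se) + of_real (pos_powr a r) * g r) \<partial>lborel)"
    by (simp only: ptw)
  also have "\<dots> = - (G * riemann_aux_bar (1/2) (of_real s) + - (G * D))"
  proof -
    have "integrable lborel (\<lambda>r. of_real (pos_powr a r) * g r)"
      unfolding g_def by (rule ray_series_integral(1)[OF a(2)])
    moreover have "(\<integral>r. of_real (pos_powr a r) * g r \<partial>lborel) = - (G * D)"
      unfolding g_def G_def D_def s_eq by (rule ray_series_integral(2)[OF a(2)])
    moreover have "(\<integral>r. of_real (pos_powr a r) * mordell 1 (1/2) (\<i> * of_real r * se) \<partial>lborel) = G * riemann_aux_bar (1/2) (of_real s)"
      unfolding G_def s_eq by (rule ray_mordell_integral(2)[OF a(2)])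
    ultimately show ?thesis
      using ray_mordell_integral(1)[OF a(2)]
      by (simp only: integral_minus Bochner_Integration.integral_add)
  qed
  finally have W: "cnj W = G * (D - riemann_aux_bar (1/2) (of_real s))" by (simp add: algebra_simps)
  have "riemann_aux (1/2) (of_real (1 - s)) = cnj (riemann_aux_bar (1/2) (of_real (- a)))"
    using riemann_aux_eq_cnj[of "1/2" "of_real (1 - s)"] by (simp add: a_def)
  also have "\<dots> = cnj (se * (exp (- (\<i> * of_real (pi * a / 4))) - exp (\<i> * of_real (3 * pi * a / 4)))) * cnj W"
    unfolding riemann_aux_bar_neg[OF a(1)] W_def[symmetric] by simp
  also have "cnj (se * (exp (- (\<i> * of_real (pi * a / 4))) - exp (\<i> * of_real (3 * pi * a / 4)))) =
      exp (\<i> * of_real (pi / 4)) * (exp (\<i> * of_real (pi * a / 4)) - exp (- (\<i> * of_real (3 * pi * a / 4))))"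
    by (simp add: se_def cis_cnj cis_conv_exp exp_cnj)
  also have "exp (\<i> * of_real (pi / 4)) * (exp (\<i> * of_real (pi * a / 4)) - exp (- (\<i> * of_real (3 * pi * a / 4)))) * cnj W
     = (2 * cos (of_real (pi * s / 2))) * Gamma (of_real s) * exp (- of_real s * of_real (ln (2 * pi))) * (D - riemann_aux_bar (1/2) (of_real s))"
  proof -
    have e1: "\<i> * of_real (pi / 4) + \<i> * of_real (pi * a / 4) + \<i> * of_real (pi * (a + 1) / 4) = \<i> * of_real (pi * s / 2)"
      by (simp add: s_eq field_simps)
    have e2: "\<i> * of_real (pi / 4) + - (\<i> * of_real (3 * pi * a / 4)) + \<i> * of_real (pi * (a + 1) / 4) = - (\<i> * of_real (pi * s / 2)) + of_real pi * \<i>"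
      by (simp add: s_eq field_simps)
    have "exp (\<i> * of_real (pi / 4)) * (exp (\<i> * of_real (pi * a / 4)) - exp (- (\<i> * of_real (3 * pi * a / 4)))) * exp (\<i> * of_real (pi * (a + 1) / 4))
      = exp (\<i> * of_real (pi / 4) + \<i> * of_real (pi * a / 4) + \<i> * of_real (pi * (a + 1) / 4))
        - exp (\<i> * of_real (pi / 4) + - (\<i> * of_real (3 * pi * a / 4)) + \<i> * of_real (pi * (a + 1) / 4))"
      unfolding exp_add by (simp only: right_diff_distrib left_diff_distrib)
    also have "\<dots> = 2 * cos (of_real (pi * s / 2))"
      unfolding e1 e2 unfolding exp_add exp_pi_i cos_exp_eq by simp
    finally have "2 * cos (of_real (pi * s / 2)) = exp (\<i> * of_real (pi / 4)) * (exp (\<i> * of_real (pi * a / 4)) - exp (- (\<i> * of_real (3 * pi * a / 4)))) * exp (\<i> * of_real (pi * (a + 1) / 4))" ..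
    then show ?thesis unfolding W G_def s_eq[symmetric] by (simp only: mult_ac)
  qed
  finally show ?thesis unfolding D_def .
qed

text \<open>Duplication splits Gamma (s) into Gamma (s/2) Gamma (s/2 + 1/2), and reflection pairs
  the second factor with Gamma ((1 - s)/2), cancelling the cosine. The interval 2 < s < 3 keeps that
  cosine nonzero.\<close>

lemma zeta_chi_real:
  assumes s: "2 < s" "s < 3"
  shows "zeta_chi (of_real s) * (2 * cos (of_real (pi * s / 2)) * Gamma (of_real s) * exp (- of_real s * of_real (ln (2 * pi)))) = 1"
proof -
  let ?s = "of_real s :: complex"
  \<comment> \<open>All powers of 2 and pi are written through these logarithms, so that in the end
    only a linear identity between exponents remains.\<close>
  define l2 lp where "l2 = ln (2::real)" and "lp = ln pi"
  have nonint: "x \<notin> \<int>\<^sub>\<le>\<^sub>0" if "Re x > 0" for x :: complex using that by (auto elim!: nonpos_Ints_cases)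
  have dup: "Gamma (?s / 2) * Gamma (?s / 2 + 1/2) = exp ((1 - ?s) * of_real l2) * of_real (sqrt pi) * Gamma ?s"
    using Gamma_legendre_duplication[of "?s / 2"] nonint[of "?s / 2"] nonint[of "?s / 2 + 1/2"] s by (simp add: l2_def)
  have refl: "Gamma ((1 - ?s) / 2) * Gamma (?s / 2 + 1/2) = of_real pi / cos (of_real (pi * s / 2))"
  proof -
    have "1 - (1 - ?s) / 2 = ?s / 2 + 1/2" by (simp add: field_simps)
    moreover have "of_real pi * ((1 - ?s) / 2) = of_real (pi / 2) - of_real (pi * s / 2)" by (simp add: field_simps)
    then have "sin (of_real pi * ((1 - ?s) / 2)) = cos (of_real (pi * s / 2))"
      by (simp only: sin_diff sin_of_real cos_of_real sin_pi_half cos_pi_half) simp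
    ultimately show ?thesis using Gamma_reflection_complex[of "(1 - ?s) / 2"] by simp
  qed
  have G0: "Gamma (?s / 2) \<noteq> 0" by (rule Gamma_nonzero) (use nonint[of "?s/2"] s in auto)
  have "cos (pi * s / 2) \<noteq> 0"
  proof
    assume "cos (pi * s / 2) = 0"
    then obtain i :: int where i: "odd i" "pi * s / 2 = of_int i * (pi / 2)" by (auto simp: cos_zero_iff_int)
    then have "s = of_int i" by simp
    then have "2 < i" "i < 3" using s by linarith+
    then show False by simp
  qed
  then have C0: "cos (of_real (pi * s / 2)) \<noteq> (0 :: complex)" by (simp add: cos_of_real del: of_real_mult of_real_divide)
  have spi: "of_real (sqrt pi) = (exp (of_real (lp / 2)) :: complex)"
    by (simp add: lp_def exp_of_real ln_sqrt[symmetric] del: of_real_divide)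
  have pie: "(of_real pi :: complex) = exp (of_real lp)" by (simp add: lp_def exp_of_real)
  have two: "x * 2 = x * exp (of_real l2)" for x :: complex by (simp add: l2_def exp_of_real)
  have GS: "Gamma ?s = Gamma (?s / 2) * Gamma (?s / 2 + 1/2) * exp ((?s - 1) * of_real l2) * exp (- of_real (lp / 2))"
    unfolding dup spi by (simp add: exp_diff exp_minus field_simps flip: exp_add)
  have l2p: "of_real (ln (2 * pi)) = (of_real l2 + of_real lp :: complex)" by (simp add: l2_def lp_def ln_mult)
  have "zeta_chi ?s * (2 * cos (of_real (pi * s / 2)) * Gamma ?s * exp (- ?s * of_real (ln (2 * pi))))
      = (of_real pi powr (?s - 1/2) * exp ((?s - 1) * of_real l2) * exp (- of_real (lp / 2)) * exp (- ?s * of_real (ln (2 * pi))) * 2)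
         * (rGamma (?s / 2) * Gamma (?s / 2)) * (cos (of_real (pi * s / 2)) * (Gamma ((1 - ?s) / 2) * Gamma (?s / 2 + 1/2)))"
    unfolding zeta_chi_def by (subst GS) (simp only: mult_ac)
  also have "rGamma (?s / 2) * Gamma (?s / 2) = 1"
    using G0 by (simp add: Gamma_def)
  also have "cos (of_real (pi * s / 2)) * (Gamma ((1 - ?s) / 2) * Gamma (?s / 2 + 1/2)) = exp (of_real lp)"
    unfolding refl using C0 pie by simp
  also have "of_real pi powr (?s - 1/2) = exp ((?s - 1/2) * of_real lp)"
    by (simp add: powr_def lp_def Ln_of_real)
  also have "exp ((?s - 1/2) * of_real lp) * exp ((?s - 1) * of_real l2) * exp (- of_real (lp / 2)) * exp (- ?s * of_real (ln (2 * pi))) * 2 * 1 * exp (of_real lp)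
      = exp ((?s - 1/2) * of_real lp + (?s - 1) * of_real l2 + - of_real (lp / 2) + - ?s * of_real (ln (2 * pi)) + of_real l2 + of_real lp)"
    by (simp only: two exp_add mult_1_right)
  also have "(?s - 1/2) * of_real lp + (?s - 1) * of_real l2 + - of_real (lp / 2) + - ?s * of_real (ln (2 * pi)) + of_real l2 + of_real lp = 0"
    unfolding l2p by (simp add: field_simps)
  finally show ?thesis by simp
qed

section \<open>Continuation of the zeta function\<close>

definition dirichlet_zeta :: "complex \<Rightarrow> complex" where
  "dirichlet_zeta s = (\<Sum>n. 1 / of_nat (Suc n) powr s)"

lemma norm_dirichlet_term: "norm (1 / of_nat (Suc n) powr s :: complex) = real (Suc n) powr (- Re s)"
  unfolding powr_minus_divide by (simp add: norm_divide norm_powr_real_powr del: of_nat_Suc)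

lemma summable_dirichlet_majorant:
  assumes "r > 1"
  shows "summable (\<lambda>n. real (Suc n) powr (- r))"
proof -
  have "summable (\<lambda>n. real n powr (- r))" using assms by (simp add: summable_real_powr_iff)
  then show ?thesis by (subst summable_Suc_iff)
qed

lemma dirichlet_zeta_sums:
  assumes "Re s > 1"
  shows "(\<lambda>n. 1 / of_nat (Suc n) powr s) sums dirichlet_zeta s"
proof -
  have "summable (\<lambda>n. norm (1 / of_nat (Suc n) powr s :: complex))"
    unfolding norm_dirichlet_term using assms by (rule summable_dirichlet_majorant)
  then show ?thesis unfolding dirichlet_zeta_def by (rule summable_sums[OF summable_norm_cancel])
qed

lemma holomorphic_dirichlet_zeta: "dirichlet_zeta holomorphic_on {s. Re s > 1}"
proof (rule holomorphic_uniform_sequence)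
  show "open {s. Re s > 1}" by (rule open_halfspace_Re_gt)
  show "(\<lambda>s. \<Sum>k<n. 1 / of_nat (Suc k) powr s) holomorphic_on {s. Re s > 1}" for n
    by (intro holomorphic_intros) (auto simp del: of_nat_Suc)
  fix s assume "s \<in> {s. Re s > 1}"
  \<comment> \<open>Half the distance of s from the line Re = 1, so that the exponent 1 + d
    dominates on the whole disc.\<close>
  define d where "d = (Re s - 1) / 2"
  have d: "d > 0" and ds: "Re s = 1 + 2 * d" using \<open>s \<in> {s. Re s > 1}\<close> by (auto simp: d_def field_simps)
  have Re: "1 + d \<le> Re w" if "w \<in> cball s d" for w
    using that abs_Re_le_cmod[of "s - w"] ds by (auto simp: dist_norm)
  have "uniform_limit (cball s d) (\<lambda>n s. \<Sum>k<n. 1 / of_nat (Suc k) powr s) dirichlet_zeta sequentially"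
    unfolding dirichlet_zeta_def[abs_def]
  proof (rule Weierstrass_m_test)
    show "norm (1 / of_nat (Suc n) powr w :: complex) \<le> real (Suc n) powr (- (1 + d))" if "w \<in> cball s d" for n w
      unfolding norm_dirichlet_term using Re[OF that] by (intro powr_mono) auto
    show "summable (\<lambda>n. real (Suc n) powr (- (1 + d)))" using d by (intro summable_dirichlet_majorant) auto
  qed
  moreover have "cball s d \<subseteq> {s. Re s > 1}" using Re d by fastforce
  ultimately show "\<exists>d>0. cball s d \<subseteq> {s. Re s > 1} \<and>
      uniform_limit (cball s d) (\<lambda>n s. \<Sum>k<n. 1 / of_nat (Suc k) powr s) dirichlet_zeta sequentially"
    using d by blast
qed

text \<open>
  The functional equation solved for \<open>\<zeta>\<close>: a formula holomorphic on \<open>Re s < 3\<close> away from \<open>1\<close>. The poles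
  of \<open>\<chi>\<close> at \<open>3, 5, \<dots>\<close> are the reason to stop there.
\<close>

definition zeta_left :: "complex \<Rightarrow> complex" where
  "zeta_left s = riemann_aux_bar (1/2) s + zeta_chi s * riemann_aux (1/2) (1 - s)"

lemma holomorphic_zeta_chi:
  assumes "\<And>s. s \<in> A \<Longrightarrow> (1 - s) / 2 \<notin> \<int>\<^sub>\<le>\<^sub>0"
  shows "zeta_chi holomorphic_on A"
  unfolding zeta_chi_def[abs_def] by (intro holomorphic_intros) (use assms in auto)

lemma nonpos_Ints_half:
  fixes s :: complex
  assumes "(1 - s) / 2 \<in> \<int>\<^sub>\<le>\<^sub>0"
  obtains n :: nat where "s = 1 + 2 * of_nat n"
proof -
  from assms obtain n :: nat where "(1 - s) / 2 = - of_nat n" by (elim nonpos_Ints_cases')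
  then have "s = 1 + 2 * of_nat n" by (simp add: field_simps)
  then show ?thesis by (rule that)
qed

lemma holomorphic_zeta_left: "zeta_left holomorphic_on {s. Re s < 3} - {1}"
proof -
  have "zeta_chi holomorphic_on {s. Re s < 3} - {1}"
  proof (rule holomorphic_zeta_chi)
    fix s assume s: "s \<in> {s. Re s < 3} - {1}"
    show "(1 - s) / 2 \<notin> \<int>\<^sub>\<le>\<^sub>0"
    proof
      assume "(1 - s) / 2 \<in> \<int>\<^sub>\<le>\<^sub>0"
      then obtain n :: nat where n: "s = 1 + 2 * of_nat n" by (rule nonpos_Ints_half)
      then have "n = 0" using s by simp
      then show False using n s by simp
    qed
  qed
  moreover have "(\<lambda>s. riemann_aux (1/2) (1 - s)) holomorphic_on {s. Re s < 3} - {1}"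
    by (intro holomorphic_on_compose[OF _ holomorphic_on_subset[OF holomorphic_riemann_aux], unfolded o_def] holomorphic_intros) auto
  moreover have "riemann_aux_bar (1/2) holomorphic_on {s. Re s < 3} - {1}"
    by (rule holomorphic_on_subset[OF holomorphic_riemann_aux_bar]) auto
  ultimately show ?thesis unfolding zeta_left_def[abs_def] by (intro holomorphic_intros)
qed

lemma zeta_left_eq_dirichlet_real:
  assumes "2 < x" "x < 3"
  shows "zeta_left (of_real x) = dirichlet_zeta (of_real x)"
proof -
  have "zeta_chi (of_real x) * riemann_aux (1/2) (of_real (1 - x)) =
      (zeta_chi (of_real x) * (2 * cos (of_real (pi * x / 2)) * Gamma (of_real x) * exp (- of_real x * of_real (ln (2 * pi)))))
        * (dirichlet_zeta (of_real x) - riemann_aux_bar (1/2) (of_real x))"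
    unfolding riemann_aux_functional_real[OF assms(1)] dirichlet_zeta_def by (simp only: mult.assoc)
  also have "\<dots> = dirichlet_zeta (of_real x) - riemann_aux_bar (1/2) (of_real x)"
    unfolding zeta_chi_real[OF assms] by simp
  finally show ?thesis by (simp add: zeta_left_def)
qed

lemma real_interval_islimpt: "(of_real (5/2) :: complex) islimpt of_real ` {2<..<3}"
  unfolding islimpt_approachable
proof (intro allI impI)
  fix e :: real assume e: "e > 0"
  define d where "d = min (e / 2) (1/4)"
  have d: "0 < d" "d < e" "d \<le> 1/4" using e by (auto simp: d_def)
  have "dist (of_real (5/2 + d)) (of_real (5/2) :: complex) = d"
    unfolding dist_of_real using d by (simp add: dist_real_def)
  moreover have "of_real (5/2 + d) \<noteq> (of_real (5/2) :: complex)" unfolding of_real_eq_iff using d by simp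
  ultimately show "\<exists>x'\<in>of_real ` {2<..<3}. x' \<noteq> of_real (5/2) \<and> dist x' (of_real (5/2) :: complex) < e"
    using d by (intro bexI[of _ "of_real (5/2 + d)"] imageI) auto
qed

text \<open>Stated for an arbitrary continuation \<open>f\<close>, because
  \<open>riemann_zeta\<close> is fixed only by a choice; agreement on the real interval (2, 3)
  spreads over the connected punctured half-plane.\<close>

lemma dirichlet_zeta_continuation:
  assumes "f holomorphic_on UNIV - {1}" "\<And>s. Re s > 1 \<Longrightarrow> f s = dirichlet_zeta s" "Re s < 3" "s \<noteq> 1"
  shows "f s = zeta_left s"
proof -
  let ?S = "{s. Re s < 3} - {1 :: complex}"
  have op: "open {s. Re s < 3}" by (rule open_halfspace_Re_lt)
  have "f s - zeta_left s = 0"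
  proof (rule analytic_continuation[where S = ?S and U = "of_real ` {2<..<3}" and \<xi> = "of_real (5/2)" and f = "\<lambda>s. f s - zeta_left s"])
    show "(\<lambda>s. f s - zeta_left s) holomorphic_on ?S"
      by (intro holomorphic_intros holomorphic_zeta_left holomorphic_on_subset[OF assms(1)]) auto
    show "open ?S" using op by (intro open_Diff) auto
    show "connected ?S"
      by (intro connected_open_delete op convex_connected convex_halfspace_Re_lt) simp
    show "of_real ` {2<..<3} \<subseteq> ?S" by (auto simp: complex_eq_iff)
    show "of_real (5/2) \<in> ?S" by (auto simp: complex_eq_iff)
    show "f z - zeta_left z = 0" if "z \<in> of_real ` {2<..<3}" for z
      using that assms(2) zeta_left_eq_dirichlet_real by auto
  qed (use assms real_interval_islimpt in auto)
  then show ?thesis by simp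
qed

lemma dirichlet_zeta_eq_left:
  assumes "1 < Re s" "Re s < 3"
  shows "dirichlet_zeta s = zeta_left s"
proof -
  let ?S = "{s. 1 < Re s} \<inter> {s. Re s < 3}"
  have "dirichlet_zeta s - zeta_left s = 0"
  proof (rule analytic_continuation[where S = ?S and U = "of_real ` {2<..<3}" and \<xi> = "of_real (5/2)" and f = "\<lambda>s. dirichlet_zeta s - zeta_left s"])
    show "(\<lambda>s. dirichlet_zeta s - zeta_left s) holomorphic_on ?S"
      by (intro holomorphic_intros holomorphic_on_subset[OF holomorphic_zeta_left] holomorphic_on_subset[OF holomorphic_dirichlet_zeta]) auto
    show "open ?S" by (intro open_Int open_halfspace_Re_gt open_halfspace_Re_lt)
    show "connected ?S" by (intro convex_connected convex_Int convex_halfspace_Re_gt convex_halfspace_Re_lt)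
    show "dirichlet_zeta z - zeta_left z = 0" if "z \<in> of_real ` {2<..<3}" for z
      using that zeta_left_eq_dirichlet_real by auto
  qed (use assms real_interval_islimpt in auto)
  then show ?thesis by simp
qed

text \<open>The choice is legitimate once some continuation exists: the Dirichlet series and
  \<open>zeta_left\<close> agree on 1 < Re s < 3, and their domains together omit only the point
  1.\<close>

lemma riemann_zeta_props:
  "riemann_zeta holomorphic_on UNIV - {1}" "\<And>s. Re s > 1 \<Longrightarrow> riemann_zeta s = dirichlet_zeta s"
proof -
  define Z where "Z = (\<lambda>s. if Re s > 1 then dirichlet_zeta s else zeta_left s)"
  have "Z holomorphic_on {s. Re s > 1} \<union> ({s. Re s < 3} - {1})"
  proof (rule holomorphic_on_Un)
    show "Z holomorphic_on {s. Re s > 1}"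
      by (rule holomorphic_transform[OF holomorphic_dirichlet_zeta]) (simp add: Z_def)
    show "Z holomorphic_on {s. Re s < 3} - {1}"
      by (rule holomorphic_transform[OF holomorphic_zeta_left]) (simp add: Z_def dirichlet_zeta_eq_left)
  qed (auto intro!: open_halfspace_Re_gt open_halfspace_Re_lt open_Diff)
  moreover have "{s. Re s > 1} \<union> ({s. Re s < 3} - {1}) = UNIV - {1 :: complex}" by auto
  ultimately have "Z holomorphic_on UNIV - {1}" by simp
  moreover have "\<forall>s. Re s > 1 \<longrightarrow> (\<lambda>n. 1 / of_nat (Suc n) powr s) sums Z s"
    using dirichlet_zeta_sums by (simp add: Z_def del: of_nat_Suc)
  ultimately have "\<exists>f. f holomorphic_on (UNIV - {1}) \<and> (\<forall>s. Re s > 1 \<longrightarrow> (\<lambda>n. 1 / of_nat (Suc n) powr s) sums f s)"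
    by blast
  then have *: "riemann_zeta holomorphic_on (UNIV - {1}) \<and> (\<forall>s. Re s > 1 \<longrightarrow> (\<lambda>n. 1 / of_nat (Suc n) powr s) sums riemann_zeta s)"
    unfolding riemann_zeta_def by (rule someI_ex)
  then show "riemann_zeta holomorphic_on UNIV - {1}" by blast
  show "riemann_zeta s = dirichlet_zeta s" if "Re s > 1" for s
    using * that dirichlet_zeta_sums[OF that] sums_unique2 by blast
qed

lemma zeta_chi_mult:
  assumes "(1 - s) / 2 \<notin> \<int>\<^sub>\<le>\<^sub>0" "s / 2 \<notin> \<int>\<^sub>\<le>\<^sub>0"
  shows "zeta_chi s * zeta_chi (1 - s) = 1"
proof -
  have G: "Gamma z * rGamma z = 1" if "z \<notin> \<int>\<^sub>\<le>\<^sub>0" for z :: complex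
    using that by (simp add: Gamma_def rGamma_eq_zero_iff)
  have "zeta_chi s * zeta_chi (1 - s) = (of_real pi powr (s - 1/2) * of_real pi powr (1 - s - 1/2)) *
      (Gamma ((1 - s) / 2) * rGamma ((1 - s) / 2)) * (Gamma (s / 2) * rGamma (s / 2))"
    unfolding zeta_chi_def by simp
  also have "\<dots> = of_real pi powr (s - 1/2) * of_real pi powr (1 - s - 1/2)"
    unfolding G[OF assms(1)] G[OF assms(2)] by simp
  also have "\<dots> = of_real pi powr ((s - 1/2) + (1 - s - 1/2))" by (rule powr_add[symmetric])
  also have "\<dots> = 1" by simp
  finally show ?thesis .
qed

text \<open>Using \<open>zeta_left\<close> at 1 - s requires Re (1 - s) < 3, that is Re s > -2.
  Further left the identity is continued within Re s < 0, where chi has no poles.\<close>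

lemma riemann_aux_zeta:
  assumes s: "(1 - s) / 2 \<notin> \<int>\<^sub>\<le>\<^sub>0" "s \<noteq> 0"
  shows "riemann_aux (1/2) s = zeta_chi s * (riemann_zeta (1 - s) - riemann_aux_bar (1/2) (1 - s))"
proof -
  have right: "riemann_aux (1/2) s = zeta_chi s * (riemann_zeta (1 - s) - riemann_aux_bar (1/2) (1 - s))"
    if "(1 - s) / 2 \<notin> \<int>\<^sub>\<le>\<^sub>0" "s \<noteq> 0" "Re s > -2" for s
  proof -
    have s2: "s / 2 \<notin> \<int>\<^sub>\<le>\<^sub>0"
    proof
      assume "s / 2 \<in> \<int>\<^sub>\<le>\<^sub>0"
      then obtain n :: nat where "s / 2 = - of_nat n" by (elim nonpos_Ints_cases')
      then have n: "s = - 2 * of_nat n" by (simp add: field_simps)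
      then have "n = 0" using that by simp
      then show False using n that by simp
    qed
    have "riemann_zeta (1 - s) = zeta_left (1 - s)"
      by (rule dirichlet_zeta_continuation[OF riemann_zeta_props]) (use that in auto)
    then have "zeta_chi s * (riemann_zeta (1 - s) - riemann_aux_bar (1/2) (1 - s)) = (zeta_chi s * zeta_chi (1 - s)) * riemann_aux (1/2) s"
      by (simp add: zeta_left_def)
    then show ?thesis unfolding zeta_chi_mult[OF that(1) s2] by simp
  qed
  show ?thesis
  proof (cases "Re s > -2")
    case True
    then show ?thesis using right s by blast
  next
    case False
    let ?S = "{s. Re s < 0}"
    have nI: "(1 - z) / 2 \<notin> \<int>\<^sub>\<le>\<^sub>0" if "z \<in> ?S" for z
    proof
      assume "(1 - z) / 2 \<in> \<int>\<^sub>\<le>\<^sub>0"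
      then obtain n :: nat where "z = 1 + 2 * of_nat n" by (rule nonpos_Ints_half)
      then show False using that by simp
    qed
    have "riemann_aux (1/2) s - zeta_chi s * (riemann_zeta (1 - s) - riemann_aux_bar (1/2) (1 - s)) = 0"
    proof (rule analytic_continuation_open[where s = "{s. -2 < Re s} \<inter> ?S" and s' = ?S and g = "\<lambda>_. 0"
          and f = "\<lambda>s. riemann_aux (1/2) s - zeta_chi s * (riemann_zeta (1 - s) - riemann_aux_bar (1/2) (1 - s))"])
      show "open ({s. -2 < Re s} \<inter> ?S)" by (intro open_Int open_halfspace_Re_gt open_halfspace_Re_lt)
      show "open ?S" by (rule open_halfspace_Re_lt)
      have "of_real (-1) \<in> {s. -2 < Re s} \<inter> ?S" by simp
      then show "{s. -2 < Re s} \<inter> ?S \<noteq> {}" by blast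
      show "connected ?S" by (intro convex_connected convex_halfspace_Re_lt)
      have "(\<lambda>s. riemann_zeta (1 - s)) holomorphic_on ?S"
        by (rule holomorphic_on_compose[OF _ holomorphic_on_subset[OF riemann_zeta_props(1)], unfolded o_def])
           (auto intro!: holomorphic_intros)
      moreover have "(\<lambda>s. riemann_aux_bar (1/2) (1 - s)) holomorphic_on ?S"
        by (rule holomorphic_on_compose[OF _ holomorphic_on_subset[OF holomorphic_riemann_aux_bar], unfolded o_def])
           (auto intro!: holomorphic_intros)
      moreover have "riemann_aux (1/2) holomorphic_on ?S"
        by (rule holomorphic_on_subset[OF holomorphic_riemann_aux]) auto
      ultimately show "(\<lambda>s. riemann_aux (1/2) s - zeta_chi s * (riemann_zeta (1 - s) - riemann_aux_bar (1/2) (1 - s))) holomorphic_on ?S"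
        by (intro holomorphic_intros holomorphic_zeta_chi nI)
      show "riemann_aux (1/2) z - zeta_chi z * (riemann_zeta (1 - z) - riemann_aux_bar (1/2) (1 - z)) = 0"
        if "z \<in> {s. -2 < Re s} \<inter> ?S" for z
        using right[of z] nI[of z] that by force
    qed (use False in auto)
    then show ?thesis by simp
  qed
qed

lemma riemann_aux_eq_half:
  assumes "0 < c" "c < 1"
  shows "riemann_aux c s = riemann_aux (1/2) s"
  using riemann_aux_eq_cnj[of "1/2" s]
  by (simp add: riemann_aux_eq_cnj[OF assms(1)] riemann_aux_bar_eq_half[OF assms])

section \<open>The asymptotic formula\<close>

text \<open>Arg (eta) + pi/4 is half the argument of s - 1, hence lies between theta/2 and pi -
  theta/2, and (Re eta + Im eta) / sqrt 2 is |eta| times its sine.\<close>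

lemma eta_props:
  assumes "0 < \<theta>" "\<theta> < Arg2pi (s - 1)" "Arg2pi (s - 1) < 2 * pi - \<theta>"
  shows "(eta s)\<^sup>2 = (s - 1) / (2 * of_real pi * \<i>)"
    and "- (pi / 4) < Arg (eta s)" "Arg (eta s) < 3 * pi / 4"
    and "eta s \<noteq> 0"
    and "sin (\<theta> / 2) * norm (eta s) \<le> (Re (eta s) + Im (eta s)) / sqrt 2"
proof -
  have pos: "0 < Arg2pi (s - 1)" using assms by linarith
  have eta: "(eta s)\<^sup>2 = (s - 1) / (2 * of_real pi * \<i>) \<and> - (pi / 4) < Arg (eta s) \<and> Arg (eta s) < 3 * pi / 4"
    unfolding eta_def by (rule theI'[OF eta_ex1[OF pos]])
  then show sq: "(eta s)\<^sup>2 = (s - 1) / (2 * of_real pi * \<i>)"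
    and arg: "- (pi / 4) < Arg (eta s)" "Arg (eta s) < 3 * pi / 4" by auto
  have "s - 1 \<noteq> 0" using pos by (auto simp: Arg2pi_0)
  then show nz: "eta s \<noteq> 0" using sq by auto
  define r a where "r = norm (eta s)" and "a = Arg (eta s)"
  have ra: "eta s = of_real r * cis a" using nz rcis_cmod_Arg[of "eta s"] by (simp add: r_def a_def rcis_def)
  have r: "r > 0" using nz by (simp add: r_def)
  have "s - 1 = 2 * of_real pi * \<i> * (eta s)\<^sup>2" unfolding sq by simp
  also have "\<dots> = of_real (2 * pi * r\<^sup>2) * (cis (pi / 2) * (cis a)\<^sup>2)" by (simp add: ra power_mult_distrib)
  also have "cis (pi / 2) * (cis a)\<^sup>2 = exp (\<i> * of_real (2 * a + pi / 2))"
    by (simp only: Complex.DeMoivre cis_mult cis_conv_exp[symmetric]) (simp add: add.commute)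
  finally have "Arg2pi (s - 1) = 2 * a + pi / 2"
    using r arg by (intro Arg2pi_unique[of "2 * pi * r\<^sup>2"]) (auto simp: a_def)
  then have a: "\<theta> / 2 \<le> a + pi / 4" "a + pi / 4 \<le> pi - \<theta> / 2" using assms by auto
  have th: "\<theta> \<le> pi" using assms by linarith
  have "sin (\<theta> / 2) \<le> sin (a + pi / 4)"
  proof (cases "a + pi / 4 \<le> pi / 2")
    case True
    then show ?thesis using a assms by (intro sin_monotone_2pi_le) auto
  next
    case False
    have "sin (\<theta> / 2) \<le> sin (pi - (a + pi / 4))" using a assms False by (intro sin_monotone_2pi_le) auto
    then show ?thesis by (simp only: sin_pi_minus)
  qed
  moreover have "sin (a + pi / 4) = (cos a + sin a) / sqrt 2"
  proof -
    have "sqrt 2 / 2 = 1 / sqrt 2" by (simp add: real_div_sqrt field_simps)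
    then show ?thesis unfolding sin_add sin_45 cos_45 by (simp only:) (simp add: add_divide_distrib)
  qed
  moreover have "(Re (eta s) + Im (eta s)) / sqrt 2 = r * ((cos a + sin a) / sqrt 2)"
    unfolding ra by (simp add: field_simps)
  ultimately show "sin (\<theta> / 2) * norm (eta s) \<le> (Re (eta s) + Im (eta s)) / sqrt 2"
    using r by (simp only: r_def[symmetric] mult.commute[of _ r]) (intro mult_left_mono; simp)
qed

theorem theorem21:
  fixes \<theta> :: real
  assumes "0 < \<theta>" and "\<theta> < pi"
  shows "\<exists>C::real. \<forall>(c::real) (s::complex).
    0 < c \<longrightarrow> c < 1 \<longrightarrow>
    norm (s - 1) \<ge> 2 * pi \<longrightarrow> \<theta> < Arg2pi (s - 1) \<longrightarrow> Arg2pi (s - 1) < 2 * pi - \<theta> \<longrightarrow>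
    (\<exists>\<epsilon>::complex. norm \<epsilon> \<le> C / norm (eta s) \<and>
      riemann_aux c s =
        zeta_chi s *
          (riemann_zeta (1 - s)
            - (\<Sum>n=1..eta_floor s. 1 / of_nat n powr (1 - s))
            + (-1) ^ eta_floor s / (2 * \<i>) * eta s powr (s - 1)
                * exp (- (of_real pi * \<i> * (eta s)\<^sup>2)) * riemann_G_bar (eta_p s) * (1 + \<epsilon>)))"
proof -
  have "0 < sin (\<theta> / 2)" using assms by (intro sin_gt_zero) auto
  then obtain C1 where C1: "\<And>\<eta> m. \<eta> \<noteq> 0 \<Longrightarrow> sin (\<theta> / 2) * norm \<eta> \<le> (Re \<eta> + Im \<eta>) / sqrt 2 \<Longrightarrow>
      real m \<le> Re \<eta> + Im \<eta> \<Longrightarrow> Re \<eta> + Im \<eta> < real m + 1 \<Longrightarrow>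
      norm (line_integral se (real m + 1/2) (\<lambda>x. exp (phase \<eta> x - phase \<eta> \<eta>) / sin_den x)
        - (-1) ^ m * saddle_gauss (\<eta> - of_nat m)) \<le> C1 / norm \<eta> * exp (- (pi * \<bar>Im \<eta>\<bar>))"
    using saddle_estimate[OF \<open>0 < sin (\<theta> / 2)\<close>] by blast
  obtain C0 where C0: "C0 > 0" "\<And>p. \<bar>Re p + Im p\<bar> \<le> 1 \<Longrightarrow>
      C0 * exp (- (pi * \<bar>Im p\<bar> / 2)) \<le> norm (saddle_gauss ((1 + p) / 2))"
    using saddle_gauss_lower_bound by blast
  show ?thesis
  \<comment> \<open>\<open>C1\<close> depends on theta through sin (theta/2), while
    \<open>C0\<close> is absolute.\<close>
  proof (intro exI[of _ "C1 / C0"] allI impI)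
    fix c :: real and s :: complex
    assume c: "0 < c" "c < 1" and s: "2 * pi \<le> norm (s - 1)" "\<theta> < Arg2pi (s - 1)" "Arg2pi (s - 1) < 2 * pi - \<theta>"
    define \<eta> m p where "\<eta> = eta s" and "m = eta_floor s" and "p = eta_p s"
    note eta = eta_props[OF assms(1) s(2,3), folded \<eta>_def]
    have "0 \<le> sin (\<theta> / 2) * norm \<eta>" using \<open>0 < sin (\<theta> / 2)\<close> by simp
    \<comment> \<open>Makes \<open>nat\<close> of the floor exact.\<close>
    then have nonneg: "0 \<le> Re \<eta> + Im \<eta>" using eta(5) by (smt (verit) divide_less_0_iff real_sqrt_gt_zero)
    then have m: "real m \<le> Re \<eta> + Im \<eta>" "Re \<eta> + Im \<eta> < real m + 1"
      unfolding m_def eta_floor_def \<eta>_def[symmetric] by linarith+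
    have p: "(1 + p) / 2 = \<eta> - of_nat m"
      unfolding p_def eta_p_def \<eta>_def[symmetric] m_def[symmetric] by (simp add: field_simps)
    have "p = 2 * \<eta> - 2 * of_nat m - 1"
      unfolding p_def eta_p_def \<eta>_def[symmetric] m_def[symmetric] by (simp add: algebra_simps)
    then have Rp: "Re p = 2 * Re \<eta> - 2 * real m - 1" and Ip: "Im p = 2 * Im \<eta>" by auto
    have pm: "\<bar>Re p + Im p\<bar> \<le> 1" using m unfolding Rp Ip by linarith
    define Q where "Q = line_integral se (real m + 1/2) (\<lambda>x. exp (phase \<eta> x - phase \<eta> \<eta>) / sin_den x)"
    define g where "g = (-1) ^ m * saddle_gauss (\<eta> - of_nat m)"
    have Qg: "norm (Q - g) \<le> C1 / norm \<eta> * exp (- (pi * \<bar>Im \<eta>\<bar>))"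
      unfolding Q_def g_def by (rule C1[OF eta(4,5) m])
    have g: "C0 * exp (- (pi * \<bar>Im \<eta>\<bar>)) \<le> norm g"
      using C0(2)[OF pm] unfolding p Ip by (simp add: g_def norm_mult norm_power abs_mult)
    have g0: "norm g > 0" using g C0(1) by (meson exp_gt_zero less_le_trans mult_pos_pos)
    \<comment> \<open>The relative error of the model integral; the exponential factors of the upper
      and the lower bound cancel in the quotient.\<close>
    define \<epsilon> where "\<epsilon> = Q / g - 1"
    have Q: "Q = g * (1 + \<epsilon>)" using g0 by (simp add: \<epsilon>_def)
    have "norm \<epsilon> = norm (Q - g) / norm g" using g0 by (simp add: \<epsilon>_def diff_divide_distrib flip: norm_divide)
    also have "\<dots> \<le> (C1 / norm \<eta> * exp (- (pi * \<bar>Im \<eta>\<bar>))) / (C0 * exp (- (pi * \<bar>Im \<eta>\<bar>)))"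
      using Qg g C0(1) by (intro frac_le) (auto intro: order_trans[OF norm_ge_zero])
    also have "\<dots> = C1 / C0 / norm \<eta>" by (simp add: field_simps)
    finally have \<epsilon>: "norm \<epsilon> \<le> C1 / C0 / norm \<eta>" .
    have s1: "s - 1 = 2 * of_real pi * \<i> * \<eta>\<^sup>2" unfolding eta(1) by simp
    \<comment> \<open>Since s - 1 = 2 pi i eta^2, the numerator of the kernel at 1 - s is exactly
      the exponential of the phase.\<close>
    have kernel: "riemann_kernel (1 - s) x = exp (phase \<eta> \<eta>) * (exp (phase \<eta> x - phase \<eta> \<eta>) / sin_den x)" for x
    proof -
      have "riemann_kernel (1 - s) x = exp ((s - 1) * Ln x - of_real pi * \<i> * x\<^sup>2) / sin_den x"
        unfolding riemann_kernel_def by (simp add: algebra_simps flip: exp_add)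
      also have "(s - 1) * Ln x - of_real pi * \<i> * x\<^sup>2 = phase \<eta> \<eta> + (phase \<eta> x - phase \<eta> \<eta>)"
        unfolding s1 phase_def by (simp add: algebra_simps)
      finally show ?thesis by (simp only: exp_add times_divide_eq_right)
    qed
    have "exp (phase \<eta> \<eta>) = \<eta> powr (s - 1) * exp (- (of_real pi * \<i> * \<eta>\<^sup>2))"
      using eta(4) unfolding powr_def s1 phase_def by (simp add: algebra_simps flip: exp_add)
    moreover have "line_integral se (real m + 1/2) (riemann_kernel (1 - s)) = exp (phase \<eta> \<eta>) * Q"
      by (simp only: Q_def kernel line_integral_def mult.assoc integral_mult_right_zero)
    moreover have "exp (- (1 - s) * Ln (of_nat n)) = 1 / of_nat n powr (1 - s)" if "n \<ge> 1" for n :: nat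
      using that by (simp add: powr_def exp_minus exp_diff field_simps flip: exp_add)
    then have "(\<Sum>n=1..m. exp (- (1 - s) * Ln (of_nat n))) = (\<Sum>n=1..m. 1 / of_nat n powr (1 - s))"
      by (intro sum.cong) auto
    ultimately have bar: "riemann_aux_bar (1/2) (1 - s) = (\<Sum>n=1..m. 1 / of_nat n powr (1 - s))
        + \<eta> powr (s - 1) * exp (- (of_real pi * \<i> * \<eta>\<^sup>2)) * Q"
      using riemann_aux_bar_shift[of "1/2" "1 - s" m] by simp
    have "\<eta> powr (s - 1) * exp (- (of_real pi * \<i> * \<eta>\<^sup>2)) * Q =
       - ((-1) ^ m / (2 * \<i>) * \<eta> powr (s - 1) * exp (- (of_real pi * \<i> * \<eta>\<^sup>2)) * riemann_G_bar p * (1 + \<epsilon>))"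
    proof -
      \<comment> \<open>The factor -2 i of \<open>riemann_G_bar_eq\<close> turns 1 / (2 i) into -1;
        this accounts for the plus sign before the main term.\<close>
      have "x / (2 * \<i>) * a * b * (- 2 * \<i> * S) * d = - (a * b * (x * S * d))" for x a b S d :: complex
        by (simp add: field_simps)
      then show ?thesis unfolding riemann_G_bar_eq p Q g_def by (simp only: minus_minus)
    qed
    then have main: "riemann_zeta (1 - s) - riemann_aux_bar (1/2) (1 - s) = riemann_zeta (1 - s) - (\<Sum>n=1..m. 1 / of_nat n powr (1 - s))
       + (-1) ^ m / (2 * \<i>) * \<eta> powr (s - 1) * exp (- (of_real pi * \<i> * \<eta>\<^sup>2)) * riemann_G_bar p * (1 + \<epsilon>)"
      unfolding bar by (simp only:) simp
    \<comment> \<open>The poles 1, 3, 5, ... of chi have \<open>Arg2pi\<close> (s - 1) = 0 and lie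
      outside the sector.\<close>
    have "(1 - s) / 2 \<notin> \<int>\<^sub>\<le>\<^sub>0"
    proof
      assume "(1 - s) / 2 \<in> \<int>\<^sub>\<le>\<^sub>0"
      then obtain n :: nat where "s = 1 + 2 * of_nat n" by (rule nonpos_Ints_half)
      then have "s - 1 = of_real (2 * real n)" by simp
      then have "Arg2pi (s - 1) = 0" by (simp only: Arg2pi_of_real) simp
      then show False using s(2) assms(1) by simp
    qed
    \<comment> \<open>At s = 0 the distance |s - 1| would be 1 < 2 pi.\<close>
    moreover have "s \<noteq> 0" using s(1) pi_gt3 by auto
    ultimately have "riemann_aux c s = zeta_chi s * (riemann_zeta (1 - s) - riemann_aux_bar (1/2) (1 - s))"
      unfolding riemann_aux_eq_half[OF c] by (rule riemann_aux_zeta)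
    then show "\<exists>\<epsilon>. norm \<epsilon> \<le> C1 / C0 / norm (eta s) \<and>
      riemann_aux c s =
        zeta_chi s *
          (riemann_zeta (1 - s)
            - (\<Sum>n=1..eta_floor s. 1 / of_nat n powr (1 - s))
            + (-1) ^ eta_floor s / (2 * \<i>) * eta s powr (s - 1)
                * exp (- (of_real pi * \<i> * (eta s)\<^sup>2)) * riemann_G_bar (eta_p s) * (1 + \<epsilon>))"
      unfolding main using \<epsilon> unfolding \<eta>_def m_def p_def by blast
  qed
qed

end
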